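(* Let $m\ge3$ be odd. Then $$\mathrm{sch}[\mathcal U^{(m)}](\tau)=\frac{\eta(m\tau)^3}{\eta(\tau)^{2m-1}}\,\mathbb F_m(\tau),$$ where $\mathbb F_m(\tau)\in\mathbb Q[E_2(\tau),E_4(\tau),E_6(\tau),E_2(m\tau),E_4(m\tau),E_6(m\tau)]$ is a quasi-modular form on $\Gamma_0(m)$.
   Context: Let $\tau$ be in the upper half-plane, $q=e^{2\pi i\tau}$, $\zeta=e^{2\pi iz}$, $\eta(\tau)=q^{1/24}\prod_{i\ge1}(1-q^i)$, $E_{2j}(\tau)=1-\frac{4j}{B_{2j}}\sum_{n\ge1}\frac{n^{2j-1}q^n}{1-q^n}$ with $B_{2j}$ the Bernoulli numbers, and $\vartheta(z;\tau)=\sum_{n\in\mathbb Z+\frac12}e^{\pi in^2\tau+2\pi in(z+\frac12)}$. For $m\ge3$, $\mathcal U^{(m)}$ is the Adamović–Milas vertex operator (super)algebra, an infinite (super)extension of the simple affine vertex operator algebra $V_{-1}(\mathfrak{sl}(m))$ of central charge $-(m+1)$; for $m$ odd it is a $\mathbb Z_{\ge 0}$-graded vertex operator superalgebra. Its supercharacter $\mathrm{sch}$ is the difference of the graded characters of the even and odd subspaces. By a theorem of Adamović and Milas (taken as known), for $m$ odd $$\mathrm{sch}[\mathcal U^{(m)}](\tau)=\mathrm{CT}_\zeta F_m(z;\tau),\qquad F_m(z;\tau)=\epsilon_m\,\eta(\tau)^{m+1}\frac{\vartheta(mz;m\tau)}{\vartheta(z;\tau)^m},$$ where $\mathrm{CT}_\zeta$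 denotes the coefficient of $\zeta^0$ in the Laurent expansion in $\zeta$ on the annulus $|q|<|\zeta^{-1}|<1$, and $\epsilon_m\ne0$ is the constant for which the $q$-expansion $q^{(m+1)/24}(1+\cdots)$ has leading coefficient $1$. Giving $E_{2i}(\tau)$ and $E_{2i}(m\tau)$ weight $2i$, every weight-homogeneous polynomial in $E_{2i}(\tau),E_{2i}(m\tau)$, $i=1,2,3$, is a quasi-modular form on $\Gamma_0(m)$. *)

theory Defs
  imports "HOL-Complex_Analysis.Complex_Analysis" "HOL-Library.Poly_Mapping"
begin

abbreviation upper_half_plane :: "complex set" where
  "upper_half_plane \<equiv> {\<tau>. Im \<tau> > 0}"

text \<open>The power \<open>q\<^sup>a\<close> of \<open>q = e\<^sup>2\<^sup>\<pi>\<^sup>i\<^sup>\<tau>\<close>, the branch for non-integral \<open>a\<close> being fixed by \<open>\<tau>\<close>.\<close>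

definition qpow :: "complex \<Rightarrow> real \<Rightarrow> complex" where
  "qpow \<tau> a = exp (2 * of_real pi * \<i> * of_real a * \<tau>)"

definition dedekind_eta :: "complex \<Rightarrow> complex" where
  "dedekind_eta \<tau> = qpow \<tau> (1/24) * prodinf (\<lambda>i. 1 - qpow \<tau> 1 ^ Suc i)"

text \<open>The convention is \<open>t / (e\<^sup>t - 1) = \<Sum>\<^sub>n B\<^sub>n t\<^sup>n / n!\<close>.\<close>

definition bernoulli :: "nat \<Rightarrow> real" where
  "bernoulli n = fact n * fps_nth (fps_X / (fps_exp 1 - 1)) n"

text \<open>\<open>eisenstein_E k\<close> is \<open>E\<^sub>k\<close>, meant for even \<open>k = 2j > 0\<close>; so \<open>4j = 2k\<close>.\<close>

definition eisenstein_E :: "nat \<Rightarrow> complex \<Rightarrow> complex" where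
  "eisenstein_E k \<tau> = 1 - of_real (2 * of_nat k / bernoulli k) *
     suminf (\<lambda>n. of_nat (Suc n) ^ (k - 1) * qpow \<tau> 1 ^ Suc n / (1 - qpow \<tau> 1 ^ Suc n))"

text \<open>The summation index \<open>n \<in> \<int> + 1/2\<close> is written as \<open>k + 1/2\<close> with \<open>k\<close> an integer.\<close>

definition jacobi_vartheta :: "complex \<Rightarrow> complex \<Rightarrow> complex" where
  "jacobi_vartheta z \<tau> = (\<Sum>\<^sub>\<infinity>k\<in>(UNIV :: int set). let n = of_int k + 1/2 in
     exp (of_real pi * \<i> * n\<^sup>2 * \<tau> + 2 * of_real pi * \<i> * n * (z + 1/2)))"


section \<open>Constant terms\<close>

text \<open>
  With \<open>\<zeta> = e\<^sup>2\<^sup>\<pi>\<^sup>i\<^sup>z\<close>, the annulus \<open>\<bar>q\<bar> < \<bar>\<zeta>\<^sup>-\<^sup>1\<bar> < 1\<close> is the strip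
  \<open>- Im \<tau> < Im z < 0\<close>. A function of \<open>\<zeta>\<close> is given as a function of \<open>z\<close>.
\<close>

definition laurent_expansion :: "complex \<Rightarrow> (complex \<Rightarrow> complex) \<Rightarrow> (int \<Rightarrow> complex) \<Rightarrow> bool" where
  "laurent_expansion \<tau> f a \<longleftrightarrow> (\<forall>z. - Im \<tau> < Im z \<and> Im z < 0 \<longrightarrow>
     ((\<lambda>n. a n * exp (2 * of_real pi * \<i> * z) powi n) has_sum f z) UNIV)"

definition constant_term :: "complex \<Rightarrow> (complex \<Rightarrow> complex) \<Rightarrow> complex" where
  "constant_term \<tau> f = (THE a. laurent_expansion \<tau> f a) 0"

definition F_scaled :: "complex \<Rightarrow> nat \<Rightarrow> complex \<Rightarrow> complex \<Rightarrow> complex" where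
  "F_scaled e m \<tau> z = e * dedekind_eta \<tau> ^ (m + 1) *
     jacobi_vartheta (of_nat m * z) (of_nat m * \<tau>) / jacobi_vartheta z \<tau> ^ m"

text \<open>The nonzero constant that makes the \<open>q\<close>-expansion of the constant term
  equal to \<open>q\<^sup>(\<^sup>m\<^sup>+\<^sup>1\<^sup>)\<^sup>/\<^sup>2\<^sup>4 (1 + \<dots>)\<close>.\<close>

definition epsilon_const :: "nat \<Rightarrow> complex" where
  "epsilon_const m = (THE e. e \<noteq> 0 \<and> (\<exists>c :: nat \<Rightarrow> complex. c 0 = 1 \<and>
     (\<forall>\<tau>\<in>upper_half_plane. \<exists>s. (\<lambda>n. c n * qpow \<tau> 1 ^ n) sums s \<and>
        constant_term \<tau> (F_scaled e m \<tau>) = qpow \<tau> ((real m + 1) / 24) * s)))"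

definition F_fun :: "nat \<Rightarrow> complex \<Rightarrow> complex \<Rightarrow> complex" where
  "F_fun m = F_scaled (epsilon_const m) m"


section \<open>Graded superspaces and supercharacters\<close>

text \<open>
  The part of the structure of a \<open>\<int>\<^sub>\<ge>\<^sub>0\<close>-graded vertex operator superalgebra on which its
  supercharacter depends: a complex vector space that is the direct sum of finite-dimensional
  subspaces \<open>V p n\<close> (parity \<open>p\<close>, conformal weight \<open>n\<close>).
\<close>

datatype parity = Even_part | Odd_part

locale graded_superspace = vector_space scale
  for scale :: "complex \<Rightarrow> 'v::ab_group_add \<Rightarrow> 'v" +
  fixes V :: "parity \<Rightarrow> nat \<Rightarrow> 'v set"
  assumes subspace_V: "subspace (V p n)"
    and finite_dim_V: "\<exists>B. finite B \<and> V p n \<subseteq> span B"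
    and direct_sum_V: "\<exists>!x :: parity \<times> nat \<Rightarrow> 'v. finite {i. x i \<noteq> 0} \<and>
      (\<forall>p n. x (p, n) \<in> V p n) \<and> v = (\<Sum>i | x i \<noteq> 0. x i)"
begin

text \<open>The graded trace of \<open>q\<^bsup>L(0) - c/24\<^esup>\<close> on the subspace of parity \<open>p\<close>; \<open>c\<close> is the central charge.\<close>

definition graded_character :: "real \<Rightarrow> parity \<Rightarrow> complex \<Rightarrow> complex" where
  "graded_character c p \<tau> = qpow \<tau> (- c / 24) * suminf (\<lambda>n. of_nat (dim (V p n)) * qpow \<tau> 1 ^ n)"

definition supercharacter :: "real \<Rightarrow> complex \<Rightarrow> complex" where
  "supercharacter c \<tau> = graded_character c Even_part \<tau> - graded_character c Odd_part \<tau>"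

end


section \<open>Quasi-modular forms\<close>

definition Gamma0 :: "nat \<Rightarrow> (int \<times> int \<times> int \<times> int) set" where
  "Gamma0 N = {(a, b, c, d). a * d - b * c = 1 \<and> int N dvd c}"

text \<open>For forms on congruence subgroups this is equivalent to holomorphy at all cusps.\<close>

definition moderate_growth :: "(complex \<Rightarrow> complex) \<Rightarrow> bool" where
  "moderate_growth f \<longleftrightarrow> (\<exists>(C::real) (N::nat). \<forall>\<tau>\<in>upper_half_plane.
     norm (f \<tau>) \<le> C * (Im \<tau> ^ N + 1 / Im \<tau> ^ N))"

text \<open>
  Quasi-modular forms in the sense of Kaneko and Zagier. The functions \<open>g r\<close> are the coefficients
  of the associated almost holomorphic modular form, up to normalisation. The identity matrix
  yields \<open>f = g 0\<close> on the upper half-plane, so \<open>f\<close> itself is holomorphic of moderate growth.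
\<close>

definition quasimodular_form ::
    "(int \<times> int \<times> int \<times> int) set \<Rightarrow> nat \<Rightarrow> (complex \<Rightarrow> complex) \<Rightarrow> bool" where
  "quasimodular_form G k f \<longleftrightarrow> (\<exists>(p::nat) (g :: nat \<Rightarrow> complex \<Rightarrow> complex).
     (\<forall>r\<le>p. g r holomorphic_on upper_half_plane \<and> moderate_growth (g r)) \<and>
     (\<forall>(a, b, c, d)\<in>G. \<forall>\<tau>\<in>upper_half_plane.
        f ((of_int a * \<tau> + of_int b) / (of_int c * \<tau> + of_int d)) / (of_int c * \<tau> + of_int d) ^ k =
        (\<Sum>r\<le>p. g r \<tau> * (of_int c / (of_int c * \<tau> + of_int d)) ^ r)))"


section \<open>Polynomials in Eisenstein series\<close>

text \<open>
  Rational polynomials in the variables \<open>X\<^sub>i\<^sub>d\<close>, to be evaluated at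
  \<open>E\<^sub>2\<^sub>i(d \<tau>)\<close>. A monomial is a finitely supported exponent function on the pairs \<open>(i, d)\<close>.
\<close>

type_synonym eis_monom = "nat \<times> nat \<Rightarrow>\<^sub>0 nat"
type_synonym eis_poly = "eis_monom \<Rightarrow>\<^sub>0 rat"

definition eis_poly_vars :: "eis_poly \<Rightarrow> (nat \<times> nat) set" where
  "eis_poly_vars P = (\<Union>M\<in>Poly_Mapping.keys P. Poly_Mapping.keys M)"

definition eval_eis_poly :: "eis_poly \<Rightarrow> complex \<Rightarrow> complex" where
  "eval_eis_poly P \<tau> = (\<Sum>M\<in>Poly_Mapping.keys P. of_rat (Poly_Mapping.lookup P M) *
     (\<Prod>(i, d)\<in>Poly_Mapping.keys M.
        eisenstein_E (2 * i) (of_nat d * \<tau>) ^ Poly_Mapping.lookup M (i, d)))"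

text \<open>Homogeneity for the grading in which \<open>X\<^sub>i\<^sub>d\<close> has weight \<open>2i\<close>.\<close>

definition eis_weight_homogeneous :: "nat \<Rightarrow> eis_poly \<Rightarrow> bool" where
  "eis_weight_homogeneous k P \<longleftrightarrow> (\<forall>M\<in>Poly_Mapping.keys P.
     (\<Sum>(i, d)\<in>Poly_Mapping.keys M. 2 * i * Poly_Mapping.lookup M (i, d)) = k)"

end

(*
  Put t = 2 pi i z, w = 2 pi i tau, q = exp w. By the Jacobi triple product, theta(z; tau) is, up to
  the factor i eta^3, the function s(t) = t exp(sum over n of B_n E_n t^n / (n n!)), so that
  Phi(t) = theta(mz; m tau) / theta(z; tau)^m has Laurent coefficients at t = 0 which, after division
  by eta(m tau)^3 / eta(tau)^(3m), are weighted homogeneous polynomials in the E_n(tau), E_n(m tau). The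
  differential equation of the Weierstrass function reduces these to n = 2, 4, 6. For odd m, Phi is
  an even elliptic function with poles only at the lattice points; by Liouville it is a constant A
  plus a combination of even derivatives of the Weierstrass function, normalised such that their
  Laurent expansions in zeta have no constant term. Hence A is the constant term, and it has
  weight m - 1. Liouville's theorem also gives the transformation of the logarithmic derivative of theta
  under SL2(Z), hence the quasi-modularity of E_2, E_4, E_6. Evaluating at z = - tau / 2 as q tends
  to 0 shows that the normalised A tends to 1, which determines epsilon_m.
*)

theory Submission
  imports Defs
begin


section \<open>Lambert series\<close>

text \<open>A constant term is a coefficient of the expansion singled out by \<open>THE\<close>, so
  a full Laurent expansion of the quotient must be exhibited and shown unique. The partial fractions
  supply it: each building block is a derivative of theta' / theta, and a termwise derivative of a
  series in powers of zeta has no zeroth coefficient. Working with theta' / theta throughout shapes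
  the proof. Its Taylor coefficients \<open>B_n E_n / n!\<close> are holomorphic in \<open>q\<close>
  up to the cusp \<open>q = 0\<close>, and a logarithmic derivative turns the m-th power in the
  denominator into a factor m, so that the Laurent coefficients of the quotient obey a linear
  recursion in which weights are visible. At \<open>q = 0\<close> the normalised constant is a sum
  of products of Bernoulli numbers with no evident evaluation; this is why its value is found
  analytically, at a point where both sides have limits. That the value is 1 makes
  \<open>epsilon_const\<close> well defined and equal to \<open>\<i> ^ m / \<i>\<close>, which
  cancels exactly against the constants of the theta functions and leaves rational
  coefficients.\<close>

lemma summable_power_mult_geometric:
  fixes r :: real
  assumes "0 \<le> r" "r < 1"
  shows "summable (\<lambda>n. real (Suc n) ^ K * r ^ n)"
proof -
  have "summable (\<lambda>n. real (Suc n) ^ K * x ^ n)" if "norm x < 1" for x :: real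
    using that
  proof (induction K arbitrary: x)
    case 0
    then show ?case by (simp add: summable_geometric)
  next
    case (Suc K)
    define c where "c = (\<lambda>n. real n ^ K)"
    have "summable (\<lambda>n. c n * y ^ n)" if "norm y < 1" for y :: real
    proof -
      have "summable (\<lambda>n. y * (real (Suc n) ^ K * y ^ n))"
        by (intro summable_mult Suc.IH that)
      hence "summable (\<lambda>n. c (Suc n) * y ^ Suc n)"
        by (simp add: c_def mult_ac)
      thus ?thesis by (subst (asm) summable_Suc_iff)
    qed
    \<comment> \<open>Formal differentiation turns the coefficients \<open>n ^ K\<close> into
      \<open>(n + 1) ^ (K + 1)\<close>, which is the induction step.\<close>
    from termdiff_converges[OF Suc.prems this]
    show ?case by (simp add: diffs_def c_def mult_ac)
  qed
  thus ?thesis using assms by simp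
qed

definition poly_bounded :: "(nat \<Rightarrow> complex) \<Rightarrow> bool" where
  "poly_bounded c \<longleftrightarrow> (\<exists>K. \<forall>n. norm (c n) \<le> real (Suc n) ^ K)"

lemma poly_bounded_power [intro]: "poly_bounded (\<lambda>n. of_nat (Suc n) ^ k)"
  unfolding poly_bounded_def by (rule exI[of _ k]) (simp add: norm_power del: of_nat_Suc)

lemma poly_bounded_inverse [intro]: "poly_bounded (\<lambda>n. 1 / of_nat (Suc n))"
  unfolding poly_bounded_def by (rule exI[of _ 0]) (simp add: norm_divide del: of_nat_Suc)

lemma norm_one_minus_power_ge:
  fixes q :: "'a :: real_normed_div_algebra"
  assumes "norm q \<le> r" "r < 1"
  shows "norm (1 - q ^ Suc n) \<ge> 1 - r"
proof -
  have r: "0 \<le> r" using assms(1) norm_ge_zero order_trans by blast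
  have "norm q ^ Suc n \<le> r ^ Suc n" using assms by (intro power_mono) auto
  also have "\<dots> \<le> r ^ 1" using assms r by (intro power_decreasing) auto
  finally have "norm (q ^ Suc n) \<le> r" by (simp add: norm_power del: power_Suc)
  thus ?thesis using norm_triangle_ineq2[of 1 "q ^ Suc n"] by simp
qed

lemma one_minus_power_nonzero:
  fixes q :: "'a :: real_normed_div_algebra"
  assumes "norm q < 1"
  shows "1 - q ^ Suc n \<noteq> 0"
  using norm_one_minus_power_ge[of q "norm q" n] assms by auto

text \<open>With \<open>c n = 1 / (n + 1)\<close> this is minus the logarithm of the product of all
  \<open>1 - q ^ j * exp t\<close> with \<open>j \<ge> 1\<close>. Each derivative in
  \<open>t\<close> multiplies \<open>c n\<close> by \<open>n + 1\<close>, and at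
  \<open>t = 0\<close> the Lambert series of the Eisenstein series appear.\<close>

definition lambert_exp :: "complex \<Rightarrow> (nat \<Rightarrow> complex) \<Rightarrow> complex \<Rightarrow> complex" where
  "lambert_exp q c t = (suminf (\<lambda>n. c n * (q ^ Suc n / (1 - q ^ Suc n)) * exp t ^ Suc n))"

lemma lambert_summable:
  assumes "norm q < 1" "norm (q * x) < 1" "poly_bounded c"
  shows "summable (\<lambda>n. norm (c n * (q ^ Suc n / (1 - q ^ Suc n)) * x ^ Suc n))"
proof -
  from assms(3) obtain K where K: "\<And>n. norm (c n) \<le> real (Suc n) ^ K"
    unfolding poly_bounded_def by blast
  have "summable (\<lambda>n. 1 / (1 - norm q) * norm (q * x) * (real (Suc n) ^ K * norm (q * x) ^ n))"
    using assms by (intro summable_mult summable_power_mult_geometric) auto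
  thus ?thesis
  proof (rule summable_comparison_test'[where N = 0])
    fix n
    have "norm (c n * (q ^ Suc n / (1 - q ^ Suc n)) * x ^ Suc n)
        = norm (c n) * norm (q * x) ^ Suc n / norm (1 - q ^ Suc n)"
      by (simp add: norm_mult norm_divide norm_power power_mult_distrib field_simps)
    also have "\<dots> \<le> real (Suc n) ^ K * norm (q * x) ^ Suc n / (1 - norm q)"
      using norm_one_minus_power_ge[of q "norm q" n] assms(1)
      by (intro frac_le mult_right_mono K) auto
    also have "\<dots> = 1 / (1 - norm q) * norm (q * x) * (real (Suc n) ^ K * norm (q * x) ^ n)"
      by (simp add: field_simps)
    finally show "norm (norm (c n * (q ^ Suc n / (1 - q ^ Suc n)) * x ^ Suc n)) \<le>
        1 / (1 - norm q) * norm (q * x) * (real (Suc n) ^ K * norm (q * x) ^ n)" by simp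
  qed
qed

lemma has_field_derivative_lambert_exp:
  assumes "norm q < 1" "norm (q * exp t) < 1" "poly_bounded c"
  shows "(lambert_exp q c has_field_derivative lambert_exp q (\<lambda>n. of_nat (Suc n) * c n) t) (at t)"
proof (cases "q = 0")
  \<comment> \<open>The radius of convergence is written \<open>1 / norm q\<close>, which evaluates
    to \<open>0\<close> instead of infinity at \<open>q = 0\<close>.\<close>
  case True
  then show ?thesis by (simp add: lambert_exp_def[abs_def])
next
  case False
  \<comment> \<open>Shifting the index and inserting the constant coefficient \<open>0\<close> gives
    an ordinary power series in \<open>exp t\<close>, to which termwise differentiation
    applies.\<close>
  define a where "a = (\<lambda>n. if n = 0 then 0 else c (n - 1) * (q ^ n / (1 - q ^ n)))"
  have summ: "summable (\<lambda>n. a n * x ^ n)" if "norm (q * x) < 1" for x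
  proof -
    have "summable (\<lambda>n. a (Suc n) * x ^ Suc n)"
      using summable_norm_cancel[OF lambert_summable[OF assms(1) that assms(3)]] by (simp add: a_def)
    thus ?thesis by (subst (asm) summable_Suc_iff)
  qed
  define f where "f = (\<lambda>x. suminf (\<lambda>n. a n * x ^ n))"
  have ball: "norm (q * x) < 1" if "norm x < 1 / norm q" for x
    using that False by (simp add: norm_mult field_simps)
  have ex: "norm (exp t) < 1 / norm q"
    using assms(2) False by (simp add: norm_mult field_simps)
  have fd: "(f has_field_derivative (suminf (\<lambda>n. diffs a n * exp t ^ n))) (at (exp t))"
    unfolding f_def by (rule termdiffs_strong'[of "1 / norm q"]) (use summ ball ex in auto)
  have "((\<lambda>t. f (exp t)) has_field_derivative (suminf (\<lambda>n. diffs a n * exp t ^ n)) * exp t) (at t)"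
    by (rule DERIV_chain2[where f = f and g = exp, OF fd]) (auto intro!: derivative_eq_intros)
  moreover have "(suminf (\<lambda>n. diffs a n * exp t ^ n)) * exp t = lambert_exp q (\<lambda>n. of_nat (Suc n) * c n) t"
  proof -
    have "summable (\<lambda>n. diffs a n * exp t ^ n)"
      by (rule termdiff_converges[of _ "1 / norm q"]) (use summ ball ex in auto)
    from suminf_mult2[OF this, of "exp t"] show ?thesis
      by (simp add: lambert_exp_def diffs_def a_def mult_ac)
  qed
  moreover have "f (exp u) = lambert_exp q c u" if "norm (q * exp u) < 1" for u
  proof -
    from suminf_split_head[OF summ[OF that]] have "f (exp u) = (suminf (\<lambda>n. a (Suc n) * exp u ^ Suc n))"
      by (simp add: f_def a_def)
    thus ?thesis by (simp add: a_def lambert_exp_def)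
  qed
  moreover have "\<forall>\<^sub>F u in nhds t. norm (q * exp u) < 1"
  proof (rule order_tendstoD(2)[OF _ assms(2)])
    have "isCont (\<lambda>u. norm (q * exp u)) t" by (intro continuous_intros)
    thus "((\<lambda>u. norm (q * exp u)) \<longlongrightarrow> norm (q * exp t)) (nhds t)"
      by (simp add: continuous_at tendsto_nhds_iff)
  qed
  ultimately show ?thesis
    by (metis (mono_tags, lifting) DERIV_cong_ev eventually_mono)
qed

text \<open>The domain includes \<open>x = 0\<close>; this is what later permits evaluating the
  coefficients at the cusp.\<close>

lemma holomorphic_lambert:
  assumes "poly_bounded c"
  shows "(\<lambda>x. suminf (\<lambda>n. c n * (x ^ Suc n / (1 - x ^ Suc n)))) holomorphic_on ball 0 1"
proof (rule holomorphic_uniform_sequence)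
  show "(\<lambda>x. \<Sum>n<N. c n * (x ^ Suc n / (1 - x ^ Suc n))) holomorphic_on ball 0 1" for N
    using one_minus_power_nonzero by (intro holomorphic_intros) (auto simp del: power_Suc)
  fix x :: complex assume x: "x \<in> ball 0 1"
  define r where "r = (1 + norm x) / 2"
  have r: "norm x < r" "r < 1" "0 \<le> r" using x by (auto simp: r_def)
  from assms obtain K where K: "\<And>n. norm (c n) \<le> real (Suc n) ^ K"
    unfolding poly_bounded_def by blast
  have sub: "norm y \<le> r" if "y \<in> cball x (r - norm x)" for y
    using that norm_triangle_ineq2[of y x] by (auto simp: dist_norm norm_minus_commute)
  have "uniform_limit (cball x (r - norm x)) (\<lambda>N y. \<Sum>n<N. c n * (y ^ Suc n / (1 - y ^ Suc n)))
          (\<lambda>y. suminf (\<lambda>n. c n * (y ^ Suc n / (1 - y ^ Suc n)))) sequentially"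
  proof (rule Weierstrass_m_test)
    show "summable (\<lambda>n. r / (1 - r) * (real (Suc n) ^ K * r ^ n))"
      using r by (intro summable_mult summable_power_mult_geometric) auto
    fix n y assume "y \<in> cball x (r - norm x)"
    hence y: "norm y \<le> r" by (rule sub)
    have "norm (c n * (y ^ Suc n / (1 - y ^ Suc n))) = norm (c n) * norm y ^ Suc n / norm (1 - y ^ Suc n)"
      by (simp add: norm_mult norm_divide norm_power)
    also have "\<dots> \<le> real (Suc n) ^ K * r ^ Suc n / (1 - r)"
      using norm_one_minus_power_ge[of y r n] r y
      by (intro frac_le mult_mono K power_mono) auto
    finally show "norm (c n * (y ^ Suc n / (1 - y ^ Suc n))) \<le> r / (1 - r) * (real (Suc n) ^ K * r ^ n)"
      by (simp add: field_simps)
  qed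
  moreover have "cball x (r - norm x) \<subseteq> ball 0 1" using sub r by force
  ultimately show "\<exists>d>0. cball x d \<subseteq> ball 0 1 \<and> uniform_limit (cball x d)
      (\<lambda>N y. \<Sum>n<N. c n * (y ^ Suc n / (1 - y ^ Suc n)))
      (\<lambda>y. suminf (\<lambda>n. c n * (y ^ Suc n / (1 - y ^ Suc n)))) sequentially"
    using r by (intro exI[of _ "r - norm x"]) auto
qed auto


section \<open>The Jacobi triple product\<close>

text \<open>The logarithm of the partial product is expanded in powers of \<open>x\<close>; summing
  the geometric series over \<open>n < N\<close> leaves the expected coefficients times
  \<open>1 - (q ^ Suc k) ^ N\<close>, and Tannery's theorem lets \<open>N\<close> tend to infinity.
  The exponential form of the limit shows at once that it does not vanish.\<close>

lemma tendsto_prod_one_minus_power: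
  fixes q x :: complex
  assumes "norm q < 1" "norm (q * x) < 1"
  shows "(\<lambda>N. \<Prod>n<N. 1 - q ^ Suc n * x) \<longlonglongrightarrow>
    exp (- (suminf (\<lambda>k. 1 / of_nat (Suc k) * (q ^ Suc k / (1 - q ^ Suc k)) * x ^ Suc k)))"
proof -
  define a where "a = (\<lambda>k N. 1 / of_nat (Suc k) * (q ^ Suc k / (1 - q ^ Suc k)) * x ^ Suc k * (1 - (q ^ Suc k) ^ N))"
  define b where "b = (\<lambda>k. 1 / of_nat (Suc k) * (q ^ Suc k / (1 - q ^ Suc k)) * x ^ Suc k)"
  have qk: "norm (q ^ Suc k) < 1" for k
  proof -
    have "norm q ^ Suc k \<le> norm q ^ 1" using assms(1) by (intro power_decreasing) auto
    thus ?thesis unfolding norm_power using assms(1) by simp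
  qed
  have lt: "norm (q ^ Suc n * x) < 1" for n
  proof -
    have "norm (q ^ Suc n * x) = norm q ^ n * norm (q * x)" by (simp add: norm_mult norm_power)
    also have "\<dots> \<le> norm (q * x)"
      using assms(1) by (intro mult_left_le_one_le) (auto simp: power_le_one)
    finally show ?thesis using assms(2) by simp
  qed
  have lnsums: "(\<lambda>k. - (y ^ Suc k) / of_nat (Suc k)) sums Ln (1 - y)" if "norm y < 1" for y :: complex
  proof -
    have "(\<lambda>k. - (y ^ k) / of_nat k) sums Ln (1 - y)"
      using Ln_series'[of "-y"] that by simp
    thus ?thesis by (subst sums_Suc_iff) simp
  qed
  have eq: "(\<Prod>n<N. 1 - q ^ Suc n * x) = exp (- (suminf (\<lambda>k. a k N)))" for N
  proof -
    have "(\<lambda>k. \<Sum>n<N. - ((q ^ Suc n * x) ^ Suc k) / of_nat (Suc k)) sums (\<Sum>n<N. Ln (1 - q ^ Suc n * x))"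
      by (intro sums_sum lnsums lt)
    moreover have "(\<Sum>n<N. - ((q ^ Suc n * x) ^ Suc k) / of_nat (Suc k)) = - a k N" for k
    proof -
      have "(\<Sum>n<N. (q ^ Suc k) ^ n) = (1 - (q ^ Suc k) ^ N) / (1 - q ^ Suc k)"
        using one_minus_power_nonzero[OF assms(1), of k]
        by (subst sum_gp_strict) (auto simp: field_simps)
      moreover have "(\<Sum>n<N. - ((q ^ Suc n * x) ^ Suc k) / of_nat (Suc k))
          = - (1 / of_nat (Suc k) * q ^ Suc k * x ^ Suc k) * (\<Sum>n<N. (q ^ Suc k) ^ n)"
        unfolding sum_distrib_left
      proof (rule sum.cong)
        fix n
        have "(q ^ Suc n * x) ^ Suc k = q ^ Suc k * x ^ Suc k * (q ^ Suc k) ^ n"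
          unfolding power_mult_distrib power_mult[symmetric]
          by (simp add: power_add[symmetric] algebra_simps)
        thus "- ((q ^ Suc n * x) ^ Suc k) / of_nat (Suc k) =
            - (1 / of_nat (Suc k) * q ^ Suc k * x ^ Suc k) * (q ^ Suc k) ^ n"
          by (simp only: ) (simp del: power_Suc of_nat_Suc)
      qed auto
      ultimately show ?thesis by (simp add: a_def del: power_Suc of_nat_Suc)
    qed
    ultimately have "(\<lambda>k. - a k N) sums (\<Sum>n<N. Ln (1 - q ^ Suc n * x))" by simp
    hence "(\<lambda>k. a k N) sums - (\<Sum>n<N. Ln (1 - q ^ Suc n * x))" using sums_minus by fastforce
    hence "exp (- (suminf (\<lambda>k. a k N))) = exp (\<Sum>n<N. Ln (1 - q ^ Suc n * x))"
      by (simp add: sums_iff)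
    also have "\<dots> = (\<Prod>n<N. 1 - q ^ Suc n * x)"
      unfolding exp_sum[OF finite_lessThan]
    proof (intro prod.cong refl exp_Ln)
      fix n show "1 - q ^ Suc n * x \<noteq> 0" using lt[of n] by auto
    qed
    finally show ?thesis by simp
  qed
  have "(\<lambda>N. suminf (\<lambda>k. a k N)) \<longlonglongrightarrow> (suminf (\<lambda>k. b k))"
  proof -
    have lim: "(\<lambda>N. a k N) \<longlonglongrightarrow> b k" for k
    proof -
      have "(\<lambda>N. b k * (1 - (q ^ Suc k) ^ N)) \<longlonglongrightarrow> b k * (1 - 0)"
        by (intro tendsto_intros LIMSEQ_power_zero qk)
      thus ?thesis by (simp add: a_def b_def del: power_Suc of_nat_Suc)
    qed
    have bd: "norm (a k N) \<le> norm (b k) * 2" for k N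
    proof -
      have "norm ((q ^ Suc k) ^ N) \<le> 1"
        unfolding norm_power[of "q ^ Suc k"] using qk[of k] by (intro power_le_one) auto
      hence "norm (1 - (q ^ Suc k) ^ N) \<le> 2"
        using norm_triangle_ineq4[of 1 "(q ^ Suc k) ^ N"] by simp
      hence "norm (b k * (1 - (q ^ Suc k) ^ N)) \<le> norm (b k) * 2"
        unfolding norm_mult by (rule mult_left_mono) auto
      thus ?thesis by (simp add: a_def b_def del: power_Suc of_nat_Suc)
    qed
    have "summable (\<lambda>k. norm (b k) * 2)" unfolding b_def
      by (intro summable_mult2 lambert_summable assms poly_bounded_inverse)
    from tannerys_theorem[of a b sequentially "\<lambda>k. norm (b k) * 2", OF lim _ this] bd show ?thesis
      by (simp add: always_eventually)
  qed
  thus ?thesis unfolding eq b_def by (intro tendsto_intros)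
qed

section \<open>Gaussian binomial coefficients\<close>

text \<open>Defining the Gaussian binomials by a Pascal rule keeps them polynomials in
  \<open>q\<close> over any commutative ring, free of division.\<close>

fun qbinomial :: "'a::comm_ring_1 \<Rightarrow> nat \<Rightarrow> nat \<Rightarrow> 'a" where
  "qbinomial q n 0 = 1"
| "qbinomial q 0 (Suc k) = 0"
| "qbinomial q (Suc n) (Suc k) = qbinomial q n (Suc k) + q ^ (n - k) * qbinomial q n k"

lemma qbinomial_eq_0: "k > n \<Longrightarrow> qbinomial q n k = 0"
  by (induction q n k rule: qbinomial.induct) auto

lemma qbinomial_theorem:
  fixes q y :: "'a::comm_ring_1"
  shows "(\<Prod>i<n. 1 + y * q ^ i) = (\<Sum>j\<le>n. q ^ (j choose 2) * y ^ j * qbinomial q n j)"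
proof (induction n)
  case 0
  then show ?case by (simp add: binomial_eq_0)
next
  case (Suc n)
  have ch: "q ^ (Suc j choose 2) = q ^ j * q ^ (j choose 2)" for j
    by (simp add: numeral_2_eq_2 power_add)
  have "(\<Prod>i<Suc n. 1 + y * q ^ i) = (\<Sum>j\<le>n. q ^ (j choose 2) * y ^ j * qbinomial q n j) * (1 + y * q ^ n)"
    by (simp add: Suc)
  also have "\<dots> = (\<Sum>j\<le>n. q ^ (j choose 2) * y ^ j * qbinomial q n j)
      + (\<Sum>j\<le>n. q ^ (Suc j choose 2) * y ^ Suc j * (q ^ (n - j) * qbinomial q n j))"
    unfolding distrib_left sum_distrib_right mult_1_right
  proof (intro arg_cong2[of _ _ _ _ "(+)"] refl sum.cong)
    fix j assume "j \<in> {..n}"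
    hence "q ^ n = q ^ j * q ^ (n - j)" by (simp add: power_add[symmetric])
    thus "q ^ (j choose 2) * y ^ j * qbinomial q n j * (y * q ^ n) =
      q ^ (Suc j choose 2) * y ^ Suc j * (q ^ (n - j) * qbinomial q n j)"
      by (simp add: ch mult_ac)
  qed
  also have "(\<Sum>j\<le>n. q ^ (j choose 2) * y ^ j * qbinomial q n j) =
     (\<Sum>j\<le>Suc n. q ^ (j choose 2) * y ^ j * qbinomial q n j)"
    by (simp add: qbinomial_eq_0)
  also have "\<dots> = 1 + (\<Sum>j\<le>n. q ^ (Suc j choose 2) * y ^ Suc j * qbinomial q n (Suc j))"
    by (subst sum.atMost_Suc_shift) (simp add: binomial_eq_0)
  also have "\<dots> + (\<Sum>j\<le>n. q ^ (Suc j choose 2) * y ^ Suc j * (q ^ (n - j) * qbinomial q n j)) =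
      1 + (\<Sum>j\<le>n. q ^ (Suc j choose 2) * y ^ Suc j * qbinomial q (Suc n) (Suc j))"
    by (simp add: sum.distrib[symmetric] distrib_left add.assoc)
  also have "\<dots> = (\<Sum>j\<le>Suc n. q ^ (j choose 2) * y ^ j * qbinomial q (Suc n) j)"
    by (subst sum.atMost_Suc_shift) (simp add: binomial_eq_0)
  finally show ?case .
qed

text \<open>The quotient formula with denominators cleared, so that it holds in every commutative
  ring. In the induction step both Pascal summands become multiples of the same product, with
  factors \<open>1 - q ^ (n - k)\<close> and \<open>q ^ (n - k) * (1 - q ^ (k + 1))\<close> adding
  up to \<open>1 - q ^ (n + 1)\<close>.\<close>

lemma qbinomial_mult_qfactorials:
  fixes q :: "'a::comm_ring_1"
  assumes "k \<le> n"
  shows "qbinomial q n k * (\<Prod>i<k. 1 - q ^ Suc i) * (\<Prod>i<n-k. 1 - q ^ Suc i) = (\<Prod>i<n. 1 - q ^ Suc i)"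
  using assms
proof (induction q n k rule: qbinomial.induct)
  case (3 q n k)
  let ?f = "\<lambda>n. \<Prod>i<n. 1 - q ^ Suc i"
  show ?case
  proof (cases "k = n")
    case True
    have "?f (Suc n) = (1 - q ^ Suc n) * ?f n" by simp
    moreover have "qbinomial q n n * ?f n = ?f n" using "3.IH"(2) True by simp
    ultimately show ?thesis using True
      by (simp add: qbinomial_eq_0 mult.assoc[symmetric] mult.commute[of "1 - _"] del: power_Suc)
  next
    case False
    with "3.prems" have k: "k < n" by simp
    then obtain d where d: "n = k + Suc d" using less_imp_Suc_add by fastforce
    have 1: "qbinomial q n (Suc k) * ?f (Suc k) * ?f d = ?f n" using "3.IH"(1) k d by simp
    have 2: "qbinomial q n k * ?f k * ?f (Suc d) = ?f n" using "3.IH"(2) k d by simp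
    have "qbinomial q (Suc n) (Suc k) * ?f (Suc k) * ?f (Suc d) =
      (qbinomial q n (Suc k) * ?f (Suc k) * ?f d) * (1 - q ^ Suc d) +
      q ^ Suc d * (1 - q ^ Suc k) * (qbinomial q n k * ?f k * ?f (Suc d))"
      by (simp add: d algebra_simps del: power_Suc)
    also have "\<dots> = ?f n * (1 - q ^ Suc d + q ^ Suc d * (1 - q ^ Suc k))"
      unfolding 1 2 by (simp add: algebra_simps)
    also have "\<dots> = ?f (Suc n)" by (simp add: d algebra_simps power_add)
    finally show ?thesis by (simp add: d del: power_Suc)
  qed
qed auto


section \<open>The Euler product and the theta series\<close>

text \<open>As an exponential of a Lambert series the function is nonzero and holomorphic by
  construction; \<open>tendsto_euler_prod\<close> recovers the product.\<close>

definition euler_prod :: "complex \<Rightarrow> complex" where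
  "euler_prod q = exp (- (suminf (\<lambda>n. 1 / of_nat (Suc n) * (q ^ Suc n / (1 - q ^ Suc n)))))"

lemma euler_prod_nonzero [simp]: "euler_prod q \<noteq> 0"
  by (simp add: euler_prod_def)

lemma euler_prod_0 [simp]: "euler_prod 0 = 1"
  by (simp add: euler_prod_def)

lemma holomorphic_euler_prod: "euler_prod holomorphic_on ball 0 1"
  unfolding euler_prod_def[abs_def]
  by (intro holomorphic_intros holomorphic_lambert poly_bounded_inverse)

lemma tendsto_euler_prod:
  assumes "norm q < 1"
  shows "(\<lambda>N. \<Prod>n<N. 1 - q ^ Suc n) \<longlonglongrightarrow> euler_prod q"
  using tendsto_prod_one_minus_power[of q 1] assms by (simp add: euler_prod_def)

lemma prodinf_euler_prod:
  assumes "norm q < 1"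
  shows "prodinf (\<lambda>n. 1 - q ^ Suc n) = euler_prod q"
proof -
  have "(\<lambda>N. \<Prod>n\<le>N. 1 - q ^ Suc n) \<longlonglongrightarrow> euler_prod q"
    using LIMSEQ_Suc[OF tendsto_euler_prod[OF assms]] unfolding lessThan_Suc_atMost .
  hence "raw_has_prod (\<lambda>n. 1 - q ^ Suc n) 0 (euler_prod q)"
    by (simp add: raw_has_prod_def)
  hence "(\<lambda>n. 1 - q ^ Suc n) has_prod euler_prod q"
    by (auto simp: has_prod_def)
  thus ?thesis by (rule has_prod_unique[symmetric])
qed

definition theta_series :: "complex \<Rightarrow> complex \<Rightarrow> complex" where
  "theta_series q x = (suminf (\<lambda>n. ((-1) ^ n * q ^ (Suc n choose 2)) * x ^ n))"

text \<open>\<open>theta q t\<close> is the sum of \<open>(-1)\<^sup>n q\<^bsup>n(n+1)/2\<^esup> 2 sinh ((n + 1/2) t)\<close>: in the series of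
  \<open>jacobi_vartheta\<close> the terms of index \<open>n\<close> and \<open>- n - 1\<close> are paired.\<close>

definition theta :: "complex \<Rightarrow> complex \<Rightarrow> complex" where
  "theta q t = exp (t / 2) * theta_series q (exp t) - exp (- t / 2) * theta_series q (exp (- t))"

lemma two_mult_Suc_choose_two: "2 * (Suc n choose 2) = n * Suc n"
  by (induction n) (simp_all add: numeral_2_eq_2)

lemma theta_series_summable:
  fixes x :: complex
  assumes "norm q < 1"
  shows "summable (\<lambda>n. norm (((-1) ^ n * q ^ (Suc n choose 2)) * x ^ n))"
proof -
  have "(\<lambda>n. norm q ^ Suc n * norm x) \<longlonglongrightarrow> 0 * norm x"
    using assms by (intro tendsto_intros LIMSEQ_Suc[OF LIMSEQ_power_zero]) auto
  hence "\<forall>\<^sub>F n in sequentially. norm q ^ Suc n * norm x < 1 / 2"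
    by (rule order_tendstoD) auto
  then obtain N where N: "\<And>n. n \<ge> N \<Longrightarrow> norm q ^ Suc n * norm x < 1 / 2"
    by (auto simp: eventually_sequentially)
  show ?thesis
  proof (rule summable_ratio_test[where c = "1 / 2" and N = N])
    fix n assume n: "n \<ge> N"
    have ch: "Suc (Suc n) choose 2 = Suc n + (Suc n choose 2)" by (simp add: numeral_2_eq_2)
    have "norm (norm (((-1) ^ Suc n * q ^ (Suc (Suc n) choose 2)) * x ^ Suc n)) =
        (norm q ^ Suc n * norm x) * norm (((-1) ^ n * q ^ (Suc n choose 2)) * x ^ n)"
      unfolding ch power_add by (simp add: norm_mult norm_power mult_ac)
    also have "\<dots> \<le> 1 / 2 * norm (((-1) ^ n * q ^ (Suc n choose 2)) * x ^ n)"
      using N[OF n] by (intro mult_right_mono) auto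
    finally show "norm (norm (((-1) ^ Suc n * q ^ (Suc (Suc n) choose 2)) * x ^ Suc n)) \<le>
        1 / 2 * norm (norm (((-1) ^ n * q ^ (Suc n choose 2)) * x ^ n))" by simp
  qed auto
qed

lemma holomorphic_theta_series:
  assumes "norm q < 1"
  shows "theta_series q holomorphic_on A"
proof -
  have "theta_series q holomorphic_on ball 0 r" for r
  proof (rule power_series_holomorphic)
    fix x :: complex
    show "(\<lambda>n. ((-1) ^ n * q ^ (Suc n choose 2)) * (x - 0) ^ n) sums theta_series q x"
      using summable_sums[OF summable_norm_cancel[OF theta_series_summable[OF assms]]]
      by (simp add: theta_series_def)
  qed
  hence "theta_series q field_differentiable at x" for x
    by (rule holomorphic_on_imp_differentiable_at[of _ "ball 0 (norm x + 1)"]) auto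
  thus ?thesis by (auto simp: holomorphic_on_def intro: field_differentiable_at_within)
qed

lemma holomorphic_theta [holomorphic_intros]:
  assumes "norm q < 1" "f holomorphic_on A"
  shows "(\<lambda>t. theta q (f t)) holomorphic_on A"
proof -
  have "theta q holomorphic_on UNIV"
    unfolding theta_def[abs_def]
    by (intro holomorphic_intros holomorphic_on_compose_gen[OF _ holomorphic_theta_series[OF assms(1), of UNIV], unfolded o_def]) auto
  from holomorphic_on_compose_gen[OF assms(2) this] show ?thesis by (simp add: o_def)
qed

lemma theta_minus: "theta q (- t) = - theta q t"
  by (simp add: theta_def)

lemma theta_sums:
  assumes "norm q < 1"
  shows "(\<lambda>n. (-1) ^ n * q ^ (Suc n choose 2) * (exp (t / 2) * exp t ^ n - exp (- t / 2) * exp (- t) ^ n))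
           sums theta q t"
proof -
  have "(\<lambda>n. exp (t / 2) * (((-1) ^ n * q ^ (Suc n choose 2)) * exp t ^ n)
           - exp (- t / 2) * (((-1) ^ n * q ^ (Suc n choose 2)) * exp (- t) ^ n)) sums theta q t"
    unfolding theta_def theta_series_def
    by (intro sums_diff sums_mult summable_sums summable_norm_cancel[OF theta_series_summable] assms)
  thus ?thesis by (simp add: algebra_simps)
qed

section \<open>From the finite to the infinite triple product\<close>

lemma prod_lessThan_add:
  fixes f :: "nat \<Rightarrow> 'a::comm_monoid_mult"
  shows "(\<Prod>i<a+b. f i) = (\<Prod>i<a. f i) * (\<Prod>i<b. f (a + i))"
  by (induction b) (simp_all add: mult_ac)

lemma sum_lessThan_add:
  fixes f :: "nat \<Rightarrow> 'a::comm_monoid_add"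
  shows "(\<Sum>i<a+b. f i) = (\<Sum>i<a. f i) + (\<Sum>i<b. f (a + i))"
  by (induction b) (simp_all add: add_ac)

lemma qbinomial_symmetric:
  fixes q :: complex
  assumes "norm q < 1" "k \<le> n"
  shows "qbinomial q n (n - k) = qbinomial q n k"
proof -
  have nz: "(\<Prod>i<k. 1 - q ^ Suc i) \<noteq> 0" for k
    using one_minus_power_nonzero[OF assms(1)] by (simp del: power_Suc)
  have "qbinomial q n (n - k) * ((\<Prod>i<k. 1 - q ^ Suc i) * (\<Prod>i<n-k. 1 - q ^ Suc i)) =
        qbinomial q n k * ((\<Prod>i<k. 1 - q ^ Suc i) * (\<Prod>i<n-k. 1 - q ^ Suc i))"
    using qbinomial_mult_qfactorials[of k n q] qbinomial_mult_qfactorials[of "n - k" n q] assms(2)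
    by (simp add: mult.assoc mult.commute[of "prod _ {..<n-k}"] del: power_Suc)
  thus ?thesis using nz by (metis mult_right_cancel no_zero_divisors)
qed

text \<open>The q-binomial theorem with \<open>2 * N + 1\<close> factors and
  \<open>y = - x / q ^ N\<close>. The first \<open>N + 1\<close> factors, read backwards, are
  \<open>- x / q ^ i\<close> times \<open>1 - q ^ i / x\<close>, and the common factor
  \<open>C\<close> collects the \<open>- x / q ^ i\<close>; the last \<open>N\<close> factors are
  \<open>1 - q ^ Suc i * x\<close>. In the sum the indices \<open>N - n\<close> and
  \<open>N + 1 + n\<close> are paired, since their Gaussian binomials agree by symmetry.\<close>

lemma finite_triple_product:
  fixes q x :: complex
  assumes "norm q < 1" "q \<noteq> 0" "x \<noteq> 0"
  shows "(\<Prod>i<N. 1 - q ^ Suc i * x) * (\<Prod>i<Suc N. 1 - q ^ i / x) =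
    (\<Sum>n<Suc N. (-1) ^ n * q ^ (Suc n choose 2) * (x ^ n - inverse x ^ Suc n) * qbinomial q (Suc (2 * N)) (Suc N + n))"
proof -
  let ?qb = "qbinomial q (Suc (2 * N))"
  define y where "y = - x / q ^ N"
  define C where "C = (- x) ^ Suc N / q ^ (Suc N choose 2)"
  have C: "C \<noteq> 0" using assms by (simp add: C_def)
  have two_N: "Suc (2 * N) = Suc N + N" by simp
  have "(\<Prod>i<Suc N + N. 1 + y * q ^ i) = (\<Prod>i<Suc N. 1 + y * q ^ i) * (\<Prod>i<N. 1 + y * q ^ (Suc N + i))"
    by (rule prod_lessThan_add)
  also have "(\<Prod>i<N. 1 + y * q ^ (Suc N + i)) = (\<Prod>i<N. 1 - q ^ Suc i * x)"
    using assms by (intro prod.cong) (auto simp: y_def power_add)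
  also have "(\<Prod>i<Suc N. 1 + y * q ^ i) = (\<Prod>i<Suc N. 1 + y * q ^ (Suc N - Suc i))"
    by (rule prod.nat_diff_reindex[symmetric])
  also have "\<dots> = (\<Prod>i<Suc N. (- x / q ^ i) * (1 - q ^ i / x))"
  proof (rule prod.cong)
    fix i assume "i \<in> {..<Suc N}"
    hence "q ^ N = q ^ i * q ^ (N - i)" by (simp add: power_add[symmetric])
    thus "1 + y * q ^ (Suc N - Suc i) = (- x / q ^ i) * (1 - q ^ i / x)"
      using assms by (simp add: y_def field_simps)
  qed auto
  also have "\<dots> = (\<Prod>i<Suc N. - x / q ^ i) * (\<Prod>i<Suc N. 1 - q ^ i / x)"
    by (rule prod.distrib)
  also have "(\<Prod>i<n. - x / q ^ i) = (- x) ^ n / q ^ (n choose 2)" for n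
  proof (induction n)
    case (Suc n)
    have "(Suc n choose 2) = n + (n choose 2)" by (simp add: numeral_2_eq_2)
    thus ?case unfolding prod.lessThan_Suc Suc.IH by (simp add: power_add mult_ac)
  qed (simp add: binomial_eq_0)
  also have "(- x) ^ Suc N / q ^ (Suc N choose 2) = C" by (simp add: C_def)
  finally have L: "(\<Prod>i<Suc (2 * N). 1 + y * q ^ i) =
      C * ((\<Prod>i<N. 1 - q ^ Suc i * x) * (\<Prod>i<Suc N. 1 - q ^ i / x))"
    unfolding two_N by (simp only: mult_ac)
  have "(\<Sum>j\<le>Suc (2 * N). q ^ (j choose 2) * y ^ j * ?qb j) =
      (\<Sum>j<Suc N + Suc N. q ^ (j choose 2) * y ^ j * ?qb j)"
    by (intro sum.cong) auto
  also have "\<dots> = (\<Sum>j<Suc N. q ^ (j choose 2) * y ^ j * ?qb j) +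
      (\<Sum>n<Suc N. q ^ ((Suc N + n) choose 2) * y ^ (Suc N + n) * ?qb (Suc N + n))"
    by (rule sum_lessThan_add)
  also have "(\<Sum>j<Suc N. q ^ (j choose 2) * y ^ j * ?qb j) =
      (\<Sum>n<Suc N. q ^ ((Suc N - Suc n) choose 2) * y ^ (Suc N - Suc n) * ?qb (Suc N - Suc n))"
    by (rule sum.nat_diff_reindex[symmetric])
  also have "\<dots> = (\<Sum>n<Suc N. - C * ((-1) ^ n * q ^ (Suc n choose 2) * inverse x ^ Suc n * ?qb (Suc N + n)))"
  proof (rule sum.cong)
    fix n assume n: "n \<in> {..<Suc N}"
    define d where "d = N - n"
    have N: "N = d + n" using n by (simp add: d_def)
    have qb: "?qb (Suc N - Suc n) = ?qb (Suc N + n)"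
      using qbinomial_symmetric[OF assms(1), of "Suc N + n" "Suc (2 * N)"] by (simp add: N)
    have ch: "(d choose 2) + (Suc N choose 2) = (Suc n choose 2) + N * d"
      using two_mult_Suc_choose_two[of d] two_mult_Suc_choose_two[of N] two_mult_Suc_choose_two[of n]
      by (simp add: N numeral_2_eq_2 algebra_simps)
    have "q ^ (d choose 2) * q ^ (Suc N choose 2) = q ^ (Suc n choose 2) * (q ^ N) ^ d"
      by (simp only: power_add[symmetric] power_mult[symmetric] ch)
    hence "q ^ (d choose 2) / (q ^ N) ^ d = q ^ (Suc n choose 2) / q ^ (Suc N choose 2)"
      using assms by (simp add: field_simps)
    moreover have "y ^ d = (- x) ^ d / (q ^ N) ^ d" unfolding y_def power_divide ..
    ultimately have "q ^ (d choose 2) * y ^ d = q ^ (Suc n choose 2) * (- x) ^ d / q ^ (Suc N choose 2)"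
      by (metis times_divide_eq_left times_divide_eq_right)
    also have "(- x) ^ d = - ((- x) ^ Suc N * ((-1) ^ n * inverse x ^ Suc n))"
    proof -
      have "(- x) ^ Suc n * inverse x ^ Suc n = (-1) ^ Suc n"
        unfolding power_mult_distrib[symmetric] using assms by simp
      moreover have "(- x) ^ Suc N * ((-1) ^ n * inverse x ^ Suc n) =
          (- x) ^ d * ((- x) ^ Suc n * inverse x ^ Suc n) * (-1) ^ n"
        by (simp add: N power_add mult.assoc mult.left_commute)
      moreover have "(-1 :: complex) ^ Suc n * (-1) ^ n = -1"
        by (simp add: power_mult_distrib[symmetric])
      ultimately show ?thesis by (simp only: mult.assoc mult_minus_right mult_1_right minus_minus)
    qed
    finally have "q ^ (d choose 2) * y ^ d = - C * ((-1) ^ n * q ^ (Suc n choose 2) * inverse x ^ Suc n)"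
      by (simp add: C_def)
    thus "q ^ ((Suc N - Suc n) choose 2) * y ^ (Suc N - Suc n) * ?qb (Suc N - Suc n) =
        - C * ((-1) ^ n * q ^ (Suc n choose 2) * inverse x ^ Suc n * ?qb (Suc N + n))"
      unfolding qb by (simp add: d_def)
  qed auto
  also have "(\<Sum>n<Suc N. q ^ ((Suc N + n) choose 2) * y ^ (Suc N + n) * ?qb (Suc N + n)) =
      (\<Sum>n<Suc N. C * ((-1) ^ n * q ^ (Suc n choose 2) * x ^ n * ?qb (Suc N + n)))"
  proof (rule sum.cong)
    fix n
    have ch: "((Suc N + n) choose 2) + (Suc N choose 2) = (Suc n choose 2) + N * (Suc N + n)"
      using two_mult_Suc_choose_two[of "N + n"] two_mult_Suc_choose_two[of N] two_mult_Suc_choose_two[of n]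
      by (simp add: algebra_simps)
    have "q ^ ((Suc N + n) choose 2) * q ^ (Suc N choose 2) = q ^ (Suc n choose 2) * (q ^ N) ^ (Suc N + n)"
      by (simp only: power_add[symmetric] power_mult[symmetric] ch)
    hence c1: "q ^ ((Suc N + n) choose 2) / (q ^ N) ^ (Suc N + n) = q ^ (Suc n choose 2) / q ^ (Suc N choose 2)"
      using assms by (simp add: field_simps)
    have c2: "y ^ (Suc N + n) = (- x) ^ (Suc N + n) / (q ^ N) ^ (Suc N + n)"
      unfolding y_def power_divide ..
    have "q ^ ((Suc N + n) choose 2) * y ^ (Suc N + n) =
        q ^ (Suc n choose 2) / q ^ (Suc N choose 2) * (- x) ^ (Suc N + n)"
      unfolding c2 c1[symmetric] by (simp only: times_divide_eq_left times_divide_eq_right)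
    also have "(- x) ^ (Suc N + n) = (- x) ^ Suc N * ((-1) ^ n * x ^ n)"
      unfolding power_add by (simp add: power_minus[of x n])
    finally have "q ^ ((Suc N + n) choose 2) * y ^ (Suc N + n) = C * ((-1) ^ n * q ^ (Suc n choose 2) * x ^ n)"
      by (simp add: C_def)
    thus "q ^ ((Suc N + n) choose 2) * y ^ (Suc N + n) * ?qb (Suc N + n) =
        C * ((-1) ^ n * q ^ (Suc n choose 2) * x ^ n * ?qb (Suc N + n))" by simp
  qed auto
  finally have R: "(\<Sum>j\<le>Suc (2 * N). q ^ (j choose 2) * y ^ j * ?qb j) =
     C * (\<Sum>n<Suc N. (-1) ^ n * q ^ (Suc n choose 2) * (x ^ n - inverse x ^ Suc n) * ?qb (Suc N + n))"
    by (simp only: sum_distrib_left sum.distrib[symmetric] ring_distribs minus_mult_left[symmetric] minus_mult_right[symmetric])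
       (simp add: algebra_simps)
  show ?thesis
    using L R C qbinomial_theorem[of y q "Suc (2 * N)"] by simp
qed

text \<open>In the finite identity the Gaussian binomial equals
  \<open>f (2 * N + 1) / (f (N + 1 + n) * f (N - n))\<close>, where \<open>f\<close> is the partial
  Euler product. It is bounded uniformly in \<open>n\<close> and \<open>N\<close>, because
  \<open>f\<close> and its inverse both converge, and it tends to \<open>1 / euler_prod q\<close>;
  Tannery's theorem then gives the limit.\<close>

theorem theta_triple_product:
  assumes "norm q < 1" "q \<noteq> 0" "norm (q * exp t) < 1" "norm (q * exp (- t)) < 1"
  shows "theta q t = (exp (t / 2) - exp (- t / 2)) * euler_prod q *
    exp (- lambert_exp q (\<lambda>n. 1 / of_nat (Suc n)) t - lambert_exp q (\<lambda>n. 1 / of_nat (Suc n)) (- t))"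
proof -
  let ?l = "lambert_exp q (\<lambda>n. 1 / of_nat (Suc n))"
  define f where "f = (\<lambda>N. \<Prod>n<N. 1 - q ^ Suc n)"
  have f_nz: "f N \<noteq> 0" for N
    unfolding f_def using one_minus_power_nonzero[OF assms(1)] by (simp del: power_Suc)
  have f_lim: "f \<longlonglongrightarrow> euler_prod q"
    unfolding f_def by (rule tendsto_euler_prod[OF assms(1)])
  have inv_lim: "(\<lambda>N. inverse (f N)) \<longlonglongrightarrow> inverse (euler_prod q)"
    by (intro tendsto_intros f_lim) auto
  obtain B1 where B1: "B1 > 0" "\<And>N. norm (f N) \<le> B1"
    using f_lim by (meson Bseq_def convergentI convergent_imp_Bseq)
  obtain B2 where B2: "B2 > 0" "\<And>N. norm (inverse (f N)) \<le> B2"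
    using inv_lim by (meson Bseq_def convergentI convergent_imp_Bseq)
  define G where "G = (\<lambda>n N. qbinomial q (Suc (2 * N)) (Suc N + n))"
  have G: "G n N = f (Suc (2 * N)) * inverse (f (Suc N + n)) * inverse (f (N - n))" if "n \<le> N" for n N
  proof -
    have "Suc (2 * N) - (Suc N + n) = N - n" using that by simp
    hence "G n N * f (Suc N + n) * f (N - n) = f (Suc (2 * N))"
      using qbinomial_mult_qfactorials[of "Suc N + n" "Suc (2 * N)" q] that by (simp add: G_def f_def del: power_Suc)
    thus ?thesis using f_nz by (simp add: field_simps)
  qed
  \<comment> \<open>Beyond \<open>n = N\<close> the Gaussian binomials vanish, so each finite sum is
    an infinite series over a fixed index set, as Tannery's theorem requires.\<close>
  have G0: "G n N = 0" if "\<not> n \<le> N" for n N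
    using that by (simp add: G_def qbinomial_eq_0)
  have G_bd: "norm (G n N) \<le> B1 * B2 * B2" for n N
  proof (cases "n \<le> N")
    case True
    show ?thesis unfolding G[OF True] norm_mult
      using B1 B2 by (intro mult_mono) auto
  next
    case False
    thus ?thesis using B1(1) B2(1) by (simp add: G0)
  qed
  have G_lim: "G n \<longlonglongrightarrow> inverse (euler_prod q)" for n
  proof -
    have s1: "filterlim (\<lambda>N. Suc (2 * N)) sequentially sequentially"
      by (rule filterlim_subseq) (auto simp: strict_mono_def)
    have s2: "filterlim (\<lambda>N. Suc N + n) sequentially sequentially"
      by (rule filterlim_subseq) (auto simp: strict_mono_def)
    have s3: "filterlim (\<lambda>N. N - n) sequentially sequentially"
      by (simp add: filterlim_minus_const_nat_at_top)
    have "(\<lambda>N. f (Suc (2 * N)) * inverse (f (Suc N + n)) * inverse (f (N - n)))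
        \<longlonglongrightarrow> euler_prod q * inverse (euler_prod q) * inverse (euler_prod q)"
      by (intro tendsto_mult filterlim_compose[OF f_lim s1] filterlim_compose[OF inv_lim s2]
            filterlim_compose[OF inv_lim s3])
    moreover have "\<forall>\<^sub>F N in sequentially. f (Suc (2 * N)) * inverse (f (Suc N + n)) * inverse (f (N - n)) = G n N"
      using eventually_ge_at_top[of n] by eventually_elim (simp add: G)
    ultimately show ?thesis by (simp add: tendsto_cong)
  qed
  define c where "c = (\<lambda>n. (-1) ^ n * q ^ (Suc n choose 2) * (exp (t / 2) * exp t ^ n - exp (- t / 2) * exp (- t) ^ n))"
  have c_summable: "summable (\<lambda>n. norm (c n) * (B1 * B2 * B2))"
  proof (intro summable_mult2)
    have "summable (\<lambda>n. norm (exp (t / 2)) * norm ((-1) ^ n * q ^ (Suc n choose 2) * exp t ^ n) +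
        norm (exp (- t / 2)) * norm ((-1) ^ n * q ^ (Suc n choose 2) * exp (- t) ^ n))"
      by (intro summable_add summable_mult theta_series_summable assms)
    thus "summable (\<lambda>n. norm (c n))"
    proof (rule summable_comparison_test'[where N = 0])
      fix n
      have "c n = exp (t / 2) * ((-1) ^ n * q ^ (Suc n choose 2) * exp t ^ n) -
         exp (- t / 2) * ((-1) ^ n * q ^ (Suc n choose 2) * exp (- t) ^ n)"
        by (simp add: c_def algebra_simps)
      hence "norm (c n) \<le> norm (exp (t / 2) * ((-1) ^ n * q ^ (Suc n choose 2) * exp t ^ n)) +
          norm (exp (- t / 2) * ((-1) ^ n * q ^ (Suc n choose 2) * exp (- t) ^ n))"
        using norm_triangle_ineq4 by simp
      thus "norm (norm (c n)) \<le> norm (exp (t / 2)) * norm ((-1) ^ n * q ^ (Suc n choose 2) * exp t ^ n) +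
        norm (exp (- t / 2)) * norm ((-1) ^ n * q ^ (Suc n choose 2) * exp (- t) ^ n)"
        by (simp add: norm_mult)
    qed
  qed
  have "(\<lambda>N. suminf (\<lambda>n. c n * G n N)) \<longlonglongrightarrow> (suminf (\<lambda>n. c n * inverse (euler_prod q)))"
  proof -
    have "norm (c n * G n N) \<le> norm (c n) * (B1 * B2 * B2)" for n N
      unfolding norm_mult by (intro mult_left_mono G_bd) auto
    hence "\<forall>\<^sub>F (n, N) in at_top \<times>\<^sub>F sequentially. norm (c n * G n N) \<le> norm (c n) * (B1 * B2 * B2)"
      by (simp add: always_eventually)
    thus ?thesis
      using tannerys_theorem[of "\<lambda>n N. c n * G n N" "\<lambda>n. c n * inverse (euler_prod q)" sequentially
              "\<lambda>n. norm (c n) * (B1 * B2 * B2)"] c_summable tendsto_mult[OF tendsto_const G_lim]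
      by auto
  qed
  also have "(\<lambda>N. suminf (\<lambda>n. c n * G n N)) =
     (\<lambda>N. (exp (t / 2) - exp (- t / 2)) * ((\<Prod>i<N. 1 - q ^ Suc i * exp t) * (\<Prod>i<N. 1 - q ^ Suc i * exp (- t))))"
  proof
    fix N
    have "(suminf (\<lambda>n. c n * G n N)) = (\<Sum>n<Suc N. c n * G n N)"
      by (rule suminf_finite) (auto simp: G0)
    also have "\<dots> = exp (t / 2) * (\<Sum>n<Suc N. (-1) ^ n * q ^ (Suc n choose 2) *
         (exp t ^ n - inverse (exp t) ^ Suc n) * G n N)"
    proof -
      have "exp (- t / 2) = exp (t / 2) * inverse (exp t)"
        by (simp add: exp_minus[symmetric] mult_exp_exp)
      hence "c n = exp (t / 2) * ((-1) ^ n * q ^ (Suc n choose 2) * (exp t ^ n - inverse (exp t) ^ Suc n))" for n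
        by (simp add: c_def exp_minus algebra_simps)
      thus ?thesis by (simp only: sum_distrib_left mult.assoc)
    qed
    also have "\<dots> = exp (t / 2) * ((\<Prod>i<N. 1 - q ^ Suc i * exp t) * (\<Prod>i<Suc N. 1 - q ^ i / exp t))"
      unfolding G_def by (subst finite_triple_product[OF assms(1,2)]) auto
    also have "(\<Prod>i<Suc N. 1 - q ^ i / exp t) = (1 - exp (- t)) * (\<Prod>i<N. 1 - q ^ Suc i * exp (- t))"
      by (subst prod.lessThan_Suc_shift) (simp add: exp_minus divide_inverse)
    also have "exp (t / 2) * (A * ((1 - exp (- t)) * B)) = (exp (t / 2) - exp (- t / 2)) * (A * B)" for A B
    proof -
      have "exp (- t / 2) = exp (t / 2) * exp (- t)" by (simp add: mult_exp_exp)
      thus ?thesis by (simp add: algebra_simps)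
    qed
    finally show "(suminf (\<lambda>n. c n * G n N)) = (exp (t / 2) - exp (- t / 2)) *
        ((\<Prod>i<N. 1 - q ^ Suc i * exp t) * (\<Prod>i<N. 1 - q ^ Suc i * exp (- t)))" .
  qed
  finally have "(\<lambda>N. (exp (t / 2) - exp (- t / 2)) * ((\<Prod>i<N. 1 - q ^ Suc i * exp t) * (\<Prod>i<N. 1 - q ^ Suc i * exp (- t))))
     \<longlonglongrightarrow> (suminf (\<lambda>n. c n * inverse (euler_prod q)))" .
  moreover have "(\<lambda>N. (exp (t / 2) - exp (- t / 2)) * ((\<Prod>i<N. 1 - q ^ Suc i * exp t) * (\<Prod>i<N. 1 - q ^ Suc i * exp (- t))))
     \<longlonglongrightarrow> (exp (t / 2) - exp (- t / 2)) * (exp (- ?l t) * exp (- ?l (- t)))"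
    unfolding lambert_exp_def by (intro tendsto_intros tendsto_prod_one_minus_power assms)
  ultimately have "(exp (t / 2) - exp (- t / 2)) * (exp (- ?l t) * exp (- ?l (- t))) = (suminf (\<lambda>n. c n * inverse (euler_prod q)))"
    by (rule LIMSEQ_unique[symmetric])
  also have "\<dots> = theta q t * inverse (euler_prod q)"
    using theta_sums[OF assms(1), of t] unfolding c_def by (intro sums_unique[symmetric] sums_mult2)
  finally have "theta q t = (exp (t / 2) - exp (- t / 2)) * (exp (- ?l t) * exp (- ?l (- t))) * euler_prod q"
    by (simp add: field_simps)
  thus ?thesis by (simp add: exp_diff exp_minus field_simps)
qed

section \<open>Comparison with the Jacobi theta function, and quasi-periods\<close>

abbreviation two_pi_i :: complex where
  "two_pi_i \<equiv> 2 * of_real pi * \<i>"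

text \<open>The factor \<open>exp (w / 8)\<close> comes from completing the square,
  \<open>(n + 1/2)^2 / 2 = n (n + 1) / 2 + 1/8\<close>, and the factor \<open>\<i>\<close> from the
  shift of \<open>z\<close> by \<open>1/2\<close>, which contributes
  \<open>\<i> * (-1) ^ n\<close>.\<close>

lemma jacobi_vartheta_eq_theta:
  assumes "Im \<tau> > 0"
  shows "jacobi_vartheta z \<tau> =
    \<i> * exp (two_pi_i * \<tau> / 8) * theta (exp (two_pi_i * \<tau>)) (two_pi_i * z)"
proof -
  define w t where "w = two_pi_i * \<tau>" and "t = two_pi_i * z"
  define T where "T = (\<lambda>k::int. let n = of_int k + 1/2 in
     exp (of_real pi * \<i> * n\<^sup>2 * \<tau> + two_pi_i * n * (z + 1/2)))"
  have q: "norm (exp w) < 1" using assms by (simp add: w_def)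
  define c where "c = (\<lambda>n. (-1) ^ n * exp w ^ (Suc n choose 2))"
  define K where "K = \<i> * exp (w / 8)"
  have exp_sq: "exp w ^ (Suc n choose 2) * exp (w / 8) = exp (w * (of_nat n + 1 / 2)\<^sup>2 / 2)" for n
  proof -
    have "2 * complex_of_nat (Suc n choose 2) = of_nat n * (of_nat n + 1)"
      using two_mult_Suc_choose_two[of n] by (metis of_nat_mult of_nat_numeral of_nat_Suc add.commute)
    hence "complex_of_nat (Suc n choose 2) = of_nat n * (of_nat n + 1) / 2"
      by (metis nonzero_mult_div_cancel_left zero_neq_numeral)
    hence "of_nat (Suc n choose 2) * w + w / 8 = w * (of_nat n + 1 / 2)\<^sup>2 / 2"
      by (simp only:) (simp add: power2_eq_square field_simps)
    thus ?thesis by (simp only: exp_of_nat_mult[symmetric] mult_exp_exp)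
  qed
  have exp_half: "exp (two_pi_i * (of_nat n + 1/2) * (1/2)) = \<i> * (-1) ^ n" for n
  proof -
    have "two_pi_i * (of_nat n + 1/2) * (1/2) = of_nat n * (\<i> * of_real pi) + \<i> * of_real pi / 2"
      by (simp add: field_simps)
    thus ?thesis
      by (simp only: exp_add exp_of_nat_mult exp_pi_i' ) (simp add: exp_eq_polar exp_Euler cos_of_real sin_of_real flip: of_real_divide)
  qed
  have T1: "T (int n) = K * (exp (t / 2) * (c n * exp t ^ n))" for n
  proof -
    have "T (int n) = exp (w * (of_nat n + 1 / 2)\<^sup>2 / 2) * exp (t / 2 + of_nat n * t) *
         exp (two_pi_i * (of_nat n + 1/2) * (1/2))"
      unfolding mult_exp_exp T_def Let_def w_def t_def
      by (intro arg_cong[of _ _ exp]) (simp add: field_simps)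
    thus ?thesis unfolding exp_half exp_sq[symmetric]
      by (simp add: K_def c_def exp_add exp_of_nat_mult mult.assoc mult.left_commute)
  qed
  have T2: "T (- int n - 1) = K * (- (exp (- t / 2) * (c n * exp (- t) ^ n)))" for n
  proof -
    have "T (- int n - 1) = exp (w * (of_nat n + 1 / 2)\<^sup>2 / 2) * exp (- t / 2 + of_nat n * (- t)) *
         inverse (exp (two_pi_i * (of_nat n + 1/2) * (1/2)))"
      unfolding mult_exp_exp exp_minus[symmetric] T_def Let_def w_def t_def
      by (intro arg_cong[of _ _ exp]) (simp add: field_simps power2_eq_square)
    moreover have "exp (- t / 2 + of_nat n * (- t)) = exp (- t / 2) * exp (- t) ^ n"
      by (simp only: exp_add exp_of_nat_mult)
    ultimately show ?thesis unfolding exp_half exp_sq[symmetric]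
      by (simp add: K_def c_def mult.assoc mult.left_commute power_inverse[symmetric])
  qed
  have abs: "((\<lambda>n. c n * x ^ n) has_sum theta_series (exp w) x) UNIV" for x
    unfolding c_def theta_series_def
    by (rule norm_summable_imp_has_sum[OF theta_series_summable[OF q]
          summable_sums[OF summable_norm_cancel[OF theta_series_summable[OF q]]]])
  have "((\<lambda>n. T (int n)) has_sum K * (exp (t / 2) * theta_series (exp w) (exp t))) UNIV"
    unfolding T1 by (intro has_sum_cmult_right abs)
  hence 1: "(T has_sum K * (exp (t / 2) * theta_series (exp w) (exp t))) (range int)"
    by (subst has_sum_reindex) (auto simp: o_def)
  have "((\<lambda>n. T (- int n - 1)) has_sum K * (- (exp (- t / 2) * theta_series (exp w) (exp (- t))))) UNIV"
    unfolding T2 by (intro has_sum_cmult_right has_sum_uminusI abs)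
  hence 2: "(T has_sum K * (- (exp (- t / 2) * theta_series (exp w) (exp (- t))))) (range (\<lambda>n. - int n - 1))"
    by (subst has_sum_reindex) (auto simp: o_def inj_on_def)
  have "(T has_sum K * (exp (t / 2) * theta_series (exp w) (exp t)) +
     K * (- (exp (- t / 2) * theta_series (exp w) (exp (- t))))) (range int \<union> range (\<lambda>n. - int n - 1))"
    by (rule has_sum_Un_disjoint[OF 1 2]) auto
  moreover have "range int \<union> range (\<lambda>n. - int n - 1) = UNIV"
  proof -
    have "k \<in> range int \<union> range (\<lambda>n. - int n - 1)" for k
      by (cases k) auto
    thus ?thesis by blast
  qed
  ultimately have "(T has_sum K * theta (exp w) t) UNIV"
    by (simp add: theta_def algebra_simps)
  thus ?thesis
    by (simp add: jacobi_vartheta_def T_def K_def w_def t_def infsumI)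
qed

lemma theta_add_2pi_i: "theta q (t + two_pi_i) = - theta q t"
proof -
  have "exp ((t + two_pi_i) / 2) = - exp (t / 2)"
    by (simp add: add_divide_distrib exp_add)
  moreover have "exp (- (t + two_pi_i) / 2) = - exp (- t / 2)"
    by (simp add: add_divide_distrib diff_divide_distrib exp_diff)
  moreover have "exp (t + two_pi_i) = exp t" by (simp add: exp_add)
  moreover have "exp (- (t + two_pi_i)) = exp (- t)" by (simp add: exp_diff)
  ultimately show ?thesis unfolding theta_def by simp
qed

text \<open>In the sum over all integers a shift by \<open>\<tau>\<close> is a shift of the
  summation index; in the folded series \<open>theta\<close> it would move terms between the two
  halves.\<close>

lemma jacobi_vartheta_add_tau:
  "jacobi_vartheta (z + \<tau>) \<tau> = - exp (- of_real pi * \<i> * \<tau> - two_pi_i * z) * jacobi_vartheta z \<tau>"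
proof -
  define T where "T = (\<lambda>z (k::int). let n = of_int k + 1/2 in
     exp (of_real pi * \<i> * n\<^sup>2 * \<tau> + two_pi_i * n * (z + 1/2)))"
  have "jacobi_vartheta (z + \<tau>) \<tau> = infsum (T (z + \<tau>)) UNIV"
    by (simp add: jacobi_vartheta_def T_def)
  also have "T (z + \<tau>) k = (- exp (- of_real pi * \<i> * \<tau> - two_pi_i * z)) * T z (k + 1)" for k
  proof -
    have "- exp (- of_real pi * \<i> * \<tau> - two_pi_i * z) =
        exp (- of_real pi * \<i> * \<tau> - two_pi_i * z + - (\<i> * of_real pi))"
      unfolding exp_add by (simp add: exp_minus)
    thus ?thesis unfolding T_def Let_def mult_exp_exp
      by (simp only: mult_exp_exp, intro arg_cong[of _ _ exp]) (simp add: field_simps power2_eq_square)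
  qed
  hence "T (z + \<tau>) = (\<lambda>k. (- exp (- of_real pi * \<i> * \<tau> - two_pi_i * z)) * T z (k + 1))" ..
  also have "infsum \<dots> UNIV = (- exp (- of_real pi * \<i> * \<tau> - two_pi_i * z)) * infsum (\<lambda>k. T z (k + 1)) UNIV"
    by (rule infsum_cmult_right')
  also have "infsum (\<lambda>k. T z (k + 1)) UNIV = infsum (T z) UNIV"
    by (rule infsum_reindex_bij_betw[of "\<lambda>k::int. k + 1"]) (rule bij_betwI[of _ _ _ "\<lambda>k. k - 1"], auto)
  finally show ?thesis by (simp add: jacobi_vartheta_def T_def)
qed

lemma theta_add_period:
  assumes "Re w < 0"
  shows "theta (exp w) (t + w) = - exp (- w / 2 - t) * theta (exp w) t"
proof -
  define \<tau> z where "\<tau> = w / two_pi_i" and "z = t / two_pi_i"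
  have w: "two_pi_i * \<tau> = w" and t: "two_pi_i * z = t"
    by (simp_all add: \<tau>_def z_def)
  have Im: "Im \<tau> > 0" using assms w[symmetric] by (auto simp: zero_less_mult_iff)
  have e: "- of_real pi * \<i> * \<tau> - t = - w / 2 - t"
    by (simp add: w[symmetric])
  have "\<i> * exp (w / 8) * theta (exp w) (t + w) = - exp (- w / 2 - t) * (\<i> * exp (w / 8) * theta (exp w) t)"
    using jacobi_vartheta_add_tau[of z \<tau>] unfolding jacobi_vartheta_eq_theta[OF Im] distrib_left w t e .
  hence "(\<i> * exp (w / 8)) * theta (exp w) (t + w) = (\<i> * exp (w / 8)) * (- exp (- w / 2 - t) * theta (exp w) t)"
    by (simp only: mult_ac)
  thus ?thesis by (subst (asm) mult_cancel_left) simp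
qed


section \<open>Elliptic functions\<close>

text \<open>The codomain is arbitrary, so that the invariance of predicates, such as membership in
  the lattice, is covered as well.\<close>

lemma periodic_of_int:
  fixes f :: "'a::ring_1 \<Rightarrow> 'b"
  assumes "\<And>t. f (t + c) = f t"
  shows "f (t + of_int n * c) = f t"
proof -
  have nat: "f (t + of_nat k * c) = f t" for t k
  proof (induction k arbitrary: t)
    case (Suc k)
    have "f (t + of_nat (Suc k) * c) = f ((t + of_nat k * c) + c)" by (simp add: algebra_simps)
    thus ?case by (simp only: assms Suc.IH)
  qed simp
  show ?thesis
  proof (cases n rule: int_cases2)
    case (nonneg k)
    thus ?thesis using nat by simp
  next
    case (nonpos k)
    thus ?thesis using nat[of "t - of_nat k * c" k] by simp
  qed
qed

section \<open>The period lattice, the zeros of theta and Liouville's theorem\<close>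

definition period_lattice :: "complex \<Rightarrow> complex set" where
  "period_lattice w = {of_int m * w + of_int n * two_pi_i |m n. True}"

lemma period_lattice_add:
  assumes "s \<in> period_lattice w" "t \<in> period_lattice w"
  shows "s + t \<in> period_lattice w" "s - t \<in> period_lattice w"
proof -
  from assms obtain k l m n where "s = of_int k * w + of_int l * two_pi_i"
    "t = of_int m * w + of_int n * two_pi_i"
    unfolding period_lattice_def by blast
  hence "s + t = of_int (k + m) * w + of_int (l + n) * two_pi_i"
    "s - t = of_int (k - m) * w + of_int (l - n) * two_pi_i"
    by (simp_all add: algebra_simps)
  thus "s + t \<in> period_lattice w" "s - t \<in> period_lattice w"
    unfolding period_lattice_def by blast+
qed

lemma period_lattice_add_iff [simp]:
  "t + w \<in> period_lattice w \<longleftrightarrow> t \<in> period_lattice w"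
  "t + two_pi_i \<in> period_lattice w \<longleftrightarrow> t \<in> period_lattice w"
proof -
  have "w = of_int 1 * w + of_int 0 * two_pi_i"
    "two_pi_i = of_int 0 * w + of_int 1 * two_pi_i" by simp_all
  hence "w \<in> period_lattice w" "two_pi_i \<in> period_lattice w"
    unfolding period_lattice_def by blast+
  moreover have "t + s \<in> period_lattice w \<longleftrightarrow> t \<in> period_lattice w" if "s \<in> period_lattice w" for s
    using period_lattice_add(1)[of t w s] period_lattice_add(2)[OF _ that, of "t + s"] that by fastforce
  ultimately show "t + w \<in> period_lattice w \<longleftrightarrow> t \<in> period_lattice w"
    "t + two_pi_i \<in> period_lattice w \<longleftrightarrow> t \<in> period_lattice w" by blast+
qed

lemma zero_in_period_lattice [simp]: "0 \<in> period_lattice w"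
  unfolding period_lattice_def by (rule CollectI, rule exI[of _ 0], rule exI[of _ 0]) simp

lemma period_lattice_strip:
  assumes "Re w < 0" "t \<in> period_lattice w" "\<bar>Re t\<bar> < - Re w"
  shows "exp t = 1"
proof -
  from assms(2) obtain m n where t: "t = of_int m * w + of_int n * two_pi_i"
    unfolding period_lattice_def by blast
  hence "\<bar>of_int m\<bar> * (- Re w) < 1 * (- Re w)" using assms(1,3) by (simp add: abs_mult)
  hence "\<bar>of_int m :: real\<bar> < 1" using assms(1) by (simp add: mult_less_cancel_right)
  hence "m = 0" by linarith
  thus ?thesis using t by (auto simp: exp_eq_1 mult_ac)
qed

lemma right_strip_not_in_period_lattice:
  assumes "Re w < 0" "0 < Re t" "Re t < - Re w"
  shows "t \<notin> period_lattice w"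
proof
  assume "t \<in> period_lattice w"
  hence "exp t = 1" using assms by (intro period_lattice_strip[OF assms(1)]) auto
  thus False using assms by (auto simp: exp_eq_1)
qed

lemma exp_eq_1_imp_in_period_lattice:
  assumes "exp t = 1"
  shows "t \<in> period_lattice w"
proof -
  from assms obtain n :: int where "Re t = 0" "Im t = of_int (2 * n) * pi"
    by (auto simp: exp_eq_1)
  hence "t = of_int 0 * w + of_int n * two_pi_i" by (simp add: complex_eq_iff)
  thus ?thesis unfolding period_lattice_def by blast
qed

lemma in_strip_imp_norm_less:
  assumes "Re w < 0" "\<bar>Re t\<bar> < - Re w"
  shows "norm (exp w * exp t) < 1" "norm (exp w * exp (- t)) < 1"
  using assms by (simp_all add: norm_mult mult_exp_exp)

text \<open>Both sides are invariant under \<open>w\<close>, so rounding \<open>Re t / Re w\<close>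
  moves the point into the strip of the triple product. There the product of exponentials never
  vanishes, and the zeros are those of \<open>exp (u / 2) - exp (- u / 2)\<close>.\<close>

lemma theta_eq_0_iff:
  assumes "Re w < 0"
  shows "theta (exp w) t = 0 \<longleftrightarrow> t \<in> period_lattice w"
proof -
  have per: "theta (exp w) (t + of_int n * w) = 0 \<longleftrightarrow> theta (exp w) t = 0" for t n
    by (rule periodic_of_int[of "\<lambda>t. theta (exp w) t = 0"]) (simp add: theta_add_period[OF assms])
  have lat: "t + of_int n * w \<in> period_lattice w \<longleftrightarrow> t \<in> period_lattice w" for t n
    by (rule periodic_of_int[of "\<lambda>t. t \<in> period_lattice w"]) simp
  define n where "n = - round (Re t / Re w)"
  define u where "u = t + of_int n * w"
  have "\<bar>Re t / Re w + of_int n\<bar> \<le> 1 / 2"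
    using of_int_round_abs_le[of "Re t / Re w"] by (simp add: n_def abs_minus_commute)
  hence "\<bar>Re t / Re w + of_int n\<bar> * \<bar>Re w\<bar> \<le> 1 / 2 * \<bar>Re w\<bar>" by (rule mult_right_mono) auto
  moreover have "Re u = (Re t / Re w + of_int n) * Re w"
    using assms by (simp add: u_def field_simps)
  ultimately have "\<bar>Re u\<bar> \<le> 1 / 2 * \<bar>Re w\<bar>" by (simp only: abs_mult)
  hence u: "\<bar>Re u\<bar> < - Re w" using assms by simp
  have "theta (exp w) u = 0 \<longleftrightarrow> exp (u / 2) = exp (- u / 2)"
    using theta_triple_product[of "exp w" u] in_strip_imp_norm_less[OF assms u] assms by simp
  also have "\<dots> \<longleftrightarrow> exp u = 1"
  proof -
    have "exp (u / 2) = exp (- u / 2) \<longleftrightarrow> exp (u / 2) * exp (u / 2) = 1"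
      by (simp add: exp_minus field_simps)
    thus ?thesis by (simp add: mult_exp_exp)
  qed
  also have "\<dots> \<longleftrightarrow> u \<in> period_lattice w"
    using period_lattice_strip[OF assms _ u] exp_eq_1_imp_in_period_lattice by blast
  finally show ?thesis unfolding u_def per lat .
qed

text \<open>The lattice is the zero set of the continuous function
  \<open>theta (exp w)\<close>.\<close>

lemma closed_period_lattice:
  assumes "Re w < 0"
  shows "closed (period_lattice w)"
proof -
  have "continuous_on UNIV (theta (exp w))"
    using assms by (intro holomorphic_on_imp_continuous_on holomorphic_theta[of _ "\<lambda>x. x"] holomorphic_intros) auto
  hence "closed (theta (exp w) -` {0})"
    by (intro continuous_closed_vimage) (auto simp: continuous_on_eq_continuous_at)
  moreover have "theta (exp w) -` {0} = period_lattice w"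
    using theta_eq_0_iff[OF assms] by auto
  ultimately show ?thesis by simp
qed

lemma open_compl_period_lattice: "Re w < 0 \<Longrightarrow> open (- period_lattice w)"
  using closed_period_lattice by (simp add: open_Compl)

lemma small_not_in_period_lattice:
  assumes "Re w < 0" "norm t < min (- Re w) (2 * pi)" "t \<noteq> 0"
  shows "t \<notin> period_lattice w"
proof
  assume "t \<in> period_lattice w"
  moreover have "\<bar>Re t\<bar> < - Re w" using assms abs_Re_le_cmod[of t] by linarith
  ultimately have "exp t = 1" by (rule period_lattice_strip[OF assms(1)])
  then obtain n :: int where n: "Re t = 0" "Im t = of_int (2 * n) * pi" by (auto simp: exp_eq_1)
  have "\<bar>Im t\<bar> < 2 * pi" using assms abs_Im_le_cmod[of t] by linarith
  hence "\<bar>of_int n\<bar> * (2 * pi) < 1 * (2 * pi)" by (simp add: n abs_mult)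
  hence "\<bar>of_int n :: real\<bar> < 1" by (simp add: mult_less_cancel_right)
  hence "n = 0" by linarith
  with n assms(3) show False by (simp add: complex_eq_iff)
qed

lemma eventually_not_in_period_lattice:
  assumes "Re w < 0"
  shows "\<forall>\<^sub>F t in at 0. t \<notin> period_lattice w"
proof -
  have "\<forall>\<^sub>F t in at 0. t \<in> ball 0 (min (- Re w) (2 * pi)) - {0}"
    using assms by (intro eventually_at_in_open) auto
  thus ?thesis
    by eventually_elim (use small_not_in_period_lattice[OF assms] in auto)
qed

text \<open>A finite limit at \<open>0\<close> removes the singularity there, and the periods carry
  this to every other lattice point. The resulting entire function takes all its values on a closed
  period parallelogram, which is compact, so Liouville's theorem applies.\<close>

theorem elliptic_constant:
  assumes w: "Re w < 0" and hol: "f holomorphic_on - period_lattice w"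
    and per1: "\<And>t. t \<notin> period_lattice w \<Longrightarrow> f (t + two_pi_i) = f t"
    and per2: "\<And>t. t \<notin> period_lattice w \<Longrightarrow> f (t + w) = f t"
    and lim: "f \<midarrow>0\<rightarrow> c"
    and t: "t \<notin> period_lattice w"
  shows "f t = c"
proof -
  define g where "g = (\<lambda>t. if t \<in> period_lattice w then c else f t)"
  define r where "r = min (- Re w) (2 * pi)"
  have r: "r > 0" using w by (simp add: r_def)
  have "g (t + w) = g t" "g (t + two_pi_i) = g t" for t
    using per1 per2 by (auto simp: g_def)
  note int_per = periodic_of_int[of g w, OF this(1)] periodic_of_int[of g "two_pi_i", OF this(2)]
  have lat: "g (t + (of_int m * w + of_int n * two_pi_i)) = g t" for t m n
    using int_per(2)[of "t + of_int m * w" n] int_per(1)[of t m] by (simp only: add.assoc)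
  have diff0: "g field_differentiable at 0"
  proof -
    have "(\<lambda>y. if y = 0 then c else f y) holomorphic_on ball 0 r"
    proof (rule removable_singularity)
      show "f holomorphic_on ball 0 r - {0}"
        by (rule holomorphic_on_subset[OF hol]) (use small_not_in_period_lattice[OF w] in \<open>auto simp: r_def\<close>)
    qed (use lim in auto)
    moreover have "(if y = 0 then c else f y) = g y" if "y \<in> ball 0 r" for y
      using small_not_in_period_lattice[OF w, of y] that by (auto simp: g_def r_def)
    ultimately have "g holomorphic_on ball 0 r"
      by (subst holomorphic_cong[OF refl]) auto
    thus ?thesis by (rule holomorphic_on_imp_differentiable_at) (use r in auto)
  qed
  have diff: "g field_differentiable at t" for t
  proof (cases "t \<in> period_lattice w")
    case True
    then obtain m n where t: "t = of_int m * w + of_int n * two_pi_i"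
      unfolding period_lattice_def by blast
    obtain D where "(g has_field_derivative D) (at 0)"
      using diff0 unfolding field_differentiable_def by blast
    hence "((\<lambda>x. g (x - t)) has_field_derivative D) (at t)"
      using DERIV_shift[of "\<lambda>x. g (x - t)" D 0 t] by (simp add: add.commute)
    moreover have "(\<lambda>x. g (x - t)) = g"
    proof
      fix x show "g (x - t) = g x" using lat[of "x - t" m n] unfolding t by simp
    qed
    ultimately show ?thesis unfolding field_differentiable_def by auto
  next
    case False
    have "g holomorphic_on - period_lattice w"
      by (rule holomorphic_transform[OF hol]) (auto simp: g_def)
    thus ?thesis
      by (rule holomorphic_on_imp_differentiable_at) (use False open_compl_period_lattice[OF w] in auto)
  qed
  hence holg: "g holomorphic_on UNIV"
    by (auto simp: holomorphic_on_def intro: field_differentiable_at_within)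
  have "bounded (range g)"
  proof -
    define h where "h = (\<lambda>p. g (of_real (fst p) * w + of_real (snd p) * two_pi_i))"
    have "continuous_on UNIV g" using holg by (rule holomorphic_on_imp_continuous_on)
    hence "continuous_on ({0..1} \<times> {0..1}) h"
      unfolding h_def by (rule continuous_on_compose2) (auto intro!: continuous_intros)
    hence "compact (h ` ({0..1} \<times> {0..1}))"
      by (rule compact_continuous_image) (intro compact_Times compact_Icc)
    moreover have "range g \<subseteq> h ` ({0..1} \<times> {0..1})"
    proof safe
      fix t
      \<comment> \<open>\<open>x\<close> and \<open>y\<close> are the real coordinates of
        \<open>t\<close> in the basis \<open>w\<close>, \<open>two_pi_i\<close>; their fractional
        parts lie in the unit square.\<close>
      define x where "x = Re t / Re w"
      define y where "y = (Im t - x * Im w) / (2 * pi)"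
      have t: "t = of_real x * w + of_real y * two_pi_i"
        using w by (simp add: complex_eq_iff x_def y_def)
      have "g t = g (of_real (frac x) * w + of_real (frac y) * two_pi_i +
          (of_int \<lfloor>x\<rfloor> * w + of_int \<lfloor>y\<rfloor> * two_pi_i))"
        by (simp add: t frac_def algebra_simps)
      also have "\<dots> = h (frac x, frac y)" unfolding lat by (simp add: h_def)
      finally show "g t \<in> h ` ({0..1} \<times> {0..1})"
        by (rule image_eqI) (simp add: frac_ge_0 less_imp_le[OF frac_lt_1])
    qed
    ultimately show ?thesis by (meson bounded_subset compact_imp_bounded)
  qed
  from Liouville_theorem[OF holg this] obtain d where d: "\<And>t. g t = d"
    unfolding constant_on_def by auto
  have "d = c" using d[of 0] by (simp add: g_def)
  thus ?thesis using d[of t] t by (simp add: g_def)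
qed


section \<open>The logarithmic derivative of theta\<close>

text \<open>Up to a linear term this is the Weierstrass zeta function, normalised so that it has the
  period \<open>two_pi_i\<close> and gains only \<open>- 1\<close> under \<open>w\<close>.\<close>

definition theta_ld :: "complex \<Rightarrow> complex \<Rightarrow> complex" where
  "theta_ld q t = deriv (theta q) t / theta q t"

lemma has_field_derivative_theta:
  assumes "norm q < 1"
  shows "(theta q has_field_derivative deriv (theta q) t) (at t)"
  using holomorphic_theta[OF assms, of "\<lambda>t. t" UNIV]
  by (intro holomorphic_derivI[of _ UNIV]) (auto intro: holomorphic_intros)

lemma holomorphic_theta_ld:
  assumes "Re w < 0"
  shows "theta_ld (exp w) holomorphic_on - period_lattice w"
  unfolding theta_ld_def[abs_def]
  using assms theta_eq_0_iff[OF assms]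
  by (intro holomorphic_intros holomorphic_deriv[of _ UNIV, THEN holomorphic_on_subset]
        holomorphic_theta[of _ "\<lambda>t. t"]) auto

lemma theta_ld_add_2pi_i:
  assumes "norm q < 1"
  shows "theta_ld q (t + two_pi_i) = theta_ld q t"
proof -
  have "((\<lambda>t. theta q (t + two_pi_i)) has_field_derivative deriv (theta q) (t + two_pi_i)) (at t)"
    by (rule DERIV_shift[THEN iffD1], rule has_field_derivative_theta[OF assms])
  moreover have "((\<lambda>t. - theta q t) has_field_derivative - deriv (theta q) t) (at t)"
    by (intro derivative_intros has_field_derivative_theta assms)
  ultimately have "deriv (theta q) (t + two_pi_i) = - deriv (theta q) t"
    unfolding theta_add_2pi_i by (rule DERIV_unique)
  thus ?thesis by (simp add: theta_ld_def theta_add_2pi_i)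
qed

lemma theta_ld_add_period:
  assumes "Re w < 0" "t \<notin> period_lattice w"
  shows "theta_ld (exp w) (t + w) = theta_ld (exp w) t - 1"
proof -
  let ?th = "theta (exp w)"
  have q: "norm (exp w) < 1" using assms by simp
  have "((\<lambda>t. ?th (t + w)) has_field_derivative deriv ?th (t + w)) (at t)"
    by (rule DERIV_shift[THEN iffD1], rule has_field_derivative_theta[OF q])
  moreover have "((\<lambda>t. - exp (- w / 2 - t) * ?th t) has_field_derivative
      - exp (- w / 2 - t) * (deriv ?th t - ?th t)) (at t)"
    by (rule derivative_eq_intros has_field_derivative_theta q refl | simp add: algebra_simps)+
  ultimately have "deriv ?th (t + w) = - exp (- w / 2 - t) * (deriv ?th t - ?th t)"
    unfolding theta_add_period[OF assms(1)] by (rule DERIV_unique)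
  moreover have "?th t \<noteq> 0" using theta_eq_0_iff[OF assms(1)] assms(2) by simp
  ultimately show ?thesis by (simp add: theta_ld_def theta_add_period[OF assms(1)] field_simps)
qed

lemma theta_ld_minus:
  assumes "norm q < 1"
  shows "theta_ld q (- t) = - theta_ld q t"
proof -
  have "((\<lambda>t. theta q (- t)) has_field_derivative deriv (theta q) (- t) * (- 1)) (at t)"
    by (rule DERIV_chain2[where f = "theta q" and g = uminus, OF has_field_derivative_theta[OF assms]])
       (auto intro!: derivative_eq_intros)
  moreover have "((\<lambda>t. - theta q t) has_field_derivative - deriv (theta q) t) (at t)"
    by (intro derivative_intros has_field_derivative_theta assms)
  ultimately have "deriv (theta q) (- t) = deriv (theta q) t"
    unfolding theta_minus by (metis DERIV_unique mult_minus1_right neg_equal_iff_equal)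
  thus ?thesis by (simp add: theta_ld_def theta_minus)
qed

section \<open>Lambert expansions in the strip\<close>

abbreviation lambert_pow :: "complex \<Rightarrow> nat \<Rightarrow> complex \<Rightarrow> complex" where
  "lambert_pow q r \<equiv> lambert_exp q (\<lambda>n. of_nat (Suc n) ^ r)"

lemma has_field_derivative_lambert_pow:
  assumes "norm q < 1" "norm (q * exp t) < 1"
  shows "(lambert_pow q r has_field_derivative lambert_pow q (Suc r) t) (at t)"
  using has_field_derivative_lambert_exp[OF assms poly_bounded_power[of r]] by simp

lemma open_strip: "open {t. \<bar>Re t\<bar> < (a::real)}"
  by (intro open_Collect_less continuous_intros)

text \<open>Stated for \<open>theta\<close> and its derivative instead of their quotient, so that it
  also applies at the zero \<open>t = 0\<close>, where it yields
  \<open>deriv_theta_0\<close>.\<close>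

lemma theta_strip_derivative:
  fixes w t :: complex
  assumes w: "Re w < 0" and t: "\<bar>Re t\<bar> < - Re w"
  defines "E \<equiv> euler_prod (exp w) * exp (- lambert_exp (exp w) (\<lambda>n. 1 / of_nat (Suc n)) t
     - lambert_exp (exp w) (\<lambda>n. 1 / of_nat (Suc n)) (- t))"
  shows "theta (exp w) t = (exp (t / 2) - exp (- t / 2)) * E"
    and "deriv (theta (exp w)) t = (exp (t / 2) + exp (- t / 2)) / 2 * E +
      theta (exp w) t * (lambert_pow (exp w) 0 (- t) - lambert_pow (exp w) 0 t)"
proof -
  let ?l = "lambert_exp (exp w) (\<lambda>n. 1 / of_nat (Suc n))"
  let ?f = "\<lambda>t. (exp (t / 2) - exp (- t / 2)) * (euler_prod (exp w) * exp (- ?l t - ?l (- t)))"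
  have q: "norm (exp w) < 1" using w by simp
  have eq: "theta (exp w) t = ?f t" if "\<bar>Re t\<bar> < - Re w" for t
    using theta_triple_product[OF q _ in_strip_imp_norm_less[OF w that]] by (simp add: mult_ac)
  show eqt: "theta (exp w) t = (exp (t / 2) - exp (- t / 2)) * E"
    using eq[OF t] by (simp add: E_def)
  have coeff: "(\<lambda>n. of_nat (Suc n) * (1 / of_nat (Suc n))) = (\<lambda>n. of_nat (Suc n) ^ 0 :: complex)"
    by (auto simp del: of_nat_Suc)
  have dl: "(?l has_field_derivative lambert_pow (exp w) 0 u) (at u)" if "\<bar>Re u\<bar> < - Re w" for u
    using has_field_derivative_lambert_exp[OF q in_strip_imp_norm_less(1)[OF w that] poly_bounded_inverse]
    unfolding coeff .
  have dlm: "((\<lambda>t. ?l (- t)) has_field_derivative - lambert_pow (exp w) 0 (- t)) (at t)"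
  proof -
    have "((\<lambda>t. ?l (- t)) has_field_derivative lambert_pow (exp w) 0 (- t) * (- 1)) (at t)"
      by (rule DERIV_chain2[where f = ?l and g = uminus, OF dl])
         (use t in \<open>auto intro!: derivative_eq_intros\<close>)
    thus ?thesis by simp
  qed
  have "(?f has_field_derivative (exp (t / 2) + exp (- t / 2)) / 2 * E +
      (exp (t / 2) - exp (- t / 2)) * (E * (lambert_pow (exp w) 0 (- t) - lambert_pow (exp w) 0 t))) (at t)"
    unfolding E_def
    by (rule derivative_eq_intros dl[OF t] dlm refl | simp add: algebra_simps)+
  moreover have "\<forall>\<^sub>F u in nhds t. theta (exp w) u = ?f u"
  proof -
    have "\<forall>\<^sub>F u in nhds t. u \<in> {t. \<bar>Re t\<bar> < - Re w}"
      using t by (intro eventually_nhds_in_open open_strip) auto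
    thus ?thesis by eventually_elim (rule eq, auto)
  qed
  ultimately have "(theta (exp w) has_field_derivative (exp (t / 2) + exp (- t / 2)) / 2 * E +
      (exp (t / 2) - exp (- t / 2)) * (E * (lambert_pow (exp w) 0 (- t) - lambert_pow (exp w) 0 t))) (at t)"
    by (subst DERIV_cong_ev[OF refl _ refl])
  from DERIV_imp_deriv[OF this] show "deriv (theta (exp w)) t = (exp (t / 2) + exp (- t / 2)) / 2 * E +
      theta (exp w) t * (lambert_pow (exp w) 0 (- t) - lambert_pow (exp w) 0 t)"
    by (simp add: eqt)
qed

text \<open>One factor is the prefactor of the triple product, the other two are its infinite
  products at \<open>t = 0\<close>. This cube is the origin of the cube in the final eta
  quotient.\<close>

lemma deriv_theta_0:
  assumes "Re w < 0"
  shows "deriv (theta (exp w)) 0 = euler_prod (exp w) ^ 3"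
proof -
  have "exp (- lambert_exp (exp w) (\<lambda>n. 1 / of_nat (Suc n)) 0 - lambert_exp (exp w) (\<lambda>n. 1 / of_nat (Suc n)) 0)
     = euler_prod (exp w) ^ 2"
    unfolding euler_prod_def lambert_exp_def power2_eq_square mult_exp_exp by simp
  thus ?thesis using theta_strip_derivative[OF assms, of 0] assms
    by (simp add: power3_eq_cube power2_eq_square)
qed

lemma theta_ld_strip:
  assumes w: "Re w < 0" and t: "\<bar>Re t\<bar> < - Re w" "t \<notin> period_lattice w"
  shows "theta_ld (exp w) t = 1 / 2 + 1 / (exp t - 1) - lambert_pow (exp w) 0 t + lambert_pow (exp w) 0 (- t)"
proof -
  note th = theta_strip_derivative[OF w t(1)]
  have nz: "theta (exp w) t \<noteq> 0" using theta_eq_0_iff[OF w] t by simp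
  have e1: "exp t \<noteq> 1" using t(2) exp_eq_1_imp_in_period_lattice by blast
  have "theta_ld (exp w) t = (exp (t / 2) + exp (- t / 2)) / 2 / (exp (t / 2) - exp (- t / 2)) +
     (lambert_pow (exp w) 0 (- t) - lambert_pow (exp w) 0 t)"
  proof -
    have cancel: "(A * E + B * E * C) / (B * E) = A / B + C" if "B * E \<noteq> 0" for A B C E :: complex
      using that by (simp add: field_simps)
    show ?thesis unfolding theta_ld_def th(2) unfolding th(1)
      by (rule cancel) (use nz th(1) in simp)
  qed
  also have "(exp (t / 2) + exp (- t / 2)) / 2 / (exp (t / 2) - exp (- t / 2)) = 1 / 2 + 1 / (exp t - 1)"
  proof -
    define x where "x = exp (t / 2)"
    have x: "x \<noteq> 0" "exp t = x * x" "exp (- t / 2) = 1 / x"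
      by (simp_all add: x_def mult_exp_exp exp_minus field_simps)
    have "x * x - 1 \<noteq> 0" using e1 x by simp
    moreover have "x - 1 / x \<noteq> 0" using calculation x(1) by (auto simp: field_simps)
    ultimately show ?thesis unfolding x x_def[symmetric] using x(1) by (simp add: field_simps)
  qed
  finally show ?thesis by simp
qed

text \<open>For \<open>Re t > 0\<close> the polar term expands as a series in
  \<open>exp (- t)\<close>, and \<open>1 + q ^ n / (1 - q ^ n) = 1 / (1 - q ^ n)\<close> merges it
  with the Lambert series at \<open>- t\<close>. The outcome is a Laurent expansion in
  \<open>exp t\<close> on the annulus of the constant term; its zeroth coefficient
  \<open>1 / 2\<close> disappears on differentiation.\<close>

lemma theta_ld_right_strip:
  assumes w: "Re w < 0" and t: "0 < Re t" "Re t < - Re w"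
  shows "theta_ld (exp w) t = 1 / 2 - lambert_pow (exp w) 0 t + lambert_pow (exp w) 0 (- t - w)"
proof -
  have notin: "t \<notin> period_lattice w" by (rule right_strip_not_in_period_lattice[OF w t])
  have q: "norm (exp w) < 1" using w by simp
  have e: "norm (exp (- t)) < 1" using t by simp
  have g: "(\<lambda>n. exp (- t) ^ Suc n) sums (1 / (exp t - 1))"
  proof -
    have "(\<lambda>n. exp (- t) * exp (- t) ^ n) sums (exp (- t) * (1 / (1 - exp (- t))))"
      by (intro sums_mult geometric_sums e)
    also have "exp (- t) * (1 / (1 - exp (- t))) = 1 / (exp t - 1)"
    proof -
      have "exp t \<noteq> 1" using t by (auto simp: exp_eq_1)
      thus ?thesis by (simp add: exp_minus field_simps)
    qed
    finally show ?thesis by simp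
  qed
  have s: "(\<lambda>n. of_nat (Suc n) ^ 0 * (exp w ^ Suc n / (1 - exp w ^ Suc n)) * exp u ^ Suc n) sums lambert_pow (exp w) 0 u"
    if "norm (exp w * exp u) < 1" for u
    unfolding lambert_exp_def
    by (intro summable_sums summable_norm_cancel[OF lambert_summable[OF q that poly_bounded_power]])
  have "norm (exp w * exp (- t)) < 1" using t w by (simp add: mult_exp_exp)
  from sums_add[OF g s[OF this]]
  have "(\<lambda>n. exp (- t) ^ Suc n + of_nat (Suc n) ^ 0 * (exp w ^ Suc n / (1 - exp w ^ Suc n)) * exp (- t) ^ Suc n)
      sums (1 / (exp t - 1) + lambert_pow (exp w) 0 (- t))" .
  moreover have "exp (- t) ^ Suc n + of_nat (Suc n) ^ 0 * (exp w ^ Suc n / (1 - exp w ^ Suc n)) * exp (- t) ^ Suc n =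
     of_nat (Suc n) ^ 0 * (exp w ^ Suc n / (1 - exp w ^ Suc n)) * exp (- t - w) ^ Suc n" for n
  proof -
    have "exp (- t) ^ Suc n = exp w ^ Suc n * exp (- t - w) ^ Suc n"
      unfolding power_mult_distrib[symmetric] mult_exp_exp by simp
    moreover have "1 - exp w ^ Suc n \<noteq> 0" by (rule one_minus_power_nonzero[OF q])
    ultimately show ?thesis by (simp add: field_simps del: power_Suc of_nat_Suc)
  qed
  ultimately have "(\<lambda>n. of_nat (Suc n) ^ 0 * (exp w ^ Suc n / (1 - exp w ^ Suc n)) * exp (- t - w) ^ Suc n)
      sums (1 / (exp t - 1) + lambert_pow (exp w) 0 (- t))" by simp
  moreover have "norm (exp w * exp (- t - w)) < 1" using t by (simp add: mult_exp_exp)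
  ultimately have "1 / (exp t - 1) + lambert_pow (exp w) 0 (- t) = lambert_pow (exp w) 0 (- t - w)"
    using s sums_unique2 by blast
  thus ?thesis using theta_ld_strip[OF w _ notin] t by (simp add: algebra_simps)
qed


section \<open>Local expansions\<close>

lemma higher_deriv_eqI:
  assumes "open S" "\<And>n t. t \<in> S \<Longrightarrow> (f n has_field_derivative f (Suc n) t) (at t)"
    and "\<And>t. t \<in> S \<Longrightarrow> g t = f 0 t" and "t \<in> S"
  shows "(deriv ^^ n) g t = f n t"
  using assms(4)
proof (induction n arbitrary: t)
  case 0
  then show ?case by (simp add: assms(3))
next
  case (Suc n)
  have "\<forall>\<^sub>F u in nhds t. (deriv ^^ n) g u = f n u"
    using eventually_nhds_in_open[OF assms(1) Suc.prems] by eventually_elim (rule Suc.IH)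
  hence "(deriv ^^ Suc n) g t = deriv (f n) t"
    by (simp add: deriv_cong_ev)
  thus ?case using DERIV_imp_deriv[OF assms(2)[OF Suc.prems]] by simp
qed

lemma has_fps_expansion_transform:
  assumes "f has_fps_expansion F" "\<forall>\<^sub>F x in nhds 0. f x = g x"
  shows "g has_fps_expansion F"
  using has_fps_expansion_cong[OF assms(2) refl[of F]] assms(1) by simp

lemma has_fps_expansion_shift_le:
  fixes f :: "complex \<Rightarrow> complex"
  assumes f: "f has_fps_expansion F" and "\<And>i. i < n \<Longrightarrow> fps_nth F i = 0" and "c = fps_nth F n"
  shows "(\<lambda>x. if x = 0 then c else f x / x ^ n) has_fps_expansion fps_shift n F"
\<comment> \<open>The subdegree of the zero series is \<open>0\<close> by convention, so a bound
  \<open>n \<le> subdegree F\<close> is available only for \<open>F \<noteq> 0\<close>.\<close>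
proof (cases "F = 0")
  case True
  hence "\<forall>\<^sub>F x in nhds 0. f x = 0" using f by (simp add: has_fps_expansion_0_iff)
  hence "\<forall>\<^sub>F x in nhds 0. (if x = 0 then c else f x / x ^ n) = 0"
    by eventually_elim (use True assms(3) in auto)
  thus ?thesis using True by (simp add: has_fps_expansion_0_iff)
next
  case False
  have "n \<le> subdegree F" by (rule subdegree_geI) (use False assms(2) in auto)
  thus ?thesis by (intro has_fps_expansion_shift f assms(3))
qed

lemma has_fps_expansion_scale:
  fixes f :: "complex \<Rightarrow> complex"
  assumes "f has_fps_expansion F"
  shows "(\<lambda>t. f (c * t)) has_fps_expansion Abs_fps (\<lambda>n. c ^ n * fps_nth F n)"
proof -
  have "(\<lambda>t. c * t) has_fps_expansion fps_const c * fps_X"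
    by (intro fps_expansion_intros)
  from has_fps_expansion_compose[OF assms this] show ?thesis
    by (simp add: o_def fps_compose_linear)
qed

lemma has_fps_expansion_higher_deriv:
  fixes f :: "complex \<Rightarrow> complex"
  assumes "f has_fps_expansion F"
  shows "(deriv ^^ n) f has_fps_expansion (fps_deriv ^^ n) F"
  by (induction n) (auto intro: assms has_fps_expansion_deriv)

section \<open>Bernoulli numbers and the Taylor coefficients of \<open>theta_ld\<close>\<close>

lemma fps_exp_minus_one:
  shows "subdegree (fps_exp 1 - 1 :: 'a::field_char_0 fps) = Suc 0" "(fps_exp 1 - 1 :: 'a fps) \<noteq> 0"
    "fps_X / (fps_exp 1 - 1 :: 'a fps) * (fps_exp 1 - 1) = fps_X"
proof -
  show sd: "subdegree (fps_exp 1 - 1 :: 'a fps) = Suc 0" by (rule subdegreeI) auto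
  show nz: "(fps_exp 1 - 1 :: 'a fps) \<noteq> 0" using sd by auto
  have "(fps_exp 1 - 1 :: 'a fps) dvd fps_X" by (simp add: fps_dvd_iff nz sd del: subdegree_minus_commute)
  thus "fps_X / (fps_exp 1 - 1 :: 'a fps) * (fps_exp 1 - 1) = fps_X" by simp
qed

lemma bernoulli_recurrence:
  "(\<Sum>i\<le>n. bernoulli i / fact i * (if i = n then 0 else 1 / fact (n - i))) = (if n = 1 then 1 else 0)"
proof -
  have "fps_nth (fps_X / (fps_exp 1 - 1) * (fps_exp 1 - 1 :: real fps)) n = fps_nth fps_X n"
    by (simp only: fps_exp_minus_one)
  moreover have "fps_nth (fps_exp 1 - 1 :: real fps) (n - i) = (if i = n then 0 else 1 / fact (n - i))"
    if "i \<le> n" for i using that by auto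
  ultimately show ?thesis
    unfolding fps_mult_nth by (simp add: bernoulli_def atLeast0AtMost)
qed

text \<open>\<open>bernoulli\<close> comes from a quotient of real power series. Its image over the
  complex numbers is identified by multiplying back: both sides times \<open>fps_exp 1 - 1\<close>
  equal \<open>fps_X\<close>.\<close>

lemma fps_bernoulli_complex:
  "fps_X / (fps_exp 1 - 1) = Abs_fps (\<lambda>n. complex_of_real (bernoulli n / fact n))"
proof -
  have "Abs_fps (\<lambda>n. complex_of_real (bernoulli n / fact n)) * (fps_exp 1 - 1) = fps_X"
  proof (rule fps_ext)
    fix n
    have "fps_nth (Abs_fps (\<lambda>n. complex_of_real (bernoulli n / fact n)) * (fps_exp 1 - 1)) n =
       (\<Sum>i\<le>n. of_real (bernoulli i / fact i * (if i = n then 0 else 1 / fact (n - i))))"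
      unfolding fps_mult_nth atLeast0AtMost
      by (rule sum.cong) auto
    also have "\<dots> = of_real (if n = 1 then 1 else 0)"
      unfolding of_real_sum[symmetric] bernoulli_recurrence ..
    finally show "fps_nth (Abs_fps (\<lambda>n. complex_of_real (bernoulli n / fact n)) * (fps_exp 1 - 1)) n =
        fps_nth fps_X n" by simp
  qed
  also have "fps_X = fps_X / (fps_exp 1 - 1 :: complex fps) * (fps_exp 1 - 1)"
    by (simp only: fps_exp_minus_one)
  finally show ?thesis by (metis fps_exp_minus_one(2) mult_right_cancel)
qed

lemma bernoulli_values: "bernoulli 2 = 1 / 6" "bernoulli 4 = - 1 / 30" "bernoulli 6 = 1 / 42"
proof -
  have b0: "bernoulli 0 = 1" using bernoulli_recurrence[of 1] by simp
  have b1: "bernoulli 1 = - 1 / 2" using bernoulli_recurrence[of 2] b0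
    by (simp add: numeral_2_eq_2)
  have b2: "bernoulli 2 = 1 / 6" using bernoulli_recurrence[of 3] b0 b1
    by (simp add: eval_nat_numeral fact_numeral)
  have b3: "bernoulli 3 = 0" using bernoulli_recurrence[of 4] b0 b1 b2
    by (simp add: eval_nat_numeral)
  have b4: "bernoulli 4 = - 1 / 30" using bernoulli_recurrence[of 5] b0 b1 b2 b3
    by (simp add: eval_nat_numeral)
  have b5: "bernoulli 5 = 0" using bernoulli_recurrence[of 6] b0 b1 b2 b3 b4
    by (simp add: eval_nat_numeral)
  have b6: "bernoulli 6 = 1 / 42" using bernoulli_recurrence[of 7] b0 b1 b2 b3 b4 b5
    by (simp add: eval_nat_numeral)
  show "bernoulli 2 = 1 / 6" "bernoulli 4 = - 1 / 30" "bernoulli 6 = 1 / 42" by fact+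
qed

text \<open>For even \<open>n > 0\<close> this is \<open>B_n E_n / n!\<close> multiplied out, which
  avoids dividing by \<open>bernoulli n\<close>. The value \<open>1\<close> at \<open>n = 0\<close>
  is the residue of \<open>theta_ld\<close>; it will let the leading term of
  \<open>phi_const\<close> fit into a uniform sum.\<close>

definition theta_ld_coeff :: "nat \<Rightarrow> complex \<Rightarrow> complex" where
  "theta_ld_coeff n q = (if n = 0 then 1 else if even n then of_real (bernoulli n / fact n) -
     2 / fact (n - 1) * (suminf (\<lambda>k. of_nat (Suc k) ^ (n - 1) * (q ^ Suc k / (1 - q ^ Suc k)))) else 0)"

lemma holomorphic_theta_ld_coeff: "theta_ld_coeff n holomorphic_on ball 0 1"
proof (cases "n = 0 \<or> odd n")
  case True
  hence "theta_ld_coeff n = (\<lambda>_. if n = 0 then 1 else 0)"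
    by (auto simp: theta_ld_coeff_def)
  thus ?thesis by simp
next
  case False
  hence "theta_ld_coeff n = (\<lambda>q. of_real (bernoulli n / fact n) -
     2 / fact (n - 1) * (suminf (\<lambda>k. of_nat (Suc k) ^ (n - 1) * (q ^ Suc k / (1 - q ^ Suc k)))))"
    by (simp add: theta_ld_coeff_def fun_eq_iff)
  thus ?thesis
    by (simp only:) (intro holomorphic_intros holomorphic_lambert poly_bounded_power)
qed

lemma theta_ld_coeff_eq_eisenstein:
  assumes "even k" "k > 0" "bernoulli k \<noteq> 0"
  shows "theta_ld_coeff k (exp (two_pi_i * \<tau>)) = of_real (bernoulli k / fact k) * eisenstein_E k \<tau>"
proof -
  have "fact k = (of_nat k * fact (k - 1) :: complex)" using assms(2) by (rule fact_reduce)
  thus ?thesis using assms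
    by (simp add: theta_ld_coeff_def eisenstein_E_def qpow_def field_simps)
qed

lemma lambert_pow_has_fps_expansion:
  assumes "norm q < 1"
  shows "lambert_pow q 0 has_fps_expansion Abs_fps (\<lambda>n. lambert_pow q n 0 / fact n)"
proof -
  define S where "S = {t. norm (q * exp t) < 1}"
  have S: "open S" unfolding S_def by (intro open_Collect_less continuous_intros)
  have 0: "0 \<in> S" using assms by (simp add: S_def)
  have "lambert_pow q 0 holomorphic_on S"
    using has_field_derivative_lambert_pow[OF assms, of _ 0]
    unfolding holomorphic_on_def S_def field_differentiable_def
    by (blast intro: has_field_derivative_at_within)
  hence "lambert_pow q 0 analytic_on {0}"
    using S 0 by (auto simp: analytic_at)
  hence "lambert_pow q 0 has_fps_expansion fps_expansion (lambert_pow q 0) 0"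
    by (rule analytic_at_imp_has_fps_expansion_0)
  also have "fps_expansion (lambert_pow q 0) 0 = Abs_fps (\<lambda>n. lambert_pow q n 0 / fact n)"
    unfolding fps_expansion_def
    by (intro arg_cong[of _ _ Abs_fps] ext arg_cong2[of _ _ _ _ "(/)"] refl
          higher_deriv_eqI[OF S _ _ 0, of "lambert_pow q"])
       (use has_field_derivative_lambert_pow[OF assms] in \<open>auto simp: S_def\<close>)
  finally show ?thesis .
qed

text \<open>The strip formula is expanded near \<open>0\<close>: the polar term contributes the
  Bernoulli numbers, the two Lambert series the divisor sums. The odd coefficients vanish because
  \<open>t * theta_ld (exp w) t\<close> is an even function.\<close>

theorem theta_ld_has_fps_expansion:
  assumes w: "Re w < 0"
  shows "(\<lambda>t. if t = 0 then 1 else t * theta_ld (exp w) t) has_fps_expansion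
     Abs_fps (\<lambda>n. theta_ld_coeff n (exp w))" (is "?h has_fps_expansion _")
proof -
  have q: "norm (exp w) < 1" using w by simp
  let ?M = "\<lambda>n. lambert_pow (exp w) n 0"
  define F where "F = fps_X / (fps_exp 1 - 1) + fps_const (1/2) * fps_X -
     fps_X * (Abs_fps (\<lambda>n. ?M n / fact n) - Abs_fps (\<lambda>n. (- 1) ^ n * (?M n / fact n)))"
  have H: "(\<lambda>t::complex. if t = 0 then 1 else t / (exp t - 1)) has_fps_expansion fps_X / (fps_exp 1 - 1)"
    by (rule has_fps_expansion_divide)
       (auto intro!: fps_expansion_intros simp: fps_exp_minus_one simp del: subdegree_minus_commute)
  have Mm: "(\<lambda>t. lambert_pow (exp w) 0 (- t)) has_fps_expansion Abs_fps (\<lambda>n. (- 1) ^ n * (?M n / fact n))"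
    using has_fps_expansion_scale[OF lambert_pow_has_fps_expansion[OF q], of "-1"] by simp
  have "(\<lambda>t. (if t = 0 then 1 else t / (exp t - 1)) + 1 / 2 * t -
      t * (lambert_pow (exp w) 0 t - lambert_pow (exp w) 0 (- t))) has_fps_expansion F"
    unfolding F_def by (intro fps_expansion_intros H Mm lambert_pow_has_fps_expansion q)
  moreover have "\<forall>\<^sub>F t in nhds 0. (if t = 0 then 1 else t / (exp t - 1)) + 1 / 2 * t -
      t * (lambert_pow (exp w) 0 t - lambert_pow (exp w) 0 (- t)) = ?h t"
  proof -
    have "\<forall>\<^sub>F t in nhds 0. t \<in> ball 0 (min (- Re w) (2 * pi))"
      using w by (intro eventually_nhds_in_open) auto
    thus ?thesis
    proof eventually_elim
      case (elim t)
      show ?case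
      proof (cases "t = 0")
        case False
        have notin: "t \<notin> period_lattice w" using elim False by (intro small_not_in_period_lattice w) auto
        have strip: "\<bar>Re t\<bar> < - Re w" using elim abs_Re_le_cmod[of t] by simp
        show ?thesis unfolding theta_ld_strip[OF w strip notin]
          using False by (simp add: distrib_left right_diff_distrib)
      qed simp
    qed
  qed
  ultimately have hF: "?h has_fps_expansion F"
    by (rule has_fps_expansion_transform)
  have "(\<lambda>t. ?h (- 1 * t)) = ?h" using theta_ld_minus[OF q] by auto
  hence "?h has_fps_expansion Abs_fps (\<lambda>n. (- 1) ^ n * fps_nth F n)"
    using has_fps_expansion_scale[OF hF, of "-1"] by simp
  hence "F = Abs_fps (\<lambda>n. (- 1) ^ n * fps_nth F n)"
    by (rule fps_expansion_unique_complex[OF hF])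
  hence sym: "fps_nth F n = (- 1) ^ n * fps_nth F n" for n by (metis fps_nth_Abs_fps)
  have "fps_nth F n = theta_ld_coeff n (exp w)" for n
  proof (cases "even n")
    case False
    thus ?thesis using sym[of n] by (cases "n = 0") (auto simp: theta_ld_coeff_def)
  next
    case True
    show ?thesis
    proof (cases n)
      case 0
      have "bernoulli 0 = 1" using bernoulli_recurrence[of 1] by simp
      thus ?thesis using 0 by (simp add: F_def fps_bernoulli_complex theta_ld_coeff_def)
    next
      case (Suc k)
      have "odd k" using True Suc by simp
      thus ?thesis using Suc True
        by (auto simp: F_def fps_bernoulli_complex theta_ld_coeff_def lambert_exp_def elim!: oddE)
    qed
  qed
  hence "F = Abs_fps (\<lambda>n. theta_ld_coeff n (exp w))" by (simp add: fps_eq_iff)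
  with hF show ?thesis by simp
qed

definition theta_ld_reg :: "complex \<Rightarrow> complex \<Rightarrow> complex" where
  "theta_ld_reg q t = (if t = 0 then 0 else theta_ld q t - 1 / t)"

lemma theta_ld_reg_has_fps_expansion:
  assumes w: "Re w < 0"
  shows "theta_ld_reg (exp w) has_fps_expansion Abs_fps (\<lambda>n. theta_ld_coeff (Suc n) (exp w))"
proof -
  let ?h = "\<lambda>t. (if t = 0 then 1 else t * theta_ld (exp w) t) - 1"
  have "?h has_fps_expansion Abs_fps (\<lambda>n. theta_ld_coeff n (exp w)) - 1"
    by (intro fps_expansion_intros theta_ld_has_fps_expansion w)
  hence "(\<lambda>t. if t = 0 then 0 else ?h t / t ^ 1) has_fps_expansion
      fps_shift 1 (Abs_fps (\<lambda>n. theta_ld_coeff n (exp w)) - 1)"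
    by (rule has_fps_expansion_shift_le) (auto simp: theta_ld_coeff_def)
  also have "(\<lambda>t. if t = 0 then 0 else ?h t / t ^ 1) = theta_ld_reg (exp w)"
    by (auto simp: theta_ld_reg_def fun_eq_iff field_simps)
  also have "fps_shift 1 (Abs_fps (\<lambda>n. theta_ld_coeff n (exp w)) - 1) = Abs_fps (\<lambda>n. theta_ld_coeff (Suc n) (exp w))"
    by (simp add: fps_eq_iff)
  finally show ?thesis .
qed

section \<open>Derivatives of \<open>theta_ld\<close> as elliptic functions, and their differential
  equation\<close>

text \<open>Up to a constant, \<open>ell_p w 0\<close> is the Weierstrass function of the lattice, and \<open>ell_p w k\<close>
  is its \<open>k\<close>-th derivative.\<close>

definition ell_p :: "complex \<Rightarrow> nat \<Rightarrow> complex \<Rightarrow> complex" where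
  "ell_p w k = (\<lambda>t. - (deriv ^^ Suc k) (theta_ld (exp w)) t)"

lemma holomorphic_ell_p: "Re w < 0 \<Longrightarrow> ell_p w k holomorphic_on - period_lattice w"
  unfolding ell_p_def
  by (intro holomorphic_intros holomorphic_higher_deriv holomorphic_theta_ld open_compl_period_lattice)

text \<open>The additive increment \<open>d\<close> is lost with the first derivative, whence
  \<open>Suc k\<close>: a quasi-periodic function has periodic derivatives.\<close>

lemma higher_deriv_quasi_periodic:
  fixes f :: "complex \<Rightarrow> complex"
  assumes S: "open S" and f: "f holomorphic_on S" and c: "\<And>t. t + c \<in> S \<longleftrightarrow> t \<in> S"
    and per: "\<And>t. t \<in> S \<Longrightarrow> f (t + c) = f t + d" and t: "t \<in> S"
  shows "(deriv ^^ Suc k) f (t + c) = (deriv ^^ Suc k) f t"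
proof -
  have hd: "((deriv ^^ n) f has_field_derivative (deriv ^^ Suc n) f t) (at t)" if "t \<in> S" for n t
    using holomorphic_derivI[OF holomorphic_higher_deriv[OF f S] S that] by simp
  let ?g = "\<lambda>n t. (deriv ^^ n) f (t + c) - (if n = 0 then d else 0)"
  have "(deriv ^^ Suc k) f t = ?g (Suc k) t"
  proof (rule higher_deriv_eqI[OF S _ _ t])
    fix n t assume "t \<in> S"
    hence "((deriv ^^ n) f has_field_derivative (deriv ^^ Suc n) f (t + c)) (at (t + c))"
      using c by (intro hd) simp
    hence "((\<lambda>t. (deriv ^^ n) f (t + c)) has_field_derivative (deriv ^^ Suc n) f (t + c)) (at t)"
      by (rule DERIV_shift[THEN iffD1])
    thus "(?g n has_field_derivative ?g (Suc n) t) (at t)"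
      by (auto intro!: derivative_eq_intros)
  qed (use per in auto)
  thus ?thesis by simp
qed

lemma ell_p_periodic:
  assumes w: "Re w < 0" and t: "t \<notin> period_lattice w"
  shows "ell_p w k (t + two_pi_i) = ell_p w k t" "ell_p w k (t + w) = ell_p w k t"
proof -
  note * = higher_deriv_quasi_periodic[OF open_compl_period_lattice[OF w] holomorphic_theta_ld[OF w]]
  have q: "norm (exp w) < 1" using w by simp
  show "ell_p w k (t + two_pi_i) = ell_p w k t"
    unfolding ell_p_def neg_equal_iff_equal
    by (rule *[where d = 0]) (use t theta_ld_add_2pi_i[OF q] in auto)
  show "ell_p w k (t + w) = ell_p w k t"
    unfolding ell_p_def neg_equal_iff_equal
    by (rule *[where d = "-1"]) (use t theta_ld_add_period[OF w] in auto)
qed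

lemma ell_p_near_0:
  assumes w: "Re w < 0"
  shows "\<forall>\<^sub>F t in at 0. ell_p w k t = (-1) ^ k * fact (Suc k) / t ^ (k + 2) -
     (deriv ^^ Suc k) (theta_ld_reg (exp w)) t"
proof -
  obtain S where S: "open S" "0 \<in> S" "theta_ld_reg (exp w) holomorphic_on S"
    using has_fps_expansion_imp_holomorphic[OF theta_ld_reg_has_fps_expansion[OF w]] by metis
  define f where "f = (\<lambda>n t. (-1) ^ n * fact n / t ^ Suc n + (deriv ^^ n) (theta_ld_reg (exp w)) t)"
  have d: "(f n has_field_derivative f (Suc n) t) (at t)" if "t \<in> S - {0}" for n t
  proof -
    have t: "t \<noteq> 0" using that by auto
    have 1: "((deriv ^^ n) (theta_ld_reg (exp w)) has_field_derivative (deriv ^^ Suc n) (theta_ld_reg (exp w)) t) (at t)"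
      using holomorphic_derivI[OF holomorphic_higher_deriv[OF S(3,1)] S(1), of t n] that by simp
    have "((\<lambda>t. (-1) ^ n * fact n / t ^ Suc n) has_field_derivative
        - ((-1) ^ n * fact n * (of_nat (Suc n) * t ^ n)) / (t ^ Suc n * t ^ Suc n)) (at t)"
      by (rule derivative_eq_intros refl | use t in simp)+
    also have "- ((-1) ^ n * fact n * (of_nat (Suc n) * t ^ n)) / (t ^ Suc n * t ^ Suc n) =
        (-1) ^ Suc n * fact (Suc n) / t ^ Suc (Suc n)"
      using t by (simp add: field_simps)
    finally show ?thesis unfolding f_def by (intro DERIV_add 1)
  qed
  have hd: "(deriv ^^ n) (theta_ld (exp w)) t = f n t" if "t \<in> S - {0}" for n t
    by (rule higher_deriv_eqI[where f = f and S = "S - {0}"])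
       (use S(1) d that in \<open>auto simp: f_def theta_ld_reg_def open_delete\<close>)
  have "\<forall>\<^sub>F t in at 0. t \<in> S - {0}" by (rule eventually_at_in_open[OF S(1,2)])
  thus ?thesis
  proof eventually_elim
    case (elim t)
    from hd[OF this, of "Suc k"] show ?case
      unfolding ell_p_def f_def by (simp del: fact_Suc funpow.simps)
  qed
qed

lemma tendsto_theta_ld_reg_deriv:
  assumes w: "Re w < 0"
  shows "(deriv ^^ n) (theta_ld_reg (exp w)) \<midarrow>0\<rightarrow> fact n * theta_ld_coeff (Suc n) (exp w)"
proof -
  note e = theta_ld_reg_has_fps_expansion[OF w]
  have "isCont ((deriv ^^ n) (theta_ld_reg (exp w))) 0"
    by (rule has_fps_expansion_imp_continuous[OF has_fps_expansion_higher_deriv[OF e]])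
  moreover have "(deriv ^^ n) (theta_ld_reg (exp w)) 0 = fact n * theta_ld_coeff (Suc n) (exp w)"
    using fps_nth_fps_expansion[OF e, of n] by (simp add: field_simps)
  ultimately show ?thesis by (simp add: isCont_def)
qed

text \<open>This limit is what each \<open>ell_p w (2 * k)\<close> contributes to the constant in
  the partial fraction decomposition of \<open>phi\<close>.\<close>

lemma tendsto_ell_p_minus_pole:
  assumes w: "Re w < 0"
  shows "(\<lambda>t. ell_p w (2 * k) t - fact (2 * k + 1) / t ^ (2 * k + 2)) \<midarrow>0\<rightarrow>
    - fact (2 * k + 1) * theta_ld_coeff (2 * k + 2) (exp w)"
proof -
  have "(\<lambda>t. - (deriv ^^ Suc (2 * k)) (theta_ld_reg (exp w)) t) \<midarrow>0\<rightarrow>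
      - (fact (Suc (2 * k)) * theta_ld_coeff (Suc (Suc (2 * k))) (exp w))"
    by (intro tendsto_intros tendsto_theta_ld_reg_deriv w)
  moreover have "\<forall>\<^sub>F t in at 0. - (deriv ^^ Suc (2 * k)) (theta_ld_reg (exp w)) t =
      ell_p w (2 * k) t - fact (2 * k + 1) / t ^ (2 * k + 2)"
    using ell_p_near_0[OF w, of "2 * k"] by eventually_elim simp
  ultimately show ?thesis by (simp add: tendsto_cong)
qed

text \<open>The differential equation \<open>\<wp>'' = 6 \<wp>\<^sup>2 - g\<^sub>2 / 2\<close> determines all Taylor coefficients from the first two.\<close>

theorem theta_ld_coeff_recurrence:
  assumes w: "Re w < 0" and n: "n > 0"
  shows "(of_nat (n + 1) * of_nat (n + 2) - 12) * (of_nat (n + 3) * theta_ld_coeff (n + 4) (exp w)) =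
    - 6 * (\<Sum>i\<in>{0<..<n}. of_nat ((i + 1) * (n - i + 1)) *
       (theta_ld_coeff (i + 2) (exp w) * theta_ld_coeff (n - i + 2) (exp w)))"
proof -
  define c where "c = (\<lambda>n. theta_ld_coeff n (exp w))"
  define J where "J = theta_ld_reg (exp w)"
  define G where "G = Abs_fps (\<lambda>n. c (Suc n))"
  have J: "J has_fps_expansion G" unfolding J_def G_def c_def by (rule theta_ld_reg_has_fps_expansion[OF w])
  \<comment> \<open>\<open>1 / t ^ 2 + R t\<close> is the Weierstrass function: adding
    \<open>c 2\<close> removes the constant term of \<open>ell_p w 0\<close>, and \<open>R\<close>
    vanishes to second order because \<open>c 3 = 0\<close>.\<close>
  define R where "R = (\<lambda>t. c 2 - deriv J t)"
  define Rf where "Rf = fps_const (c 2) - fps_deriv G"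
  have R: "R has_fps_expansion Rf" unfolding R_def Rf_def by (intro fps_expansion_intros J)
  have Rf0: "fps_nth Rf 0 = 0" by (simp add: Rf_def G_def numeral_2_eq_2)
  have Rfn: "fps_nth Rf i = - (of_nat (i + 1) * c (i + 2))" if "i > 0" for i
    using that by (simp add: Rf_def G_def del: of_nat_Suc)
  have Rf_low: "fps_nth Rf i = 0" if "i < 2" for i
  proof -
    have "i = 0 \<or> i = 1" using that by auto
    thus ?thesis using Rf0 Rfn[of 1] by (auto simp: c_def theta_ld_coeff_def)
  qed
  define S where "S = (\<lambda>t. if t = 0 then fps_nth Rf 2 else R t / t ^ 2)"
  have S: "S has_fps_expansion fps_shift 2 Rf"
    unfolding S_def by (rule has_fps_expansion_shift_le[OF R Rf_low refl])
  \<comment> \<open>In \<open>6 / t ^ 4 - 6 * (1 / t ^ 2 + R t)\<^sup>2\<close> the poles of order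
    four cancel, and the cross term is \<open>- 12 * S t\<close>; it accounts for the
    \<open>12\<close> in the recurrence.\<close>
  define T where "T = (\<lambda>t. (- (deriv ^^ 3) J t) - 12 * S t - 6 * (R t)\<^sup>2)"
  define Tf where "Tf = - (fps_deriv ^^ 3) G - 12 * fps_shift 2 Rf - 6 * Rf\<^sup>2"
  have T: "T has_fps_expansion Tf"
    unfolding T_def Tf_def by (intro fps_expansion_intros S R has_fps_expansion_higher_deriv J)
  define f where "f = (\<lambda>t. ell_p w 2 t - 6 * (ell_p w 0 t + c 2)\<^sup>2)"
  have fT: "\<forall>\<^sub>F t in at 0. f t = T t"
    using ell_p_near_0[OF w, of 2] ell_p_near_0[OF w, of 0] eventually_neq_at_within[of 0]
  proof eventually_elim
    case (elim t)
    have "f t = 6 / t ^ 4 - (deriv ^^ 3) J t - 6 * (1 / t ^ 2 + R t)\<^sup>2"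
    proof -
      have "ell_p w 0 t + c 2 = 1 / t ^ 2 + R t" using elim(2) by (simp add: R_def J_def numeral_2_eq_2)
      moreover have "ell_p w 2 t = 6 / t ^ 4 - (deriv ^^ 3) J t" using elim(1) by (simp add: J_def eval_nat_numeral)
      ultimately show ?thesis by (simp only: f_def)
    qed
    also have "\<dots> = T t" using elim(3)
      by (simp add: T_def S_def field_simps power2_eq_square power4_eq_xxxx)
    finally show ?case .
  qed
  have "isCont T 0" by (rule has_fps_expansion_imp_continuous[OF T])
  hence "T \<midarrow>0\<rightarrow> T 0" by (simp add: isCont_def)
  hence lim: "f \<midarrow>0\<rightarrow> T 0" using fT by (simp add: tendsto_cong)
  have f_const: "f t = T 0" if "t \<notin> period_lattice w" for t
  proof (rule elliptic_constant[OF w _ _ _ lim that])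
    show "f holomorphic_on - period_lattice w"
      unfolding f_def by (intro holomorphic_intros holomorphic_ell_p w)
  qed (simp_all add: f_def ell_p_periodic w)
  have "\<forall>\<^sub>F t in at 0. T t = T 0"
    using fT eventually_not_in_period_lattice[OF w] by eventually_elim (use f_const in auto)
  hence "\<forall>\<^sub>F t in nhds 0. T t = T 0"
    unfolding eventually_at_filter by eventually_elim auto
  hence "(\<lambda>_. T 0) has_fps_expansion Tf"
    by (rule has_fps_expansion_transform[OF T])
  hence "Tf = fps_const (T 0)"
    using has_fps_expansion_const fps_expansion_unique_complex by blast
  \<comment> \<open>Only the coefficients of positive index vanish; the constant \<open>T 0\<close>
    itself is \<open>- g_2 / 2\<close>.\<close>
  hence "fps_nth Tf n = 0" using n by simp
  hence E0: "- fps_nth ((fps_deriv ^^ 3) G) n - 12 * fps_nth Rf (n + 2) - 6 * fps_nth (Rf\<^sup>2) n = 0"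
    by (simp add: Tf_def)
  have E1: "fps_nth ((fps_deriv ^^ 3) G) n = of_nat (n + 1) * (of_nat (n + 2) * (of_nat (n + 3) * c (n + 4)))"
    by (simp add: G_def eval_nat_numeral)
  have E2: "fps_nth Rf (n + 2) = - (of_nat (n + 3) * c (n + 4))"
    using Rfn[of "n + 2"] by (simp add: eval_nat_numeral)
  have E3: "fps_nth (Rf\<^sup>2) n = (\<Sum>i\<in>{0<..<n}. of_nat ((i + 1) * (n - i + 1)) * (c (i + 2) * c (n - i + 2)))"
  proof -
    have "fps_nth (Rf\<^sup>2) n = (\<Sum>i\<in>{0..n}. fps_nth Rf i * fps_nth Rf (n - i))"
      by (simp add: power2_eq_square fps_mult_nth)
    also have "\<dots> = (\<Sum>i\<in>{0<..<n}. fps_nth Rf i * fps_nth Rf (n - i))"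
    proof (rule sum.mono_neutral_right)
      show "\<forall>i\<in>{0..n} - {0<..<n}. fps_nth Rf i * fps_nth Rf (n - i) = 0"
      proof
        fix i assume "i \<in> {0..n} - {0<..<n}"
        hence "i = 0 \<or> n - i = 0" by auto
        thus "fps_nth Rf i * fps_nth Rf (n - i) = 0"
        proof
          assume "i = 0"
          thus ?thesis by (simp add: Rf0)
        next
          assume "n - i = 0"
          thus ?thesis by (simp only: Rf0 mult_zero_right)
        qed
      qed
    qed auto
    also have "\<dots> = (\<Sum>i\<in>{0<..<n}. of_nat ((i + 1) * (n - i + 1)) * (c (i + 2) * c (n - i + 2)))"
    proof (rule sum.cong)
      fix i assume "i \<in> {0<..<n}"
      thus "fps_nth Rf i * fps_nth Rf (n - i) = of_nat ((i + 1) * (n - i + 1)) * (c (i + 2) * c (n - i + 2))"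
        using Rfn[of i] Rfn[of "n - i"] by (simp only: of_nat_mult) (simp add: mult_ac)
    qed simp
    finally show ?thesis .
  qed
  have "(x * y - 12) * (z * u) = - 6 * Q"
    if "- g - 12 * r - 6 * Q = 0" "g = x * (y * (z * u))" "r = - (z * u)" for x y z u g r Q :: complex
  proof -
    have "(x * y - 12) * (z * u) + 6 * Q = - (- g - 12 * r - 6 * Q)"
      by (simp add: that(2,3) algebra_simps)
    thus ?thesis using that(1) by (simp add: eq_neg_iff_add_eq_0)
  qed
  from this[OF E0 E1 E2] show ?thesis unfolding E3 c_def .
qed


section \<open>Modularity\<close>

abbreviation nome :: "complex \<Rightarrow> complex" where
  "nome \<tau> \<equiv> exp (two_pi_i * \<tau>)"

lemma theta_ld_add_of_int:
  assumes w: "Re w < 0" and t: "t \<notin> period_lattice w"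
  shows "theta_ld (exp w) (t + of_int n * w + of_int k * two_pi_i) = theta_ld (exp w) t - of_int n"
    and "t + of_int n * w + of_int k * two_pi_i \<notin> period_lattice w"
proof -
  have q: "norm (exp w) < 1" using w by simp
  \<comment> \<open>Adding \<open>Re t / Re w\<close> compensates the increment \<open>- 1\<close>
    and makes the function periodic; the value \<open>0\<close> on the lattice makes the periodicity
    hold everywhere, as \<open>periodic_of_int\<close> requires.\<close>
  define f where "f = (\<lambda>t. if t \<in> period_lattice w then 0 else theta_ld (exp w) t + of_real (Re t / Re w))"
  have "f (t + of_int n * w) = f t"
  proof (rule periodic_of_int)
    fix t
    have "(Re t + Re w) / Re w = Re t / Re w + 1" using w by (simp add: field_simps)
    thus "f (t + w) = f t"
      by (simp add: f_def theta_ld_add_period[OF w])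
  qed
  moreover have lat: "t + of_int n * w \<notin> period_lattice w"
    using periodic_of_int[of "\<lambda>t. t \<in> period_lattice w" w t n] t by simp
  ultimately have "theta_ld (exp w) (t + of_int n * w) + of_real (Re (t + of_int n * w) / Re w) =
      theta_ld (exp w) t + of_real (Re t / Re w)"
    using t by (simp only: f_def if_False)
  moreover have "Re (t + of_int n * w) / Re w = Re t / Re w + of_int n" using w by (simp add: field_simps)
  ultimately have "theta_ld (exp w) (t + of_int n * w) + (of_real (Re t / Re w) + of_int n) =
      theta_ld (exp w) t + of_real (Re t / Re w)"
    by (simp only: of_real_add of_real_of_int_eq)
  hence "theta_ld (exp w) (t + of_int n * w) = theta_ld (exp w) t - of_int n"
    by (simp add: eq_diff_eq)
  moreover have "theta_ld (exp w) (u + of_int k * two_pi_i) = theta_ld (exp w) u" for u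
    by (rule periodic_of_int) (rule theta_ld_add_2pi_i[OF q])
  ultimately show "theta_ld (exp w) (t + of_int n * w + of_int k * two_pi_i) = theta_ld (exp w) t - of_int n"
    by simp
  show "t + of_int n * w + of_int k * two_pi_i \<notin> period_lattice w"
    using periodic_of_int[of "\<lambda>t. t \<in> period_lattice w" "two_pi_i" "t + of_int n * w" k] lat by simp
qed

lemma moebius_denominator_nonzero:
  fixes a b c d :: int and \<tau> :: complex
  assumes "a * d - b * c = 1" "Im \<tau> > 0"
  shows "of_int c * \<tau> + of_int d \<noteq> 0"
proof
  assume z: "of_int c * \<tau> + of_int d = 0"
  from arg_cong[OF this, of Im] have "of_int c * Im \<tau> = 0" by simp
  hence "c = 0" using assms(2) by simp
  thus False using z assms(1) by simp
qed

lemma moebius_Im_pos: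
  fixes a b c d :: int and \<tau> :: complex
  assumes "a * d - b * c = 1" "Im \<tau> > 0"
  shows "Im ((of_int a * \<tau> + of_int b) / (of_int c * \<tau> + of_int d)) > 0"
proof -
  let ?l = "of_int c * \<tau> + of_int d"
  have "Im ((of_int a * \<tau> + of_int b) / ?l) = of_int (a * d - b * c) * Im \<tau> / (norm ?l)\<^sup>2"
    by (simp add: Im_divide cmod_power2 algebra_simps)
  also have "\<dots> > 0" using assms moebius_denominator_nonzero[OF assms] by simp
  finally show ?thesis .
qed

text \<open>Multiplication by \<open>l\<close> carries the lattice of \<open>w'\<close> into that of
  \<open>w\<close>, so \<open>theta_ld (exp w') (t / l) / l\<close> and
  \<open>theta_ld (exp w) t\<close> have the same pole at \<open>0\<close> and are both
  quasi-periodic for the lattice of \<open>w\<close>. Their difference is therefore linear in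
  \<open>t\<close>. Comparing Taylor coefficients gives all weights at once, and the linear term
  affects only \<open>n = 1\<close>, that is \<open>E_2\<close>.\<close>

theorem theta_ld_coeff_modular:
  fixes a b c d :: int and \<tau> :: complex
  assumes det: "a * d - b * c = 1" and \<tau>: "Im \<tau> > 0"
  defines "l \<equiv> of_int c * \<tau> + of_int d"
  defines "\<tau>' \<equiv> (of_int a * \<tau> + of_int b) / l"
  shows "theta_ld_coeff (Suc n) (nome \<tau>') / l ^ Suc n =
    theta_ld_coeff (Suc n) (nome \<tau>) + (if n = 1 then of_int c / (two_pi_i * l) else 0)"
proof -
  define w w' where "w = two_pi_i * \<tau>" and "w' = two_pi_i * \<tau>'"
  \<comment> \<open>\<open>k\<close> is determined by the increments of the two functions:
    \<open>k * two_pi_i = c / l\<close> and \<open>k * w = 1 - d / l\<close> hold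
    simultaneously.\<close>
  define k where "k = of_int c / (two_pi_i * l)"
  have l: "l \<noteq> 0" unfolding l_def using moebius_denominator_nonzero[OF det \<tau>] .
  have w: "Re w < 0" using \<tau> by (simp add: w_def)
  have "Im \<tau>' > 0" unfolding \<tau>'_def l_def by (rule moebius_Im_pos[OF det \<tau>])
  hence w': "Re w' < 0" by (simp add: w'_def)
  have det': "of_int a * of_int d - of_int b * of_int c = (1 :: complex)"
    unfolding of_int_mult[symmetric] of_int_diff[symmetric] det by simp
  have lw': "l * w' = of_int a * w + of_int b * two_pi_i"
  proof -
    have "l * \<tau>' = of_int a * \<tau> + of_int b" using l by (simp add: \<tau>'_def)
    moreover have "l * w' = two_pi_i * (l * \<tau>')" by (simp add: w'_def)
    ultimately show ?thesis by (simp add: w_def algebra_simps)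
  qed
  have lpi: "l * two_pi_i = of_int c * w + of_int d * two_pi_i"
    by (simp add: l_def w_def algebra_simps)
  have lat: "t / l \<notin> period_lattice w'" if "t \<notin> period_lattice w" for t
  proof
    assume "t / l \<in> period_lattice w'"
    then obtain m n where "t / l = of_int m * w' + of_int n * two_pi_i"
      unfolding period_lattice_def by blast
    hence "t = of_int m * (l * w') + of_int n * (l * two_pi_i)"
      using l by (simp add: field_simps)
    also have "\<dots> = of_int (m * a + n * c) * w + of_int (m * b + n * d) * two_pi_i"
      unfolding lw' lpi by (simp add: algebra_simps)
    finally show False using that unfolding period_lattice_def by blast
  qed
  define f where "f = (\<lambda>t. theta_ld (exp w') (t / l) / l - theta_ld (exp w) t - k * t)"
  define g where "g = (\<lambda>t. theta_ld_reg (exp w') (inverse l * t) / l - theta_ld_reg (exp w) t - k * t)"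
  have fg: "f t = g t" if "t \<noteq> 0" for t
    using that l by (simp add: f_def g_def theta_ld_reg_def field_simps)
  define G where "G = Abs_fps (\<lambda>n. inverse l ^ n * theta_ld_coeff (Suc n) (exp w')) * fps_const (1 / l) -
      Abs_fps (\<lambda>n. theta_ld_coeff (Suc n) (exp w)) - fps_const k * fps_X"
  have gG: "g has_fps_expansion G"
  proof -
    have 1: "(\<lambda>t. theta_ld_reg (exp w') (inverse l * t)) has_fps_expansion
        Abs_fps (\<lambda>n. inverse l ^ n * theta_ld_coeff (Suc n) (exp w'))"
      using has_fps_expansion_scale[OF theta_ld_reg_has_fps_expansion[OF w'], of "inverse l"] by simp
    have "(\<lambda>t. theta_ld_reg (exp w') (inverse l * t) * (1 / l) - theta_ld_reg (exp w) t - k * t) has_fps_expansion G"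
      unfolding G_def by (intro fps_expansion_intros 1 theta_ld_reg_has_fps_expansion w)
    thus ?thesis by (simp add: g_def)
  qed
  have "isCont g 0" by (rule has_fps_expansion_imp_continuous[OF gG])
  hence "g \<midarrow>0\<rightarrow> 0" by (simp add: isCont_def) (simp add: g_def theta_ld_reg_def)
  moreover have "\<forall>\<^sub>F t in at 0. g t = f t"
    using eventually_neq_at_within[of 0] by eventually_elim (simp add: fg)
  ultimately have lim: "f \<midarrow>0\<rightarrow> 0" by (simp add: tendsto_cong)
  have f0: "f t = 0" if "t \<notin> period_lattice w" for t
  proof (rule elliptic_constant[OF w _ _ _ lim that])
    show "f holomorphic_on - period_lattice w"
      unfolding f_def
      by (intro holomorphic_intros holomorphic_theta_ld w l
            holomorphic_on_compose_gen[OF _ holomorphic_theta_ld[OF w'], unfolded o_def])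
         (use lat l in auto)
  next
    fix t assume t: "t \<notin> period_lattice w"
    have "(t + two_pi_i) / l = t / l + of_int (- c) * w' + of_int a * two_pi_i"
    proof -
      have "of_int (- c) * (l * w') + of_int a * (l * two_pi_i) =
          (of_int a * of_int d - of_int b * of_int c) * two_pi_i"
        unfolding lw' lpi by (simp add: algebra_simps)
      thus ?thesis using l unfolding det' by (simp add: field_simps)
    qed
    hence "theta_ld (exp w') ((t + two_pi_i) / l) = theta_ld (exp w') (t / l) + of_int c"
      by (simp only: theta_ld_add_of_int(1)[OF w' lat[OF t]]) simp
    moreover have "k * two_pi_i = of_int c / l" using l by (simp add: k_def)
    ultimately show "f (t + two_pi_i) = f t"
      using w by (simp add: f_def theta_ld_add_2pi_i add_divide_distrib distrib_left)
    have "(t + w) / l = t / l + of_int d * w' + of_int (- b) * two_pi_i"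
    proof -
      have "of_int d * (l * w') + of_int (- b) * (l * two_pi_i) =
          (of_int a * of_int d - of_int b * of_int c) * w"
        unfolding lw' lpi by (simp add: algebra_simps)
      thus ?thesis using l unfolding det' by (simp add: field_simps)
    qed
    hence "theta_ld (exp w') ((t + w) / l) = theta_ld (exp w') (t / l) - of_int d"
      by (simp only: theta_ld_add_of_int(1)[OF w' lat[OF t]])
    moreover have "k * w = 1 - of_int d / l" using l by (simp add: k_def w_def field_simps) (simp add: l_def)
    ultimately show "f (t + w) = f t"
      by (simp add: f_def theta_ld_add_period[OF w t] diff_divide_distrib distrib_left)
  qed
  have "\<forall>\<^sub>F t in at 0. g t = 0"
    using eventually_not_in_period_lattice[OF w] eventually_neq_at_within[of 0]
    by eventually_elim (metis f0 fg)
  hence "\<forall>\<^sub>F t in nhds 0. g t = 0"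
    unfolding eventually_at_filter by eventually_elim (auto simp: g_def theta_ld_reg_def)
  hence "(\<lambda>_. 0) has_fps_expansion G" by (rule has_fps_expansion_transform[OF gG])
  hence "G = 0" using has_fps_expansion_0 fps_expansion_unique_complex by blast
  hence "fps_nth G n = 0" by simp
  thus ?thesis
    unfolding w_def[symmetric] w'_def[symmetric] k_def[symmetric]
    by (simp add: G_def power_inverse field_simps split: if_splits)
qed


section \<open>Quasi-modular forms\<close>

text \<open>The maximum of \<open>Im \<tau>\<close> and its inverse is at least \<open>1\<close>, so
  its powers increase with the exponent and multiply; in this form sums and products are
  immediate.\<close>

lemma moderate_growth_iff:
  "moderate_growth f \<longleftrightarrow> (\<exists>C N. C \<ge> 0 \<and> (\<forall>\<tau>\<in>upper_half_plane. norm (f \<tau>) \<le> C * max (Im \<tau>) (1 / Im \<tau>) ^ N))"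
proof
  assume "moderate_growth f"
  then obtain C N where C: "\<And>\<tau>. Im \<tau> > 0 \<Longrightarrow> norm (f \<tau>) \<le> C * (Im \<tau> ^ N + 1 / Im \<tau> ^ N)"
    unfolding moderate_growth_def by auto
  have "norm (f \<tau>) \<le> (2 * \<bar>C\<bar>) * max (Im \<tau>) (1 / Im \<tau>) ^ N" if "Im \<tau> > 0" for \<tau>
  proof -
    have "Im \<tau> ^ N \<le> max (Im \<tau>) (1 / Im \<tau>) ^ N" "(1 / Im \<tau>) ^ N \<le> max (Im \<tau>) (1 / Im \<tau>) ^ N"
      using that by (intro power_mono; simp)+
    hence "Im \<tau> ^ N + 1 / Im \<tau> ^ N \<le> 2 * max (Im \<tau>) (1 / Im \<tau>) ^ N" by (simp add: power_one_over)
    hence "\<bar>C\<bar> * (Im \<tau> ^ N + 1 / Im \<tau> ^ N) \<le> \<bar>C\<bar> * (2 * max (Im \<tau>) (1 / Im \<tau>) ^ N)"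
      by (rule mult_left_mono) simp
    moreover have "C * (Im \<tau> ^ N + 1 / Im \<tau> ^ N) \<le> \<bar>C\<bar> * (Im \<tau> ^ N + 1 / Im \<tau> ^ N)"
      using that by (intro mult_right_mono) auto
    ultimately show ?thesis using C[OF that] by linarith
  qed
  thus "\<exists>C N. C \<ge> 0 \<and> (\<forall>\<tau>\<in>upper_half_plane. norm (f \<tau>) \<le> C * max (Im \<tau>) (1 / Im \<tau>) ^ N)"
    by (intro exI[of _ "2 * \<bar>C\<bar>"] exI[of _ N]) auto
next
  assume "\<exists>C N. C \<ge> 0 \<and> (\<forall>\<tau>\<in>upper_half_plane. norm (f \<tau>) \<le> C * max (Im \<tau>) (1 / Im \<tau>) ^ N)"
  then obtain C N where C: "C \<ge> 0" "\<And>\<tau>. Im \<tau> > 0 \<Longrightarrow> norm (f \<tau>) \<le> C * max (Im \<tau>) (1 / Im \<tau>) ^ N" by auto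
  have "norm (f \<tau>) \<le> C * (Im \<tau> ^ N + 1 / Im \<tau> ^ N)" if "Im \<tau> > 0" for \<tau>
  proof -
    have "max (Im \<tau>) (1 / Im \<tau>) ^ N \<le> Im \<tau> ^ N + 1 / Im \<tau> ^ N"
      using that by (auto simp: max_def power_one_over)
    thus ?thesis using C(2)[OF that] mult_left_mono[OF _ C(1)] by (meson order_trans)
  qed
  thus "moderate_growth f" unfolding moderate_growth_def by auto
qed

lemma max_inverse_ge_1: "y > 0 \<Longrightarrow> 1 \<le> max y (1 / y :: real)"
  by (cases "y \<ge> 1") (auto simp: le_max_iff_disj field_simps)

lemma moderate_growth_const: "moderate_growth (\<lambda>_. c)"
  unfolding moderate_growth_iff by (intro exI[of _ "norm c"] exI[of _ 0]) simp

lemma moderate_growth_add: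
  assumes "moderate_growth f" "moderate_growth g"
  shows "moderate_growth (\<lambda>\<tau>. f \<tau> + g \<tau>)"
proof -
  from assms obtain C N D M where C: "C \<ge> 0" "D \<ge> 0"
    "\<And>\<tau>. Im \<tau> > 0 \<Longrightarrow> norm (f \<tau>) \<le> C * max (Im \<tau>) (1 / Im \<tau>) ^ N"
    "\<And>\<tau>. Im \<tau> > 0 \<Longrightarrow> norm (g \<tau>) \<le> D * max (Im \<tau>) (1 / Im \<tau>) ^ M"
    unfolding moderate_growth_iff by auto
  have "norm (f \<tau> + g \<tau>) \<le> (C + D) * max (Im \<tau>) (1 / Im \<tau>) ^ max N M" if "Im \<tau> > 0" for \<tau>
  proof -
    have "max (Im \<tau>) (1 / Im \<tau>) ^ N \<le> max (Im \<tau>) (1 / Im \<tau>) ^ max N M"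
      "max (Im \<tau>) (1 / Im \<tau>) ^ M \<le> max (Im \<tau>) (1 / Im \<tau>) ^ max N M"
      by (intro power_increasing max_inverse_ge_1 that; simp)+
    hence "norm (f \<tau>) \<le> C * max (Im \<tau>) (1 / Im \<tau>) ^ max N M" "norm (g \<tau>) \<le> D * max (Im \<tau>) (1 / Im \<tau>) ^ max N M"
      using C(3,4)[OF that] mult_left_mono C(1,2) by (meson order_trans)+
    thus ?thesis using norm_triangle_ineq[of "f \<tau>" "g \<tau>"] by (simp add: distrib_right)
  qed
  thus ?thesis unfolding moderate_growth_iff using C(1,2) by (intro exI[of _ "C + D"] exI[of _ "max N M"]) auto
qed

lemma moderate_growth_mult:
  assumes "moderate_growth f" "moderate_growth g"
  shows "moderate_growth (\<lambda>\<tau>. f \<tau> * g \<tau>)"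
proof -
  from assms obtain C N D M where C: "C \<ge> 0" "D \<ge> 0"
    "\<And>\<tau>. Im \<tau> > 0 \<Longrightarrow> norm (f \<tau>) \<le> C * max (Im \<tau>) (1 / Im \<tau>) ^ N"
    "\<And>\<tau>. Im \<tau> > 0 \<Longrightarrow> norm (g \<tau>) \<le> D * max (Im \<tau>) (1 / Im \<tau>) ^ M"
    unfolding moderate_growth_iff by auto
  have "norm (f \<tau> * g \<tau>) \<le> (C * D) * max (Im \<tau>) (1 / Im \<tau>) ^ (N + M)" if "Im \<tau> > 0" for \<tau>
  proof -
    have "norm (f \<tau> * g \<tau>) \<le> (C * max (Im \<tau>) (1 / Im \<tau>) ^ N) * (D * max (Im \<tau>) (1 / Im \<tau>) ^ M)"
      unfolding norm_mult using C that by (intro mult_mono) auto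
    thus ?thesis by (simp add: power_add mult_ac)
  qed
  thus ?thesis unfolding moderate_growth_iff using C(1,2) by (intro exI[of _ "C * D"] exI[of _ "N + M"]) auto
qed

lemma moderate_growth_sum:
  "(\<And>i. i \<in> A \<Longrightarrow> moderate_growth (f i)) \<Longrightarrow> moderate_growth (\<lambda>\<tau>. \<Sum>i\<in>A. f i \<tau>)"
  by (induction A rule: infinite_finite_induct) (auto intro: moderate_growth_add moderate_growth_const)

section \<open>The graded algebra of quasi-modular forms\<close>

text \<open>The coefficients are padded with zeros beyond the depth \<open>p\<close> and the
  identity is stated for every \<open>N \<ge> p\<close>, so that expansions of different depths can
  be added and multiplied like polynomials in \<open>c / (c \<tau> + d)\<close>.\<close>

definition quasimodular_expansion ::
    "(int \<times> int \<times> int \<times> int) set \<Rightarrow> nat \<Rightarrow> (complex \<Rightarrow> complex) \<Rightarrow> nat \<Rightarrow> (nat \<Rightarrow> complex \<Rightarrow> complex) \<Rightarrow> bool" where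
  "quasimodular_expansion G k f p g \<longleftrightarrow>
     (\<forall>r. g r holomorphic_on upper_half_plane) \<and> (\<forall>r. moderate_growth (g r)) \<and> (\<forall>r>p. g r = (\<lambda>_. 0)) \<and>
     (\<forall>a b c d \<tau> N. (a, b, c, d) \<in> G \<longrightarrow> Im \<tau> > 0 \<longrightarrow> N \<ge> p \<longrightarrow>
        f ((of_int a * \<tau> + of_int b) / (of_int c * \<tau> + of_int d)) / (of_int c * \<tau> + of_int d) ^ k =
        (\<Sum>r\<le>N. g r \<tau> * (of_int c / (of_int c * \<tau> + of_int d)) ^ r))"

lemma quasimodular_expansionD:
  assumes "quasimodular_expansion G k f p g"
  shows "g r holomorphic_on upper_half_plane" "moderate_growth (g r)" "r > p \<Longrightarrow> g r = (\<lambda>_. 0)"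
    "(a, b, c, d) \<in> G \<Longrightarrow> Im \<tau> > 0 \<Longrightarrow> N \<ge> p \<Longrightarrow>
        f ((of_int a * \<tau> + of_int b) / (of_int c * \<tau> + of_int d)) / (of_int c * \<tau> + of_int d) ^ k =
        (\<Sum>r\<le>N. g r \<tau> * (of_int c / (of_int c * \<tau> + of_int d)) ^ r)"
  using assms unfolding quasimodular_expansion_def by blast+

lemma quasimodular_form_obtain_expansion:
  assumes "quasimodular_form G k f"
  obtains p g where "quasimodular_expansion G k f p g"
proof -
  from assms obtain p g where g: "\<forall>r\<le>p. g r holomorphic_on upper_half_plane \<and> moderate_growth (g r)"
    and tr: "\<forall>(a, b, c, d)\<in>G. \<forall>\<tau>\<in>upper_half_plane.
        f ((of_int a * \<tau> + of_int b) / (of_int c * \<tau> + of_int d)) / (of_int c * \<tau> + of_int d) ^ k =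
        (\<Sum>r\<le>p. g r \<tau> * (of_int c / (of_int c * \<tau> + of_int d)) ^ r)"
    unfolding quasimodular_form_def by blast
  define g' where "g' = (\<lambda>r. if r \<le> p then g r else (\<lambda>_. 0))"
  have eq: "(\<Sum>r\<le>p. g r \<tau> * x ^ r) = (\<Sum>r\<le>N. g' r \<tau> * x ^ r)" if "N \<ge> p" for \<tau> x N
    by (rule sum.mono_neutral_cong_left) (use that in \<open>auto simp: g'_def\<close>)
  have "f ((of_int a * \<tau> + of_int b) / (of_int c * \<tau> + of_int d)) / (of_int c * \<tau> + of_int d) ^ k =
        (\<Sum>r\<le>N. g' r \<tau> * (of_int c / (of_int c * \<tau> + of_int d)) ^ r)"
    if "(a, b, c, d) \<in> G" "Im \<tau> > 0" "N \<ge> p" for a b c d \<tau> N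
    using bspec[OF tr that(1)] that(2) eq[OF that(3)] by simp
  moreover have "g' r holomorphic_on upper_half_plane \<and> moderate_growth (g' r)" for r
    using g moderate_growth_const[of 0] by (simp add: g'_def)
  ultimately have "quasimodular_expansion G k f p g'"
    unfolding quasimodular_expansion_def by (auto simp: g'_def)
  thus ?thesis by (rule that)
qed

lemma quasimodular_formI:
  assumes "\<And>r. g r holomorphic_on upper_half_plane" "\<And>r. moderate_growth (g r)"
    "\<And>a b c d \<tau>. (a, b, c, d) \<in> G \<Longrightarrow> Im \<tau> > 0 \<Longrightarrow>
        f ((of_int a * \<tau> + of_int b) / (of_int c * \<tau> + of_int d)) / (of_int c * \<tau> + of_int d) ^ k =
        (\<Sum>r\<le>p. g r \<tau> * (of_int c / (of_int c * \<tau> + of_int d)) ^ r)"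
  shows "quasimodular_form G k f"
  unfolding quasimodular_form_def using assms by (intro exI[of _ p] exI[of _ g]) auto

lemma quasimodular_form_const: "quasimodular_form G 0 (\<lambda>_. c)"
  by (rule quasimodular_formI[where p = 0 and g = "\<lambda>_ _. c"]) (auto intro: moderate_growth_const)

lemma quasimodular_form_zero: "quasimodular_form G k (\<lambda>_. 0)"
  by (rule quasimodular_formI[where p = 0 and g = "\<lambda>_ _. 0"]) (auto intro: moderate_growth_const)

lemma quasimodular_form_add:
  assumes "quasimodular_form G k f1" "quasimodular_form G k f2"
  shows "quasimodular_form G k (\<lambda>\<tau>. f1 \<tau> + f2 \<tau>)"
proof -
  obtain p1 g1 where "quasimodular_expansion G k f1 p1 g1"
    by (rule quasimodular_form_obtain_expansion[OF assms(1)])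
  note 1 = quasimodular_expansionD[OF this]
  obtain p2 g2 where "quasimodular_expansion G k f2 p2 g2"
    by (rule quasimodular_form_obtain_expansion[OF assms(2)])
  note 2 = quasimodular_expansionD[OF this]
  show ?thesis
  proof (rule quasimodular_formI[where p = "max p1 p2" and g = "\<lambda>r \<tau>. g1 r \<tau> + g2 r \<tau>"])
    fix a b c d \<tau> assume G: "(a, b, c, d) \<in> G" "Im \<tau> > 0"
    let ?l = "of_int c * \<tau> + of_int d"
    let ?t = "(of_int a * \<tau> + of_int b) / ?l"
    have "(f1 ?t + f2 ?t) / ?l ^ k = f1 ?t / ?l ^ k + f2 ?t / ?l ^ k" by (rule add_divide_distrib)
    also have "\<dots> = (\<Sum>r\<le>max p1 p2. g1 r \<tau> * (of_int c / ?l) ^ r) + (\<Sum>r\<le>max p1 p2. g2 r \<tau> * (of_int c / ?l) ^ r)"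
      by (intro arg_cong2[of _ _ _ _ "(+)"] 1(4) 2(4) G max.cobounded1 max.cobounded2)
    also have "\<dots> = (\<Sum>r\<le>max p1 p2. (g1 r \<tau> + g2 r \<tau>) * (of_int c / ?l) ^ r)"
      by (simp only: distrib_right sum.distrib)
    finally show "(f1 ?t + f2 ?t) / ?l ^ k = (\<Sum>r\<le>max p1 p2. (g1 r \<tau> + g2 r \<tau>) * (of_int c / ?l) ^ r)" .
  qed (intro holomorphic_intros moderate_growth_add 1 2)+
qed

lemma quasimodular_form_mult:
  assumes "quasimodular_form G k1 f1" "quasimodular_form G k2 f2"
  shows "quasimodular_form G (k1 + k2) (\<lambda>\<tau>. f1 \<tau> * f2 \<tau>)"
proof -
  obtain p1 g1 where "quasimodular_expansion G k1 f1 p1 g1"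
    by (rule quasimodular_form_obtain_expansion[OF assms(1)])
  note 1 = quasimodular_expansionD[OF this]
  obtain p2 g2 where "quasimodular_expansion G k2 f2 p2 g2"
    by (rule quasimodular_form_obtain_expansion[OF assms(2)])
  note 2 = quasimodular_expansionD[OF this]
  show ?thesis
  proof (rule quasimodular_formI[where p = "p1 + p2" and g = "\<lambda>r \<tau>. \<Sum>i\<le>r. g1 i \<tau> * g2 (r - i) \<tau>"])
    fix a b c d \<tau> assume G: "(a, b, c, d) \<in> G" "Im \<tau> > 0"
    let ?l = "of_int c * \<tau> + of_int d"
    let ?t = "(of_int a * \<tau> + of_int b) / ?l"
    have "f1 ?t * f2 ?t / ?l ^ (k1 + k2) = (f1 ?t / ?l ^ k1) * (f2 ?t / ?l ^ k2)"
      by (simp add: power_add)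
    also have "\<dots> = (\<Sum>r\<le>p1. g1 r \<tau> * (of_int c / ?l) ^ r) * (\<Sum>r\<le>p2. g2 r \<tau> * (of_int c / ?l) ^ r)"
      by (intro arg_cong2[of _ _ _ _ "(*)"] 1(4) 2(4) G order_refl)
    also have "\<dots> = (\<Sum>r\<le>p1 + p2. (\<Sum>i\<le>r. g1 i \<tau> * g2 (r - i) \<tau>) * (of_int c / ?l) ^ r)"
      by (rule polynomial_product) (use 1(3) 2(3) in auto)
    finally show "f1 ?t * f2 ?t / ?l ^ (k1 + k2) = (\<Sum>r\<le>p1 + p2. (\<Sum>i\<le>r. g1 i \<tau> * g2 (r - i) \<tau>) * (of_int c / ?l) ^ r)" .
  qed (intro holomorphic_intros moderate_growth_sum moderate_growth_mult 1 2)+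
qed

text \<open>Agreement on the upper half-plane is used at the transformed point; matrices in
  \<open>Gamma0 N\<close> have determinant one and keep that point in the upper half-plane.\<close>

lemma quasimodular_form_cong:
  assumes "quasimodular_form (Gamma0 N) k f" "\<And>\<tau>. Im \<tau> > 0 \<Longrightarrow> f \<tau> = h \<tau>"
  shows "quasimodular_form (Gamma0 N) k h"
proof -
  obtain p g where "quasimodular_expansion (Gamma0 N) k f p g"
    by (rule quasimodular_form_obtain_expansion[OF assms(1)])
  note 1 = quasimodular_expansionD[OF this]
  show ?thesis
  proof (rule quasimodular_formI[where p = p and g = g, OF 1(1,2)])
    fix a b c d \<tau> assume G: "(a, b, c, d) \<in> Gamma0 N" "Im \<tau> > 0"
    let ?l = "of_int c * \<tau> + of_int d"
    let ?t = "(of_int a * \<tau> + of_int b) / ?l"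
    have "Im ?t > 0" using G by (intro moebius_Im_pos) (auto simp: Gamma0_def)
    hence "h ?t = f ?t" by (rule assms(2)[symmetric])
    thus "h ?t / ?l ^ k = (\<Sum>r\<le>p. g r \<tau> * (of_int c / ?l) ^ r)"
      using 1(4)[OF G order_refl] by simp
  qed
qed

lemma quasimodular_form_cmult:
  assumes "quasimodular_form G k f"
  shows "quasimodular_form G k (\<lambda>\<tau>. c * f \<tau>)"
  using quasimodular_form_mult[OF quasimodular_form_const[of G c] assms] by simp

lemma quasimodular_form_sum:
  "(\<And>i. i \<in> A \<Longrightarrow> quasimodular_form G k (f i)) \<Longrightarrow> quasimodular_form G k (\<lambda>\<tau>. \<Sum>i\<in>A. f i \<tau>)"
  by (induction A rule: infinite_finite_induct) (auto intro: quasimodular_form_add quasimodular_form_zero)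

lemma quasimodular_form_prod:
  "(\<And>i. i \<in> A \<Longrightarrow> quasimodular_form G (k i) (f i)) \<Longrightarrow> finite A \<Longrightarrow>
    quasimodular_form G (\<Sum>i\<in>A. k i) (\<lambda>\<tau>. \<Prod>i\<in>A. f i \<tau>)"
  by (induction A rule: infinite_finite_induct) (auto intro: quasimodular_form_mult quasimodular_form_const)

lemma quasimodular_form_power:
  assumes "quasimodular_form G k f"
  shows "quasimodular_form G (k * n) (\<lambda>\<tau>. f \<tau> ^ n)"
  by (induction n) (auto intro: quasimodular_form_mult[OF assms] quasimodular_form_const)

section \<open>Growth and quasi-modularity of the Taylor coefficients\<close>

text \<open>A single Taylor term bounds the exponential from below; the free exponent
  \<open>n\<close> is later chosen large enough for convergence.\<close>

lemma exp_minus_one_ge: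
  fixes x :: real
  assumes "x \<ge> 0" "n > 0"
  shows "exp x - 1 \<ge> x ^ n / fact n"
proof -
  have "(\<Sum>i\<in>{0, n}. x ^ i /\<^sub>R fact i) \<le> (suminf (\<lambda>i. x ^ i /\<^sub>R fact i))"
    by (rule sum_le_suminf[OF summable_exp_generic]) (use assms in auto)
  thus ?thesis using assms by (simp add: exp_def divide_inverse mult_ac)
qed

text \<open>With \<open>norm (q ^ n) = exp (- x)\<close> each quotient is at most
  \<open>1 / (exp x - 1)\<close>, hence at most \<open>fact (k + 2) / x ^ (k + 2)\<close>. The
  exponent \<open>k + 2\<close> absorbs the factor \<open>n ^ (k - 1)\<close>, leaves the summable
  \<open>1 / n ^ 2\<close>, and costs a power of \<open>1 / Im \<tau>\<close>.\<close>

lemma moderate_growth_theta_ld_coeff: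
  assumes D: "D > 0"
  shows "moderate_growth (\<lambda>\<tau>. theta_ld_coeff k (nome (of_nat D * \<tau>)))"
proof -
  have sq: "summable (\<lambda>n. 1 / real (Suc n) ^ 2)"
    using inverse_power_summable[of 2, where 'a = real] by (subst summable_Suc_iff) (simp add: divide_inverse)
  define B where "B = fact (k + 2) * (suminf (\<lambda>n. 1 / real (Suc n) ^ 2))"
  have bound: "norm (suminf (\<lambda>n. of_nat (Suc n) ^ (k - 1) * (nome (of_nat D * \<tau>) ^ Suc n / (1 - nome (of_nat D * \<tau>) ^ Suc n))))
      \<le> B * max (Im \<tau>) (1 / Im \<tau>) ^ (k + 2)" if \<tau>: "Im \<tau> > 0" for \<tau>
  proof -
    let ?q = "nome (of_nat D * \<tau>)"
    let ?h = "max (Im \<tau>) (1 / Im \<tau>)"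
    let ?f = "\<lambda>n. of_nat (Suc n) ^ (k - 1) * (?q ^ Suc n / (1 - ?q ^ Suc n))"
    have le: "norm (?f n) \<le> fact (k + 2) * ?h ^ (k + 2) * (1 / real (Suc n) ^ 2)" for n
    proof -
      define x where "x = 2 * pi * real D * Im \<tau> * real (Suc n)"
      have x: "x > 0" using \<tau> D by (simp add: x_def)
      have "norm (?q ^ Suc n) = exp (- x)"
        by (simp add: x_def norm_power exp_of_nat_mult[symmetric] mult_ac del: of_nat_Suc power_Suc)
      moreover have "1 - norm (?q ^ Suc n) \<le> norm (1 - ?q ^ Suc n)"
        using norm_triangle_ineq2[of 1 "?q ^ Suc n"] by simp
      ultimately have "norm (?q ^ Suc n / (1 - ?q ^ Suc n)) \<le> exp (- x) / (1 - exp (- x))"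
        unfolding norm_divide using x by (intro frac_le) auto
      also have "\<dots> = 1 / (exp x - 1)" using x by (simp add: exp_minus field_simps)
      also have "\<dots> \<le> 1 / (x ^ (k + 2) / fact (k + 2))"
        using exp_minus_one_ge[of x "k + 2"] x by (intro divide_left_mono) auto
      also have "\<dots> = fact (k + 2) / x ^ (k + 2)" by simp
      also have "\<dots> \<le> fact (k + 2) / (Im \<tau> * real (Suc n)) ^ (k + 2)"
      proof (intro divide_left_mono power_mono)
        have "1 * (Im \<tau> * real (Suc n)) \<le> (2 * pi * real D) * (Im \<tau> * real (Suc n))"
        proof (rule mult_right_mono)
          have "1 * 1 \<le> (2 * pi) * real D" using D pi_gt3 by (intro mult_mono) auto
          thus "1 \<le> 2 * pi * real D" by simp
        qed (use \<tau> in auto)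
        thus "Im \<tau> * real (Suc n) \<le> x" by (simp add: x_def mult_ac)
      qed (use \<tau> x in auto)
      finally have "norm (?f n) \<le> real (Suc n) ^ (k - 1) * (fact (k + 2) / (Im \<tau> * real (Suc n)) ^ (k + 2))"
        unfolding norm_mult norm_power norm_of_nat by (intro mult_left_mono) auto
      also have "\<dots> \<le> real (Suc n) ^ k * (fact (k + 2) / (Im \<tau> * real (Suc n)) ^ (k + 2))"
        using \<tau> by (intro mult_right_mono power_increasing) auto
      also have "\<dots> = fact (k + 2) * (1 / Im \<tau>) ^ (k + 2) * (1 / real (Suc n) ^ 2)"
        by (simp add: power_add power_mult_distrib power_one_over power2_eq_square field_simps del: of_nat_Suc)
      also have "\<dots> \<le> fact (k + 2) * ?h ^ (k + 2) * (1 / real (Suc n) ^ 2)"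
        using \<tau> by (intro mult_right_mono mult_left_mono power_mono) auto
      finally show ?thesis .
    qed
    have "norm (suminf (\<lambda>n. ?f n)) \<le> (suminf (\<lambda>n. fact (k + 2) * ?h ^ (k + 2) * (1 / real (Suc n) ^ 2)))"
      by (rule norm_suminf_le[OF le summable_mult[OF sq]])
    also have "\<dots> = B * ?h ^ (k + 2)" by (subst suminf_mult[OF sq]) (simp add: B_def mult_ac)
    finally show ?thesis .
  qed
  have B: "B \<ge> 0" unfolding B_def by (intro mult_nonneg_nonneg suminf_nonneg sq) auto
  have "moderate_growth (\<lambda>\<tau>. suminf (\<lambda>n. of_nat (Suc n) ^ (k - 1) * (nome (of_nat D * \<tau>) ^ Suc n / (1 - nome (of_nat D * \<tau>) ^ Suc n))))"
    unfolding moderate_growth_iff using bound B by (intro exI[of _ B] exI[of _ "k + 2"]) auto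
  hence main: "moderate_growth (\<lambda>\<tau>. of_real (bernoulli k / fact k) + (- 2 / fact (k - 1)) *
     (suminf (\<lambda>n. of_nat (Suc n) ^ (k - 1) * (nome (of_nat D * \<tau>) ^ Suc n / (1 - nome (of_nat D * \<tau>) ^ Suc n)))))"
    by (intro moderate_growth_add moderate_growth_mult moderate_growth_const)
  show ?thesis
  proof (cases "k = 0 \<or> odd k")
    case True
    hence "(\<lambda>\<tau>. theta_ld_coeff k (nome (of_nat D * \<tau>))) = (\<lambda>_. if k = 0 then 1 else 0)"
      by (auto simp: theta_ld_coeff_def)
    thus ?thesis by (simp only: moderate_growth_const)
  next
    case False
    hence "(\<lambda>\<tau>. theta_ld_coeff k (nome (of_nat D * \<tau>))) = (\<lambda>\<tau>. of_real (bernoulli k / fact k) + (- 2 / fact (k - 1)) *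
     (suminf (\<lambda>n. of_nat (Suc n) ^ (k - 1) * (nome (of_nat D * \<tau>) ^ Suc n / (1 - nome (of_nat D * \<tau>) ^ Suc n)))))"
      by (simp add: theta_ld_coeff_def fun_eq_iff)
    thus ?thesis by (simp only: main)
  qed
qed

lemma holomorphic_theta_ld_coeff_nome:
  assumes "D > 0"
  shows "(\<lambda>\<tau>. theta_ld_coeff k (nome (of_nat D * \<tau>))) holomorphic_on upper_half_plane"
  by (rule holomorphic_on_compose_gen[OF _ holomorphic_theta_ld_coeff, unfolded o_def])
     (use assms in \<open>auto intro!: holomorphic_intros\<close>)

text \<open>On \<open>D * \<tau>\<close> the matrix \<open>(a, b, c, d)\<close> acts as
  \<open>(a, D * b, c / D, d)\<close>, which is integral because \<open>D\<close> divides
  \<open>N\<close> and \<open>N\<close> divides \<open>c\<close>. The depth is at most one, and the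
  additional coefficient, present only in weight 2, is a constant.\<close>

theorem quasimodular_theta_ld_coeff:
  assumes D: "D > 0" "D dvd N" and k: "k > 0"
  shows "quasimodular_form (Gamma0 N) k (\<lambda>\<tau>. theta_ld_coeff k (nome (of_nat D * \<tau>)))"
proof (rule quasimodular_formI[where p = 1 and g = "\<lambda>r. if r = 0 then (\<lambda>\<tau>. theta_ld_coeff k (nome (of_nat D * \<tau>)))
      else (\<lambda>_. if k = 2 then 1 / (two_pi_i * of_nat D) else 0)"], goal_cases)
  case (1 r)
  thus ?case using holomorphic_theta_ld_coeff_nome[OF D(1)] by auto
next
  case (2 r)
  thus ?case using moderate_growth_theta_ld_coeff[OF D(1)] moderate_growth_const by auto
next
  case (3 a b c d \<tau>)
  hence det: "a * d - b * c = 1" and Nc: "int N dvd c" by (auto simp: Gamma0_def)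
  have "int D dvd c" using D(2) Nc by (meson dvd_trans of_nat_dvd_iff)
  then obtain c' where c': "c = int D * c'" by (elim dvdE)
  obtain n where n: "k = Suc n" using k by (cases k) auto
  have det': "a * d - (int D * b) * c' = 1" using det by (simp add: c' mult_ac)
  have Im: "Im (of_nat D * \<tau>) > 0" using D(1) 3 by simp
  note main = theta_ld_coeff_modular[OF det' Im, of n]
  let ?l = "of_int c * \<tau> + of_int d"
  have L: "of_int c' * (of_nat D * \<tau>) + of_int d = ?l" by (simp add: c')
  have T: "(of_int a * (of_nat D * \<tau>) + of_int (int D * b)) / l = of_nat D * ((of_int a * \<tau> + of_int b) / l)" for l
    by (simp add: algebra_simps)
  have "(if n = 1 then of_int c' / (two_pi_i * ?l) else 0) =
      (if k = 2 then 1 / (two_pi_i * of_nat D) else 0) * (of_int c / ?l)"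
    using D(1) by (simp add: n c')
  with main show ?case unfolding L T by (simp only: n) simp
qed


section \<open>The partial fraction decomposition\<close>

definition phi :: "nat \<Rightarrow> complex \<Rightarrow> complex \<Rightarrow> complex" where
  "phi m w t = theta (exp (of_nat m * w)) (of_nat m * t) / theta (exp w) t ^ m"

lemma holomorphic_phi:
  assumes w: "Re w < 0" and m: "m > 0"
  shows "phi m w holomorphic_on - period_lattice w"
  unfolding phi_def[abs_def]
  by (intro holomorphic_intros holomorphic_theta[of _ "\<lambda>t. t"])
     (use w m theta_eq_0_iff[OF w] in \<open>auto simp: zero_less_mult_iff mult_less_0_iff\<close>)

text \<open>Under \<open>w\<close> the numerator, a single theta function, contributes one sign and
  the denominator contributes \<open>m\<close> of them; these agree for odd \<open>m\<close>. The
  exponential factors match since the numerator has \<open>m * w\<close> and \<open>m * t\<close> in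
  place of \<open>w\<close> and \<open>t\<close>.\<close>

lemma phi_periodic:
  assumes w: "Re w < 0" and m: "odd m"
  shows "phi m w (t + two_pi_i) = phi m w t" "phi m w (t + w) = phi m w t"
proof -
  have "theta q (of_nat m * (t + two_pi_i)) = - theta q (of_nat m * t)" for q
  proof -
    have "theta q (s + of_nat n * two_pi_i) = (- 1) ^ n * theta q s" for n s
    proof (induction n)
      case (Suc n)
      have "theta q (s + of_nat (Suc n) * two_pi_i) =
          theta q ((s + of_nat n * two_pi_i) + two_pi_i)"
        by (simp add: algebra_simps)
      thus ?case by (simp only: theta_add_2pi_i Suc.IH) simp
    qed simp
    from this[of "of_nat m * t" m] m show ?thesis by (simp add: distrib_left)
  qed
  thus "phi m w (t + two_pi_i) = phi m w t"
    using m by (simp add: phi_def theta_add_2pi_i)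
  have m0: "m > 0" using m by (cases m) auto
  have mw: "Re (of_nat m * w) < 0" using w m0 by (simp add: mult_less_0_iff)
  have "theta (exp (of_nat m * w)) (of_nat m * (t + w)) =
      - (exp (- w / 2 - t) ^ m) * theta (exp (of_nat m * w)) (of_nat m * t)"
    using theta_add_period[OF mw, of "of_nat m * t"]
    by (simp add: exp_of_nat_mult[symmetric] algebra_simps)
  moreover have "(- exp (- w / 2 - t) * theta (exp w) t) ^ m = - (exp (- w / 2 - t) ^ m) * theta (exp w) t ^ m"
    using m by (simp add: power_mult_distrib)
  ultimately show "phi m w (t + w) = phi m w t"
    by (simp add: phi_def theta_add_period[OF w])
qed

section \<open>Taylor coefficients of the theta quotient\<close>

text \<open>The logarithmic derivative of \<open>Sm / S ^ m\<close> for the Euler operator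
  \<open>fps_X * fps_deriv\<close>, written without division of power series.\<close>

lemma fps_deriv_power_cancel:
  fixes S Sm U N Nm :: "complex fps"
  assumes S: "fps_X * fps_deriv S = (N - 1) * S" and Sm: "fps_X * fps_deriv Sm = (Nm - 1) * Sm"
    and U: "U * S ^ m = Sm" and nz: "S \<noteq> 0"
  shows "fps_X * fps_deriv U = ((Nm - 1) - of_nat m * (N - 1)) * U"
proof -
  have XS: "fps_X * fps_deriv (S ^ n) = of_nat n * (N - 1) * S ^ n" for n
  proof (induction n)
    case (Suc n)
    have "fps_X * fps_deriv (S ^ Suc n) = (fps_X * fps_deriv S) * S ^ n + S * (fps_X * fps_deriv (S ^ n))"
      by (simp add: algebra_simps)
    also have "\<dots> = of_nat (Suc n) * (N - 1) * S ^ Suc n"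
      unfolding S Suc.IH by (simp add: algebra_simps)
    finally show ?case .
  qed simp
  have "(fps_X * fps_deriv U) * S ^ m = fps_X * fps_deriv (U * S ^ m) - U * (fps_X * fps_deriv (S ^ m))"
    by (simp add: algebra_simps)
  also have "\<dots> = (Nm - 1) * (U * S ^ m) - U * (of_nat m * (N - 1) * S ^ m)"
    by (simp only: U Sm XS)
  also have "\<dots> = (((Nm - 1) - of_nat m * (N - 1)) * U) * S ^ m"
    by (simp add: algebra_simps)
  finally have "(fps_X * fps_deriv U) * S ^ m = (((Nm - 1) - of_nat m * (N - 1)) * U) * S ^ m" .
  thus ?thesis using nz by (metis mult_right_cancel power_not_zero)
qed

text \<open>Dividing by \<open>t\<close> leaves a nonzero constant coefficient, so that powers of
  \<open>S\<close> can be inverted as power series; it also lowers the logarithmic derivative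
  \<open>t theta' / theta\<close> by one.\<close>

lemma theta_has_fps_expansion:
  assumes w: "Re w < 0"
  obtains S where "(\<lambda>t. if t = 0 then euler_prod (exp w) ^ 3 else theta (exp w) t / t) has_fps_expansion S"
    "fps_nth S 0 = euler_prod (exp w) ^ 3"
    "fps_X * fps_deriv S = (Abs_fps (\<lambda>n. theta_ld_coeff n (exp w)) - 1) * S"
proof -
  let ?th = "theta (exp w)"
  define N where "N = Abs_fps (\<lambda>n. theta_ld_coeff n (exp w))"
  define T where "T = fps_expansion ?th 0"
  have q: "norm (exp w) < 1" using w by simp
  have "?th analytic_on {0}"
    using holomorphic_theta[OF q, of "\<lambda>t. t" UNIV] by (auto simp: analytic_at intro: holomorphic_intros)
  hence T: "?th has_fps_expansion T" unfolding T_def by (rule analytic_at_imp_has_fps_expansion_0)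
  have T0: "fps_nth T 0 = 0" and T1: "fps_nth T 1 = euler_prod (exp w) ^ 3"
    using fps_nth_fps_expansion[OF T, of 0] fps_nth_fps_expansion[OF T, of 1] deriv_theta_0[OF w]
    by (simp_all add: theta_def)
  define S where "S = fps_shift 1 T"
  have TS: "T = fps_X * S" using T0 by (intro fps_ext) (auto simp: S_def)
  have 1: "(\<lambda>t. if t = 0 then euler_prod (exp w) ^ 3 else ?th t / t) has_fps_expansion S"
    using has_fps_expansion_shift_le[OF T, of 1 "euler_prod (exp w) ^ 3"] T0 T1 by (simp add: S_def cong: if_cong)
  have "(\<lambda>t. (if t = 0 then 1 else t * theta_ld (exp w) t) * ?th t) has_fps_expansion N * T"
    unfolding N_def by (intro fps_expansion_intros theta_ld_has_fps_expansion w T)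
  moreover have "\<forall>\<^sub>F t in nhds 0. (if t = 0 then 1 else t * theta_ld (exp w) t) * ?th t = t * deriv ?th t"
  proof -
    have "\<forall>\<^sub>F t in nhds 0. t \<noteq> 0 \<longrightarrow> t \<notin> period_lattice w"
      using eventually_not_in_period_lattice[OF w] by (simp add: eventually_at_filter)
    thus ?thesis
    proof eventually_elim
      case (elim t)
      thus ?case using theta_eq_0_iff[OF w, of t] by (auto simp: theta_ld_def theta_def)
    qed
  qed
  ultimately have "(\<lambda>t. t * deriv ?th t) has_fps_expansion N * T" by (rule has_fps_expansion_transform)
  moreover have "(\<lambda>t. t * deriv ?th t) has_fps_expansion fps_X * fps_deriv T"
    by (intro fps_expansion_intros T)
  ultimately have "fps_X * fps_deriv T = N * T" by (rule fps_expansion_unique_complex[symmetric])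
  hence "fps_X * (fps_X * fps_deriv S + S) = fps_X * (N * S)" unfolding TS by (simp add: algebra_simps)
  hence "fps_X * fps_deriv S + S = N * S" by (metis fps_X_neq_zero mult_left_cancel)
  hence "fps_X * fps_deriv S = (N - 1) * S" by (simp add: algebra_simps eq_diff_eq)
  with 1 show ?thesis using T1 that by (simp add: N_def S_def)
qed

text \<open>The Taylor coefficients of \<open>U(t) = t\<^bsup>m-1\<^esup> phi m w t / phi_scale m q\<close> at \<open>0\<close>. The recursion expresses
  \<open>t U' / U = m - 1 + m t J(m t; m w) - m t J(t; w)\<close>, where \<open>J = theta' / theta\<close>.\<close>

fun phi_coeff :: "nat \<Rightarrow> nat \<Rightarrow> complex \<Rightarrow> complex" where
  "phi_coeff m 0 q = of_nat m"
| "phi_coeff m (Suc n) q = (\<Sum>i\<le>n. (of_nat m ^ Suc i * theta_ld_coeff (Suc i) (q ^ m) -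
     of_nat m * theta_ld_coeff (Suc i) q) * phi_coeff m (n - i) q) / of_nat (Suc n)"

lemma phi_coeff_odd: "odd n \<Longrightarrow> phi_coeff m n q = 0"
proof (induction n rule: less_induct)
  case (less n)
  then obtain k where n: "n = Suc k" by (cases n) auto
  have "(of_nat m ^ Suc i * theta_ld_coeff (Suc i) (q ^ m) -
     of_nat m * theta_ld_coeff (Suc i) q) * phi_coeff m (k - i) q = 0" if "i \<le> k" for i
  proof (cases "even i")
    case True
    thus ?thesis by (simp add: theta_ld_coeff_def)
  next
    case False
    hence "odd (k - i)" using less.prems n that by auto
    thus ?thesis using less.IH[of "k - i"] n by simp
  qed
  thus ?case unfolding n phi_coeff.simps by (simp add: sum.neutral)
qed

lemma holomorphic_phi_coeff:
  assumes "m > 0"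
  shows "phi_coeff m n holomorphic_on ball 0 1"
proof (induction n rule: less_induct)
  case (less n)
  have N: "(\<lambda>q. theta_ld_coeff i (q ^ m)) holomorphic_on ball 0 1" for i
    by (rule holomorphic_on_compose_gen[OF _ holomorphic_theta_ld_coeff, unfolded o_def])
       (use assms in \<open>auto intro!: holomorphic_intros simp: norm_power power_less_one_iff\<close>)
  show ?case
  proof (cases n)
    case 0
    thus ?thesis by simp
  next
    case (Suc k)
    show ?thesis unfolding Suc phi_coeff.simps[abs_def]
      by (intro holomorphic_intros N holomorphic_theta_ld_coeff less.IH) (use Suc in auto)
  qed
qed

text \<open>Since theta has derivative \<open>euler_prod q ^ 3\<close> at \<open>0\<close>, the
  leading Laurent coefficient of \<open>phi m w\<close> at \<open>0\<close> is \<open>m\<close>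
  times this; the factor \<open>m\<close> is \<open>phi_coeff m 0 q\<close>.\<close>

definition phi_scale :: "nat \<Rightarrow> complex \<Rightarrow> complex" where
  "phi_scale m q = euler_prod (q ^ m) ^ 3 / euler_prod q ^ (3 * m)"

text \<open>The limit at \<open>0\<close> of \<open>phi / phi_scale\<close> minus the combination of the \<open>ell_p w (2 * k)\<close> with the same
  principal part.\<close>

definition phi_const :: "nat \<Rightarrow> complex \<Rightarrow> complex" where
  "phi_const m q = (\<Sum>k\<le>(m - 1) div 2. phi_coeff m (2 * ((m - 1) div 2 - k)) q * theta_ld_coeff (2 * k) q)"

lemma phi_has_fps_expansion:
  assumes w: "Re w < 0" and m: "m > 0"
  obtains U where "U has_fps_expansion Abs_fps (\<lambda>n. phi_scale m (exp w) * phi_coeff m n (exp w))"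
    "\<And>t. t \<noteq> 0 \<Longrightarrow> U t = phi m w t * t ^ (m - 1)"
proof -
  let ?q = "exp w" and ?qm = "exp (of_nat m * w)"
  have qm: "?qm = ?q ^ m" by (rule exp_of_nat_mult)
  have mw: "Re (of_nat m * w) < 0" using w m by (simp add: mult_less_0_iff)
  obtain S where S: "(\<lambda>t. if t = 0 then euler_prod ?q ^ 3 else theta ?q t / t) has_fps_expansion S"
    "fps_nth S 0 = euler_prod ?q ^ 3" "fps_X * fps_deriv S = (Abs_fps (\<lambda>n. theta_ld_coeff n ?q) - 1) * S"
    using theta_has_fps_expansion[OF w] by blast
  obtain S' where S': "(\<lambda>t. if t = 0 then euler_prod ?qm ^ 3 else theta ?qm t / t) has_fps_expansion S'"
    "fps_nth S' 0 = euler_prod ?qm ^ 3" "fps_X * fps_deriv S' = (Abs_fps (\<lambda>n. theta_ld_coeff n ?qm) - 1) * S'"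
    using theta_has_fps_expansion[OF mw] by blast
  define Sm where "Sm = fps_const (of_nat m) * Abs_fps (\<lambda>n. of_nat m ^ n * fps_nth S' n)"
  define Nm where "Nm = Abs_fps (\<lambda>n. of_nat m ^ n * theta_ld_coeff n ?qm)"
  have sm: "(\<lambda>t. of_nat m * (if of_nat m * t = 0 then euler_prod ?qm ^ 3 else theta ?qm (of_nat m * t) / (of_nat m * t)))
      has_fps_expansion Sm"
    unfolding Sm_def by (intro fps_expansion_intros has_fps_expansion_scale[OF S'(1)])
  have Sm_ode: "fps_X * fps_deriv Sm = (Nm - 1) * Sm"
  proof -
    define comp where "comp = (\<lambda>F::complex fps. fps_compose F (fps_const (of_nat m) * fps_X))"
    have d: "fps_X * fps_deriv (comp F) = comp (fps_X * fps_deriv F)" for F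
      unfolding comp_def by (rule fps_ext) (simp add: fps_X_mult_nth)
    have mult: "comp (F * G) = comp F * comp G" for F G
      unfolding comp_def by (rule fps_compose_mult_distrib) simp
    have Sm_comp: "Sm = fps_const (of_nat m) * comp S'"
      by (simp add: Sm_def comp_def fps_compose_linear)
    have Nm_comp: "Nm - 1 = comp (Abs_fps (\<lambda>n. theta_ld_coeff n ?qm) - 1)"
      by (rule fps_ext) (simp add: Nm_def comp_def)
    have "fps_X * fps_deriv Sm = fps_const (of_nat m) * (fps_X * fps_deriv (comp S'))"
      by (simp add: Sm_comp)
    also have "\<dots> = fps_const (of_nat m) * ((Nm - 1) * comp S')"
      by (simp only: d S'(3) mult Nm_comp)
    also have "\<dots> = (Nm - 1) * Sm" by (simp only: Sm_comp mult.left_commute)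
    finally show ?thesis .
  qed
  have S0: "S \<noteq> 0" using S(2) by auto
  define Uf where "Uf = Sm / S ^ m"
  have Sm_nz: "fps_nth (S ^ m) 0 \<noteq> 0" by (simp add: S(2) fps_nth_power_0)
  have U: "Uf * S ^ m = Sm"
    unfolding Uf_def using Sm_nz by (simp add: fps_divide_unit mult.assoc inverse_mult_eq_1)
  define U where "U = (\<lambda>t. (of_nat m * (if of_nat m * t = 0 then euler_prod ?qm ^ 3 else theta ?qm (of_nat m * t) / (of_nat m * t))) /
      (if t = 0 then euler_prod ?q ^ 3 else theta ?q t / t) ^ m)"
  have Ufps: "U has_fps_expansion Uf"
    unfolding U_def Uf_def by (intro has_fps_expansion_divide' sm has_fps_expansion_power S(1) Sm_nz)
  have Uphi: "U t = phi m w t * t ^ (m - 1)" if "t \<noteq> 0" for t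
  proof -
    have "t ^ m = t * t ^ (m - 1)" using m by (cases m) auto
    thus ?thesis using that m by (simp add: U_def phi_def power_divide)
  qed
  \<comment> \<open>\<open>K\<close> is the series of \<open>t U' / U\<close>. Its constant
    coefficient is \<open>0\<close>, so comparing coefficients at \<open>Suc k\<close> involves only
    earlier coefficients of \<open>Uf\<close> and reproduces the recursion of
    \<open>phi_coeff\<close>.\<close>
  define K where "K = (Nm - 1) - of_nat m * (Abs_fps (\<lambda>n. theta_ld_coeff n ?q) - 1)"
  have K0: "fps_nth K 0 = 0" by (simp add: K_def Nm_def theta_ld_coeff_def)
  have Kn: "fps_nth K (Suc i) = of_nat m ^ Suc i * theta_ld_coeff (Suc i) (?q ^ m) - of_nat m * theta_ld_coeff (Suc i) ?q" for i
    by (simp add: K_def Nm_def qm fps_of_nat[symmetric] del: fps_of_nat)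
  have ode: "fps_X * fps_deriv Uf = K * Uf"
    unfolding K_def by (rule fps_deriv_power_cancel[OF S(3) Sm_ode U S0])
  have "fps_nth Uf n = phi_scale m ?q * phi_coeff m n ?q" for n
  proof (induction n rule: less_induct)
    case (less n)
    show ?case
    proof (cases n)
      case 0
      have "fps_nth Uf 0 = of_nat m * euler_prod ?qm ^ 3 / (euler_prod ?q ^ 3) ^ m"
        unfolding Uf_def using Sm_nz
        by (simp add: fps_divide_unit fps_nth_power_0 S(2) Sm_def S'(2) divide_inverse)
      thus ?thesis by (simp add: 0 phi_scale_def qm power_mult)
    next
      case (Suc k)
      have "of_nat (Suc k) * fps_nth Uf (Suc k) = fps_nth (fps_X * fps_deriv Uf) (Suc k)"
        by (simp add: fps_X_mult_nth)
      also have "\<dots> = (\<Sum>i\<le>Suc k. fps_nth K i * fps_nth Uf (Suc k - i))"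
        unfolding ode fps_mult_nth by (simp add: atLeast0AtMost)
      also have "\<dots> = (\<Sum>i\<le>k. fps_nth K (Suc i) * fps_nth Uf (k - i))"
        by (subst sum.atMost_Suc_shift) (simp add: K0)
      also have "\<dots> = (\<Sum>i\<le>k. fps_nth K (Suc i) * (phi_scale m ?q * phi_coeff m (k - i) ?q))"
        by (intro sum.cong refl arg_cong2[of _ _ _ _ "(*)"] less.IH) (use Suc in auto)
      also have "\<dots> = phi_scale m ?q * (of_nat (Suc k) * phi_coeff m (Suc k) ?q)"
      proof -
        have "of_nat (Suc k) * phi_coeff m (Suc k) ?q = (\<Sum>i\<le>k. fps_nth K (Suc i) * phi_coeff m (k - i) ?q)"
          unfolding phi_coeff.simps Kn by (simp del: of_nat_Suc)
        thus ?thesis by (simp only: sum_distrib_left mult.left_commute[of "phi_scale m ?q"])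
      qed
      finally have "of_nat (Suc k) * fps_nth Uf (Suc k) = of_nat (Suc k) * (phi_scale m ?q * phi_coeff m (Suc k) ?q)"
        by (simp only: mult_ac)
      thus ?thesis unfolding Suc by (metis mult_left_cancel of_nat_neq_0)
    qed
  qed
  hence "Uf = Abs_fps (\<lambda>n. phi_scale m ?q * phi_coeff m n ?q)" by (simp add: fps_eq_iff)
  with Ufps Uphi show ?thesis using that by simp
qed

section \<open>Decomposition into derivatives of the Weierstrass function\<close>

lemma sum_lessThan_double:
  fixes f :: "nat \<Rightarrow> 'a::comm_monoid_add"
  shows "(\<Sum>i<2 * M. f i) = (\<Sum>j<M. f (2 * j) + f (2 * j + 1))"
  by (induction M) (simp_all add: add_ac)

text \<open>The pole of \<open>phi\<close> at \<open>0\<close> has order at most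
  \<open>m - 1\<close>, and by \<open>phi_coeff_odd\<close> only even powers of \<open>t\<close>
  occur in it. Subtracting multiples of the \<open>ell_p w (2 * k)\<close> removes it, and the rest
  is constant by \<open>elliptic_constant\<close>; the constant is computed as the limit at
  \<open>0\<close>.\<close>

theorem phi_partial_fractions:
  assumes w: "Re w < 0" and m: "odd m" and t: "t \<notin> period_lattice w"
  shows "phi m w t = phi_scale m (exp w) * (phi_const m (exp w) +
     (\<Sum>k<(m - 1) div 2. phi_coeff m (2 * ((m - 1) div 2 - Suc k)) (exp w) / fact (2 * k + 1) * ell_p w (2 * k) t))"
proof -
  define M where "M = (m - 1) div 2"
  have m0: "m > 0" using m by (cases m) auto
  have mM: "m - 1 = 2 * M" using m by (auto simp: M_def elim!: oddE)
  define u where "u = (\<lambda>n. phi_scale m (exp w) * phi_coeff m n (exp w))"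
  obtain U where U: "U has_fps_expansion Abs_fps u" "\<And>t. t \<noteq> 0 \<Longrightarrow> U t = phi m w t * t ^ (2 * M)"
    using phi_has_fps_expansion[OF w m0] unfolding u_def[symmetric] mM by blast
  \<comment> \<open>Truncating at order \<open>2 * M\<close> splits off the principal part of
    \<open>phi\<close>; the remainder divided by \<open>t ^ (2 * M)\<close> is continuous at
    \<open>0\<close> with value \<open>u (2 * M)\<close>.\<close>
  define F where "F = Abs_fps u - (\<Sum>i<2*M. fps_const (u i) * fps_X ^ i)"
  have F_nth: "fps_nth F j = (if j < 2 * M then 0 else u j)" for j
  proof -
    have "(\<Sum>i<2*M. u i * fps_nth (fps_X ^ i) j) = (\<Sum>i<2*M. if i = j then u i else 0)"
      by (intro sum.cong) auto
    thus ?thesis by (simp add: F_def fps_sum_nth)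
  qed
  have "(\<lambda>t. U t - (\<Sum>i<2*M. u i * t ^ i)) has_fps_expansion F"
    unfolding F_def by (intro fps_expansion_intros U(1))
  hence "(\<lambda>t. if t = 0 then u (2 * M) else (U t - (\<Sum>i<2*M. u i * t ^ i)) / t ^ (2 * M)) has_fps_expansion fps_shift (2 * M) F"
    by (rule has_fps_expansion_shift_le) (auto simp: F_nth)
  hence "isCont (\<lambda>t. if t = 0 then u (2 * M) else (U t - (\<Sum>i<2*M. u i * t ^ i)) / t ^ (2 * M)) 0"
    by (rule has_fps_expansion_imp_continuous)
  hence l1: "(\<lambda>t. if t = 0 then u (2 * M) else (U t - (\<Sum>i<2*M. u i * t ^ i)) / t ^ (2 * M)) \<midarrow>0\<rightarrow> u (2 * M)"
    by (simp add: isCont_def)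
  \<comment> \<open>The power \<open>t ^ (2 * k + 2)\<close> occurs in the denominator with
    coefficient \<open>u (2 * (M - Suc k))\<close> in \<open>phi\<close> and with coefficient
    \<open>fact (2 * k + 1)\<close> in \<open>ell_p w (2 * k)\<close>.\<close>
  define \<beta> where "\<beta> = (\<lambda>k. u (2 * (M - Suc k)) / fact (2 * k + 1))"
  define f where "f = (\<lambda>t. phi m w t - (\<Sum>k<M. \<beta> k * ell_p w (2 * k) t))"
  define A where "A = u (2 * M) - (\<Sum>k<M. \<beta> k * (- fact (2 * k + 1) * theta_ld_coeff (2 * k + 2) (exp w)))"
  have "(\<lambda>t. (if t = 0 then u (2 * M) else (U t - (\<Sum>i<2*M. u i * t ^ i)) / t ^ (2 * M)) -
      (\<Sum>k<M. \<beta> k * (ell_p w (2 * k) t - fact (2 * k + 1) / t ^ (2 * k + 2)))) \<midarrow>0\<rightarrow> A"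
    unfolding A_def by (intro tendsto_intros l1 tendsto_ell_p_minus_pole w)
  moreover have "\<forall>\<^sub>F t in at 0. (if t = 0 then u (2 * M) else (U t - (\<Sum>i<2*M. u i * t ^ i)) / t ^ (2 * M)) -
      (\<Sum>k<M. \<beta> k * (ell_p w (2 * k) t - fact (2 * k + 1) / t ^ (2 * k + 2))) = f t"
    using eventually_neq_at_within[of 0]
  proof eventually_elim
    case (elim t)
    have "(\<Sum>i<2*M. u i * t ^ i) = (\<Sum>j<M. u (2 * j) * t ^ (2 * j) + u (2 * j + 1) * t ^ (2 * j + 1))"
      by (rule sum_lessThan_double)
    also have "\<dots> = (\<Sum>j<M. u (2 * j) * t ^ (2 * j))"
      by (simp add: u_def phi_coeff_odd del: phi_coeff.simps)
    also have "\<dots> = (\<Sum>k<M. u (2 * (M - Suc k)) * t ^ (2 * (M - Suc k)))"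
      by (rule sum.nat_diff_reindex[symmetric])
    also have "\<dots> / t ^ (2 * M) = (\<Sum>k<M. \<beta> k * (fact (2 * k + 1) / t ^ (2 * k + 2)))"
      unfolding sum_divide_distrib
    proof (rule sum.cong)
      fix k assume "k \<in> {..<M}"
      hence "2 * M = 2 * (M - Suc k) + (2 * k + 2)" by auto
      hence "t ^ (2 * M) = t ^ (2 * (M - Suc k)) * t ^ (2 * k + 2)" by (metis power_add)
      thus "u (2 * (M - Suc k)) * t ^ (2 * (M - Suc k)) / t ^ (2 * M) = \<beta> k * (fact (2 * k + 1) / t ^ (2 * k + 2))"
        using elim by (simp add: \<beta>_def del: fact_Suc power_Suc)
    qed simp
    finally have s: "(\<Sum>i<2*M. u i * t ^ i) / t ^ (2 * M) = (\<Sum>k<M. \<beta> k * (fact (2 * k + 1) / t ^ (2 * k + 2)))" .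
    have "(if t = 0 then u (2 * M) else (U t - (\<Sum>i<2*M. u i * t ^ i)) / t ^ (2 * M)) =
        phi m w t - (\<Sum>k<M. \<beta> k * (fact (2 * k + 1) / t ^ (2 * k + 2)))"
      using elim U(2)[OF elim] by (simp add: diff_divide_distrib s)
    thus ?case by (simp only: f_def right_diff_distrib sum_subtractf) simp
  qed
  ultimately have lim: "f \<midarrow>0\<rightarrow> A" by (simp add: tendsto_cong)
  have "f t = A"
  proof (rule elliptic_constant[OF w _ _ _ lim t])
    show "f holomorphic_on - period_lattice w"
      unfolding f_def by (intro holomorphic_intros holomorphic_ell_p holomorphic_phi w m0)
  qed (simp_all add: f_def ell_p_periodic w phi_periodic m)
  moreover have "A = phi_scale m (exp w) * phi_const m (exp w)"
  proof -
    have "A = u (2 * M) + (\<Sum>k<M. u (2 * (M - Suc k)) * theta_ld_coeff (2 * Suc k) (exp w))"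
      by (simp add: A_def \<beta>_def sum_negf del: fact_Suc)
    \<comment> \<open>The isolated term \<open>u (2 * M)\<close> becomes the summand
      \<open>k = 0\<close>, because \<open>theta_ld_coeff 0\<close> is \<open>1\<close>.\<close>
    also have "\<dots> = (\<Sum>k\<le>M. u (2 * (M - k)) * theta_ld_coeff (2 * k) (exp w))"
      by (subst sum.atMost_shift) (simp add: theta_ld_coeff_def)
    finally show ?thesis by (simp add: phi_const_def M_def u_def sum_distrib_left mult_ac)
  qed
  ultimately have "phi m w t = phi_scale m (exp w) * phi_const m (exp w) + (\<Sum>k<M. \<beta> k * ell_p w (2 * k) t)"
    by (simp add: f_def algebra_simps)
  thus ?thesis unfolding \<beta>_def u_def M_def by (simp add: distrib_left sum_distrib_left mult_ac)
qed

text \<open>An odd number of derivatives of the right strip formula: the constant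
  \<open>1 / 2\<close> drops out, and the sign from differentiating at \<open>- t - w\<close> gives
  both Lambert series the same sign. Hence the symmetry under exchanging \<open>t\<close> and
  \<open>- t - w\<close>.\<close>

lemma ell_p_right_strip:
  assumes w: "Re w < 0" and t: "0 < Re t" "Re t < - Re w"
  shows "ell_p w (2 * k) t = lambert_pow (exp w) (2 * k + 1) t + lambert_pow (exp w) (2 * k + 1) (- t - w)"
proof -
  have q: "norm (exp w) < 1" using w by simp
  define S where "S = {t. 0 < Re t \<and> Re t < - Re w}"
  have S: "open S" unfolding S_def by (intro open_Collect_conj open_Collect_less continuous_intros)
  let ?M = "lambert_pow (exp w)"
  define f where "f = (\<lambda>n t. (if n = 0 then 1 / 2 else 0) - ?M n t + (- 1) ^ n * ?M n (- t - w))"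
  have "(deriv ^^ n) (theta_ld (exp w)) t = f n t" for n
  proof (rule higher_deriv_eqI[OF S])
    fix n t assume "t \<in> S"
    hence t: "0 < Re t" "Re t < - Re w" by (auto simp: S_def)
    have 1: "(?M n has_field_derivative ?M (Suc n) t) (at t)"
      by (rule has_field_derivative_lambert_pow[OF q]) (use t in \<open>simp add: mult_exp_exp\<close>)
    have "(?M n has_field_derivative ?M (Suc n) (- t - w)) (at (- t - w))"
      by (rule has_field_derivative_lambert_pow[OF q]) (use t in \<open>simp add: mult_exp_exp\<close>)
    hence "((\<lambda>t. ?M n (- t - w)) has_field_derivative ?M (Suc n) (- t - w) * (- 1)) (at t)"
      by (rule DERIV_chain2[where g = "\<lambda>t. - t - w"]) (auto intro!: derivative_eq_intros)
    from DERIV_add[OF DERIV_diff[OF DERIV_const[of "if n = 0 then 1 / 2 else 0"] 1] DERIV_cmult[OF this, of "(- 1) ^ n"]]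
    show "(f n has_field_derivative f (Suc n) t) (at t)" by (simp add: f_def)
  next
    fix t assume "t \<in> S"
    thus "theta_ld (exp w) t = f 0 t" using theta_ld_right_strip[OF w] by (simp add: f_def S_def)
  qed (use t in \<open>auto simp: S_def\<close>)
  from this[of "Suc (2 * k)"] show ?thesis by (simp add: ell_p_def f_def)
qed


section \<open>The value of the constant term at the cusp\<close>

text \<open>The theta constant summing \<open>(- 1) ^ n * x ^ n\<^sup>2\<close> over all integers,
  with \<open>n\<close> and \<open>- n - 1\<close> paired.\<close>

definition theta_null :: "complex \<Rightarrow> complex" where
  "theta_null x = (suminf (\<lambda>n. (- 1) ^ n * (x ^ n\<^sup>2 - x ^ (Suc n)\<^sup>2)))"

lemma theta_null_0: "theta_null 0 = 1"
proof -
  have "theta_null 0 = (\<Sum>n\<in>{0}. (- 1) ^ n * (0 ^ n\<^sup>2 - 0 ^ (Suc n)\<^sup>2))"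
    unfolding theta_null_def by (rule suminf_finite) (auto simp: power_0_left)
  thus ?thesis by simp
qed

lemma tendsto_theta_null: "theta_null \<midarrow>0\<rightarrow> 1"
proof -
  let ?a = "\<lambda>(n::nat) (x::complex). (- 1) ^ n * (x ^ n\<^sup>2 - x ^ (Suc n)\<^sup>2)"
  have bd: "norm (?a n x) \<le> 2 * (1 / 2) ^ n" if x: "norm x < 1 / 2" for n x
  proof -
    have le: "norm x ^ j \<le> (1 / 2) ^ n" if "n \<le> j" for j
    proof -
      have "norm x ^ j \<le> norm x ^ n" using that x by (intro power_decreasing) auto
      also have "\<dots> \<le> (1 / 2) ^ n" using x by (intro power_mono) auto
      finally show ?thesis .
    qed
    have sq: "n \<le> n\<^sup>2" "n \<le> (Suc n)\<^sup>2" by (auto simp: power2_eq_square)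
    have "norm (?a n x) = norm (x ^ n\<^sup>2 - x ^ (Suc n)\<^sup>2)" by (simp add: norm_mult norm_power)
    also have "\<dots> \<le> norm (x ^ n\<^sup>2) + norm (x ^ (Suc n)\<^sup>2)" by (rule norm_triangle_ineq4)
    also have "\<dots> \<le> (1 / 2) ^ n + (1 / 2) ^ n"
      unfolding norm_power by (intro add_mono le sq)
    finally show ?thesis by simp
  qed
  have ev: "\<forall>\<^sub>F x in at 0. norm (x::complex) < 1 / 2"
    using eventually_at_in_open[of "ball 0 (1/2)" "0::complex"] by (auto elim!: eventually_mono)
  have "\<forall>\<^sub>F (n, x) in at_top \<times>\<^sub>F at 0. norm (?a n x) \<le> 2 * (1 / 2) ^ n"
  proof -
    have "\<forall>\<^sub>F p in at_top \<times>\<^sub>F at 0. True \<and> norm (snd p :: complex) < 1 / 2"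
      by (rule eventually_prodI[OF _ ev, where P = "\<lambda>_. True"]) simp
    thus ?thesis
    proof (rule eventually_mono)
      fix p :: "nat \<times> complex" assume "True \<and> norm (snd p) < 1 / 2"
      thus "case p of (n, x) \<Rightarrow> norm (?a n x) \<le> 2 * (1 / 2) ^ n"
        using bd[of "snd p" "fst p"] by (simp add: case_prod_beta)
    qed
  qed
  moreover have "?a n \<midarrow>0\<rightarrow> ?a n 0" for n by (intro tendsto_intros)
  moreover have "summable (\<lambda>n. 2 * (1 / 2 :: real) ^ n)" by (intro summable_mult summable_geometric) auto
  ultimately have "(\<lambda>x. suminf (\<lambda>n. ?a n x)) \<midarrow>0\<rightarrow> suminf (\<lambda>n. ?a n 0)"
    using tannerys_theorem[of ?a "\<lambda>n. ?a n 0" "at 0" "\<lambda>n. 2 * (1 / 2) ^ n"] by auto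
  thus ?thesis using theta_null_0 unfolding theta_null_def[abs_def] by simp
qed

lemma theta_half_period:
  assumes w: "Re w < 0"
  shows "theta (exp w) (- w / 2) = exp (- w / 4) * theta_null (exp (w / 2))"
proof -
  \<comment> \<open>\<open>X\<close> is the square root of \<open>q\<close> that \<open>w\<close>
    singles out; at the half period all exponents of the theta series become integral in
    \<open>X\<close>.\<close>
  define X where "X = exp (w / 2)"
  have q: "norm (exp w) < 1" using w by simp
  have X: "exp w = X ^ 2" "exp (- w / 2) = inverse X" "X \<noteq> 0"
    by (simp_all add: X_def power2_eq_square mult_exp_exp exp_minus[symmetric])
  have "(- 1) ^ n * exp w ^ (Suc n choose 2) * (exp ((- w / 2) / 2) * exp (- w / 2) ^ n - exp (- (- w / 2) / 2) * exp (- (- w / 2)) ^ n)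
      = exp (- w / 4) * ((- 1) ^ n * (X ^ n\<^sup>2 - X ^ (Suc n)\<^sup>2))" for n
  proof -
    have c1: "exp w ^ (Suc n choose 2) = X ^ (n * Suc n)"
      unfolding X(1) power_mult[symmetric] two_mult_Suc_choose_two ..
    have c2: "exp (- (- w / 2) / 2) = exp (- w / 4) * X"
      by (simp add: X_def mult_exp_exp)
    have c3: "exp (- (- w / 2)) = X" by (simp add: X_def)
    have c4: "X ^ (n * Suc n) * inverse X ^ n = X ^ n\<^sup>2"
    proof -
      have "X ^ n * inverse X ^ n = 1" using X(3) by (simp add: power_mult_distrib[symmetric])
      moreover have "X ^ (n * Suc n) = X ^ n\<^sup>2 * X ^ n"
        by (simp add: power_add[symmetric] power2_eq_square add.commute)
      ultimately show ?thesis by (simp only: mult.assoc mult_1_right)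
    qed
    have c5: "X ^ (n * Suc n) * (X * X ^ n) = X ^ (Suc n)\<^sup>2"
    proof -
      have "n * Suc n + Suc n = (Suc n)\<^sup>2" by (simp add: power2_eq_square)
      thus ?thesis by (simp only: power_Suc[symmetric] power_add[symmetric])
    qed
    have c6: "exp ((- w / 2) / 2) = exp (- w / 4)" by simp
    have alg: "A * (s * B - (s * Y) * D) = s * (A * B - A * (Y * D))" for A B D s Y :: complex
      by (simp add: algebra_simps)
    have "exp w ^ (Suc n choose 2) * (exp ((- w / 2) / 2) * exp (- w / 2) ^ n - exp (- (- w / 2) / 2) * exp (- (- w / 2)) ^ n)
      = exp (- w / 4) * (X ^ n\<^sup>2 - X ^ (Suc n)\<^sup>2)"
      unfolding c1 c2 c3 c6 X(2) alg c4 c5 ..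
    thus ?thesis by (simp add: mult_ac)
  qed
  hence sums: "(\<lambda>n. exp (- w / 4) * ((- 1) ^ n * (X ^ n\<^sup>2 - X ^ (Suc n)\<^sup>2))) sums theta (exp w) (- w / 2)"
    using theta_sums[OF q, of "- w / 2"] by (simp only:)
  hence "(\<lambda>n. (- 1) ^ n * (X ^ n\<^sup>2 - X ^ (Suc n)\<^sup>2)) sums (theta (exp w) (- w / 2) / exp (- w / 4))"
    using sums_divide[OF sums, of "exp (- w / 4)"] by simp
  hence "theta_null X = theta (exp w) (- w / 2) / exp (- w / 4)"
    by (simp add: theta_null_def sums_iff)
  thus ?thesis by (simp add: X_def)
qed

definition lambert_series :: "nat \<Rightarrow> complex \<Rightarrow> complex" where
  "lambert_series r x = (suminf (\<lambda>n. of_nat (Suc n) ^ r * (x ^ Suc n / (1 - x ^ Suc n))))"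

lemma tendsto_lambert_series_0: "lambert_series r \<midarrow>0\<rightarrow> 0"
proof -
  have "continuous_on (ball 0 1) (lambert_series r)"
    unfolding lambert_series_def[abs_def]
    by (intro holomorphic_on_imp_continuous_on holomorphic_lambert poly_bounded_power)
  hence "isCont (lambert_series r) 0" by (simp add: continuous_on_eq_continuous_at)
  thus ?thesis by (simp add: isCont_def lambert_series_def)
qed

text \<open>With \<open>X = exp (w / 2)\<close> and \<open>y = X ^ n\<close>, the term
  \<open>y ^ 2 / (1 - y ^ 2)\<close> is multiplied by \<open>exp (- w / 2) ^ n = 1 / y\<close>, and
  \<open>y / (1 - y ^ 2) = y / (1 - y) - y ^ 2 / (1 - y ^ 2)\<close>.\<close>

lemma lambert_pow_half_period:
  assumes w: "Re w < 0"
  shows "lambert_pow (exp w) r (- w / 2) = lambert_series r (exp (w / 2)) - lambert_series r (exp w)"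
proof -
  define X where "X = exp (w / 2)"
  have X: "norm X < 1" "X \<noteq> 0" "exp w = X ^ 2" "exp (- w / 2) = inverse X"
    using w by (simp_all add: X_def power2_eq_square mult_exp_exp exp_minus[symmetric])
  have s: "summable (\<lambda>n. of_nat (Suc n) ^ r * (y ^ Suc n / (1 - y ^ Suc n)))" if "norm y < 1" for y :: complex
    using summable_norm_cancel[OF lambert_summable[OF that, of 1 "\<lambda>n. of_nat (Suc n) ^ r"]] that
    by (simp add: poly_bounded_power del: of_nat_Suc power_Suc)
  have X2: "norm (X ^ 2) < 1" using X(1) by (simp add: norm_power power_less_one_iff)
  have "lambert_series r X - lambert_series r (X ^ 2) =
      (suminf (\<lambda>n. of_nat (Suc n) ^ r * (X ^ Suc n / (1 - X ^ Suc n)) - of_nat (Suc n) ^ r * ((X ^ 2) ^ Suc n / (1 - (X ^ 2) ^ Suc n))))"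
    unfolding lambert_series_def by (rule suminf_diff[OF s[OF X(1)] s[OF X2]])
  also have "\<dots> = (suminf (\<lambda>n. of_nat (Suc n) ^ r * ((X ^ 2) ^ Suc n / (1 - (X ^ 2) ^ Suc n)) * (inverse X) ^ Suc n))"
  proof (rule suminf_cong)
    fix n
    define y where "y = X ^ Suc n"
    have y: "(X ^ 2) ^ Suc n = y ^ 2" "inverse X ^ Suc n = inverse y" "y \<noteq> 0"
      using X(2) by (simp_all only: y_def power_mult[symmetric] mult.commute[of 2] power_inverse power_not_zero not_False_eq_True)
    have "1 - y \<noteq> 0" "1 - y ^ 2 \<noteq> 0"
      using one_minus_power_nonzero[OF X(1), of n] one_minus_power_nonzero[OF X2, of n]
      unfolding y(1) by (simp_all add: y_def)
    hence "y / (1 - y) - y ^ 2 / (1 - y ^ 2) = y ^ 2 / (1 - y ^ 2) * inverse y"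
      using y(3) by (simp add: divide_simps) (simp add: algebra_simps power2_eq_square)
    thus "of_nat (Suc n) ^ r * (X ^ Suc n / (1 - X ^ Suc n)) - of_nat (Suc n) ^ r * ((X ^ 2) ^ Suc n / (1 - (X ^ 2) ^ Suc n))
       = of_nat (Suc n) ^ r * ((X ^ 2) ^ Suc n / (1 - (X ^ 2) ^ Suc n)) * inverse X ^ Suc n"
      unfolding y y_def[symmetric] right_diff_distrib[symmetric] by (simp only: mult.assoc)
  qed
  finally show ?thesis by (simp only: lambert_exp_def X(3,4) X_def[symmetric])
qed

text \<open>At the half period \<open>t = - w / 2\<close> the \<open>ell_p w (2 * k)\<close> vanish in the limit \<open>q \<rightarrow> 0\<close>, and
  \<open>phi\<close> is a quotient of theta constants tending to \<open>1\<close>.\<close>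

lemma phi_const_0:
  assumes m: "odd m"
  shows "phi_const m 0 = 1"
proof -
  define M where "M = (m - 1) div 2"
  have m0: "m > 0" using m by (cases m) auto
  \<comment> \<open>\<open>R\<close> and the \<open>B k\<close> are holomorphic at the cusp, so
    their limits along \<open>q = x ^ 2\<close> are their values at \<open>0\<close>.\<close>
  define R where "R = (\<lambda>q. phi_scale m q * phi_const m q)"
  define B where "B = (\<lambda>k q. phi_scale m q * phi_coeff m (2 * (M - Suc k)) q / fact (2 * k + 1))"
  have scale_hol: "phi_scale m holomorphic_on ball 0 1"
    unfolding phi_scale_def[abs_def]
    by (intro holomorphic_intros holomorphic_euler_prod
          holomorphic_on_compose_gen[OF _ holomorphic_euler_prod, unfolded o_def])
       (use m0 in \<open>auto simp: norm_power power_less_one_iff\<close>)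
  have cont: "f \<midarrow>0\<rightarrow> f 0" if "f holomorphic_on ball 0 1" for f :: "complex \<Rightarrow> complex"
    using holomorphic_on_imp_continuous_on[OF that] by (simp add: continuous_on_eq_continuous_at isCont_def)
  have "R holomorphic_on ball 0 1" "B k holomorphic_on ball 0 1" for k
    unfolding R_def B_def phi_const_def
    by (intro holomorphic_intros scale_hol holomorphic_phi_coeff m0 holomorphic_theta_ld_coeff; simp)+
  note lims = this[THEN cont]
  have sq: "filterlim (\<lambda>x::complex. x ^ 2) (at 0) (at 0)"
    unfolding filterlim_at by (auto intro!: tendsto_eq_intros simp: eventually_at_filter)
  have pm: "filterlim (\<lambda>x::complex. x ^ m) (at 0) (at 0)"
    unfolding filterlim_at using m0 by (auto intro!: tendsto_eq_intros simp: eventually_at_filter)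
  have eq: "theta_null (x ^ m) / theta_null x ^ m = R (x ^ 2) +
     (\<Sum>k<M. B k (x ^ 2) * (2 * (lambert_series (2 * k + 1) x - lambert_series (2 * k + 1) (x ^ 2))))"
    if x: "x \<noteq> 0" "norm x < 1" for x
  proof -
    \<comment> \<open>The half period involves \<open>exp (w / 2)\<close>, a square root of
      \<open>q\<close>. Taking that root \<open>x\<close> as the variable keeps the identity
      single-valued on the punctured disc.\<close>
    define w where "w = 2 * Ln x"
    have w: "Re w < 0" using x by (simp add: w_def Re_Ln)
    have X: "exp (w / 2) = x" "exp w = x ^ 2"
      using x by (simp_all add: w_def exp_double)
    have mw: "Re (of_nat m * w) < 0" using w m0 by (simp add: mult_less_0_iff)
    have strip: "0 < Re (- w / 2)" "Re (- w / 2) < - Re w" using w by auto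
    have notin: "- w / 2 \<notin> period_lattice w" by (rule right_strip_not_in_period_lattice[OF w strip])
    have "phi m w (- w / 2) = theta_null (x ^ m) / theta_null x ^ m"
    proof -
      have a: "of_nat m * (- w / 2) = - (of_nat m * w) / 2" by simp
      have b: "exp (- (of_nat m * w) / 4) = exp (- w / 4) ^ m"
        by (simp add: exp_of_nat_mult[symmetric])
      have c: "exp (of_nat m * w / 2) = x ^ m"
        unfolding X(1)[symmetric] by (simp add: exp_of_nat_mult[symmetric])
      show ?thesis
        unfolding phi_def a theta_half_period[OF mw] theta_half_period[OF w] b c X(1)
        by (simp add: power_mult_distrib)
    qed
    moreover have "ell_p w (2 * k) (- w / 2) = 2 * (lambert_series (2 * k + 1) x - lambert_series (2 * k + 1) (x ^ 2))" for k
    proof -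
      have e: "- (- w / 2) - w = - w / 2" by simp
      show ?thesis unfolding ell_p_right_strip[OF w strip] e lambert_pow_half_period[OF w]
        unfolding X by (rule mult_2[symmetric])
    qed
    ultimately show ?thesis
      using phi_partial_fractions[OF w m notin]
      by (simp add: X R_def B_def M_def distrib_left sum_distrib_left mult_ac)
  qed
  have l1: "(\<lambda>x. R (x ^ 2) + (\<Sum>k<M. B k (x ^ 2) * (2 * (lambert_series (2 * k + 1) x - lambert_series (2 * k + 1) (x ^ 2)))))
      \<midarrow>0\<rightarrow> R 0 + (\<Sum>k<M. B k 0 * (2 * (0 - 0)))"
    by (intro tendsto_intros filterlim_compose[OF lims(1) sq] filterlim_compose[OF lims(2) sq]
          tendsto_lambert_series_0 filterlim_compose[OF tendsto_lambert_series_0 sq])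
  have l2: "(\<lambda>x. theta_null (x ^ m) / theta_null x ^ m) \<midarrow>0\<rightarrow> 1 / 1 ^ m"
    by (intro tendsto_intros tendsto_theta_null filterlim_compose[OF tendsto_theta_null pm]) auto
  have ev: "\<forall>\<^sub>F x in at 0. theta_null (x ^ m) / theta_null x ^ m = R (x ^ 2) +
     (\<Sum>k<M. B k (x ^ 2) * (2 * (lambert_series (2 * k + 1) x - lambert_series (2 * k + 1) (x ^ 2))))"
  proof -
    have "\<forall>\<^sub>F x in at 0. x \<in> ball 0 1 - {0::complex}" by (rule eventually_at_in_open) auto
    thus ?thesis by eventually_elim (rule eq, auto)
  qed
  have "R 0 = 1"
    using LIM_unique[OF l1 l2[unfolded tendsto_cong[OF ev]]] by simp
  thus ?thesis using m0 by (simp add: R_def phi_scale_def zero_power)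
qed


section \<open>Laurent expansions\<close>

text \<open>Needed because \<open>constant_term\<close> is defined by \<open>THE\<close>. The
  difference of the two expansions, divided by the \<open>j\<close>-th power of zeta, is integrated
  over one period of a horizontal line inside the strip: only the term of index \<open>j\<close>
  survives, and the total is \<open>0\<close>.\<close>

lemma laurent_expansion_unique:
  assumes \<tau>: "Im \<tau> > 0" and a: "laurent_expansion \<tau> f a" and b: "laurent_expansion \<tau> f b"
  shows "a = b"
proof
  fix j :: int
  define y where "y = - Im \<tau> / 2"
  define d where "d = (\<lambda>n. a n - b n)"
  define Z where "Z = (\<lambda>x::real. of_real x + \<i> * of_real y)"
  define h where "h = (\<lambda>(n::int) x. d n * exp (two_pi_i * of_int (n - j) * Z x))"
  have hs: "((\<lambda>n. h n x) has_sum 0) UNIV" for x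
  proof -
    have z: "- Im \<tau> < Im (Z x)" "Im (Z x) < 0" using \<tau> by (simp_all add: Z_def y_def)
    let ?e = "exp (two_pi_i * Z x)"
    have "((\<lambda>n. a n * ?e powi n + - (b n * ?e powi n)) has_sum (f (Z x) + - f (Z x))) UNIV"
      using a b z unfolding laurent_expansion_def by (intro has_sum_add has_sum_uminusI) auto
    from has_sum_cmult_left[OF this, of "inverse ?e powi j"]
    have "((\<lambda>n. (a n * ?e powi n - b n * ?e powi n) * inverse ?e powi j) has_sum 0) UNIV" by simp
    moreover have "(a n * ?e powi n - b n * ?e powi n) * inverse ?e powi j = h n x" for n
    proof -
      have "?e powi n * inverse ?e powi j = ?e powi (n - j)"
        by (simp add: power_int_diff power_int_inverse divide_inverse)
      also have "\<dots> = exp (two_pi_i * of_int (n - j) * Z x)"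
        by (simp add: exp_power_int mult_ac)
      finally have "?e powi n * inverse ?e powi j = exp (two_pi_i * of_int (n - j) * Z x)" .
      moreover have "(a n * ?e powi n - b n * ?e powi n) * inverse ?e powi j = d n * (?e powi n * inverse ?e powi j)"
        by (simp add: d_def algebra_simps)
      ultimately show ?thesis by (simp only: h_def)
    qed
    ultimately show ?thesis by simp
  qed
  have norm_h: "norm (h n x) = norm (h n 0)" for n x
    by (simp add: h_def norm_mult Z_def)
  \<comment> \<open>On the horizontal line each term has constant norm, so absolute summability at
    the single point \<open>x = 0\<close> is a majorant for the whole interval.\<close>
  have ul: "uniform_limit {0..1} (\<lambda>X x. \<Sum>n\<in>X. h n x) (\<lambda>_. 0) (finite_subsets_at_top UNIV)"
  proof (rule Weierstrass_m_test_general')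
    show "norm (h n x) \<le> norm (h n 0)" for n x by (rule eq_refl[OF norm_h])
    show "(\<lambda>n. norm (h n 0)) summable_on UNIV"
      using hs[of 0] by (metis has_sum_imp_summable summable_on_iff_abs_summable_on_complex)
  qed (rule hs)
  have cont: "continuous_on {0..1} (\<lambda>x. \<Sum>n\<in>X. h n x)" for X
    unfolding h_def Z_def by (intro continuous_intros)
  obtain I J where I: "\<And>X. ((\<lambda>x. \<Sum>n\<in>X. h n x) has_integral I X) {0..1}"
    and J: "((\<lambda>_::real. 0 :: complex) has_integral J) {0..1}" and IJ: "(I \<longlongrightarrow> J) (finite_subsets_at_top UNIV)"
    using uniform_limit_integral[OF ul cont finite_subsets_at_top_neq_bot] by blast
  have J0: "J = 0" using J has_integral_is_0_cbox by (metis has_integral_0_eq)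
  have hn: "(h n has_integral (if n = j then d j else 0)) {0..1}" for n
  proof (cases "n = j")
    case True
    thus ?thesis using has_integral_const_real[of "d j" 0 1] by (simp add: h_def[abs_def])
  next
    case False
    define c where "c = two_pi_i * of_int (n - j)"
    have c: "c \<noteq> 0" using False by (simp add: c_def)
    have "((\<lambda>x. d n * exp (c * Z x)) has_integral (d n * exp (c * Z 1) / c - d n * exp (c * Z 0) / c)) {0..1}"
    proof (rule fundamental_theorem_of_calculus)
      fix x :: real
      have "((\<lambda>u. d n * exp (c * (u + \<i> * of_real y)) / c) has_field_derivative d n * exp (c * Z x)) (at (of_real x))"
        using c by (auto intro!: derivative_eq_intros simp: Z_def)
      from has_vector_derivative_real_field[OF this]
      show "((\<lambda>x. d n * exp (c * Z x) / c) has_vector_derivative d n * exp (c * Z x)) (at x within {0..1})"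
        by (simp add: Z_def)
    qed simp
    moreover have "exp (c * Z 1) = exp (c * Z 0)"
    proof -
      have "c * Z 1 = c * Z 0 + of_int (n - j) * two_pi_i" by (simp add: Z_def c_def algebra_simps)
      moreover have "exp (of_int k * two_pi_i) = 1" for k
        by (auto simp: exp_eq_1 mult_ac)
      ultimately show ?thesis by (simp only: exp_add mult_1_right)
    qed
    ultimately show ?thesis using False by (simp add: h_def[abs_def] c_def)
  qed
  have "\<forall>\<^sub>F X in finite_subsets_at_top UNIV. I X = d j"
    unfolding eventually_finite_subsets_at_top
  proof (intro exI[of _ "{j}"] conjI allI impI)
    fix X :: "int set" assume X: "finite X \<and> {j} \<subseteq> X \<and> X \<subseteq> UNIV"
    have "((\<lambda>x. \<Sum>n\<in>X. h n x) has_integral (\<Sum>n\<in>X. if n = j then d j else 0)) {0..1}"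
      using X by (intro has_integral_sum hn) auto
    moreover have "(\<Sum>n\<in>X. if n = j then d j else 0) = d j" using X by simp
    ultimately show "I X = d j" using I[of X] has_integral_unique by metis
  qed auto
  hence "(I \<longlongrightarrow> d j) (finite_subsets_at_top UNIV)" by (simp add: tendsto_cong)
  hence "d j = J" using IJ tendsto_unique finite_subsets_at_top_neq_bot by metis
  thus "a j = b j" using J0 by (simp add: d_def)
qed

lemma constant_term_eqI:
  assumes "Im \<tau> > 0" "laurent_expansion \<tau> f a"
  shows "constant_term \<tau> f = a 0"
proof -
  have "(THE a. laurent_expansion \<tau> f a) = a"
    using assms laurent_expansion_unique by (intro the_equality) auto
  thus ?thesis by (simp add: constant_term_def)
qed

section \<open>Laurent coefficients on the annulus\<close>

text \<open>Positive and negative indices come from the Lambert series at \<open>t\<close> and at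
  \<open>- t - w\<close>; in the latter \<open>q ^ n * exp (- w) ^ n = 1\<close> turns the numerator
  into \<open>1\<close>. The value \<open>0\<close> at \<open>n = 0\<close> is what identifies the
  constant of the partial fractions with the constant term.\<close>

definition ell_p_laurent :: "complex \<Rightarrow> nat \<Rightarrow> int \<Rightarrow> complex" where
  "ell_p_laurent q k n = (if n = 0 then 0 else
     of_nat (nat \<bar>n\<bar>) ^ (2 * k + 1) * ((if n > 0 then q ^ nat \<bar>n\<bar> else 1) / (1 - q ^ nat \<bar>n\<bar>)))"

lemma ell_p_has_sum:
  assumes w: "Re w < 0" and t: "0 < Re t" "Re t < - Re w"
  shows "((\<lambda>n. ell_p_laurent (exp w) k n * exp t powi n) has_sum ell_p w (2 * k) t) UNIV"
proof -
  let ?f = "\<lambda>n. ell_p_laurent (exp w) k n * exp t powi n"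
  have q: "norm (exp w) < 1" using w by simp
  have hs: "((\<lambda>n. of_nat (Suc n) ^ (2 * k + 1) * (exp w ^ Suc n / (1 - exp w ^ Suc n)) * exp u ^ Suc n) has_sum
      lambert_pow (exp w) (2 * k + 1) u) UNIV" if "norm (exp w * exp u) < 1" for u
    unfolding lambert_exp_def
    by (rule norm_summable_imp_has_sum[OF lambert_summable[OF q that poly_bounded_power]
          summable_sums[OF summable_norm_cancel[OF lambert_summable[OF q that poly_bounded_power]]]])
  have "((\<lambda>n. ?f (int (Suc n))) has_sum lambert_pow (exp w) (2 * k + 1) t) UNIV"
  proof -
    have "?f (int (Suc n)) = of_nat (Suc n) ^ (2 * k + 1) * (exp w ^ Suc n / (1 - exp w ^ Suc n)) * exp t ^ Suc n" for n
    proof -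
      have "nat \<bar>int (Suc n)\<bar> = Suc n" "int (Suc n) > 0" "int (Suc n) \<noteq> 0" by auto
      thus ?thesis by (simp only: ell_p_laurent_def power_int_of_nat if_True if_False)
    qed
    thus ?thesis using hs[of t] t by (simp add: mult_exp_exp del: of_nat_Suc power_Suc)
  qed
  hence 1: "(?f has_sum lambert_pow (exp w) (2 * k + 1) t) (range (\<lambda>n. int (Suc n)))"
    by (subst has_sum_reindex) (auto simp: o_def inj_on_def)
  have "((\<lambda>n. ?f (- int (Suc n))) has_sum lambert_pow (exp w) (2 * k + 1) (- t - w)) UNIV"
  proof -
    have "?f (- int (Suc n)) = of_nat (Suc n) ^ (2 * k + 1) * (exp w ^ Suc n / (1 - exp w ^ Suc n)) * exp (- t - w) ^ Suc n" for n
    proof -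
      have "nat \<bar>- int (Suc n)\<bar> = Suc n" "\<not> - int (Suc n) > 0" "- int (Suc n) \<noteq> 0" by auto
      hence "?f (- int (Suc n)) = of_nat (Suc n) ^ (2 * k + 1) * (1 / (1 - exp w ^ Suc n)) * inverse (exp t ^ Suc n)"
        by (simp only: ell_p_laurent_def power_int_minus power_int_of_nat if_False)
      also have "inverse (exp t ^ Suc n) = exp w ^ Suc n * exp (- t - w) ^ Suc n"
        unfolding power_mult_distrib[symmetric] power_inverse[symmetric] mult_exp_exp by (simp add: exp_minus)
      finally show ?thesis by (simp del: of_nat_Suc power_Suc)
    qed
    thus ?thesis using hs[of "- t - w"] t by (simp add: mult_exp_exp del: of_nat_Suc power_Suc)
  qed
  hence 2: "(?f has_sum lambert_pow (exp w) (2 * k + 1) (- t - w)) (range (\<lambda>n. - int (Suc n)))"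
    by (subst has_sum_reindex) (auto simp: o_def inj_on_def)
  have "(?f has_sum (lambert_pow (exp w) (2 * k + 1) t + lambert_pow (exp w) (2 * k + 1) (- t - w)))
      (range (\<lambda>n. int (Suc n)) \<union> range (\<lambda>n. - int (Suc n)))"
    by (rule has_sum_Un_disjoint[OF 1 2]) auto
  moreover have "0 \<notin> range (\<lambda>n. int (Suc n)) \<union> range (\<lambda>n. - int (Suc n))" by auto
  ultimately have "(?f has_sum (?f 0 + (lambert_pow (exp w) (2 * k + 1) t + lambert_pow (exp w) (2 * k + 1) (- t - w))))
      (insert 0 (range (\<lambda>n. int (Suc n)) \<union> range (\<lambda>n. - int (Suc n))))"
    by (intro has_sum_insert)
  moreover have "?f 0 = 0" by (simp add: ell_p_laurent_def)
  ultimately have "(?f has_sum ell_p w (2 * k) t) (insert 0 (range (\<lambda>n. int (Suc n)) \<union> range (\<lambda>n. - int (Suc n))))"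
    unfolding ell_p_right_strip[OF w t] by (simp only: add_0_left)
  moreover have "insert 0 (range (\<lambda>n. int (Suc n)) \<union> range (\<lambda>n. - int (Suc n))) = UNIV"
  proof -
    have "n \<in> insert 0 (range (\<lambda>n. int (Suc n)) \<union> range (\<lambda>n. - int (Suc n)))" for n
    proof (cases n rule: int_cases3)
      case (pos k)
      hence "n = int (Suc (k - 1))" by simp
      thus ?thesis by blast
    next
      case (neg k)
      hence "n = - int (Suc (k - 1))" by simp
      thus ?thesis by blast
    qed simp
    thus ?thesis by blast
  qed
  ultimately show ?thesis by simp
qed

lemma has_sum_finite_sum:
  fixes f :: "'i \<Rightarrow> 'a \<Rightarrow> 'b::topological_comm_monoid_add"
  assumes "finite K" "\<And>k. k \<in> K \<Longrightarrow> (f k has_sum s k) A"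
  shows "((\<lambda>n. \<Sum>k\<in>K. f k n) has_sum (\<Sum>k\<in>K. s k)) A"
  using assms by (induction K) (auto intro!: has_sum_add)

lemma phi_has_sum:
  assumes w: "Re w < 0" and m: "odd m" and t: "0 < Re t" "Re t < - Re w"
  defines "M \<equiv> (m - 1) div 2"
  shows "((\<lambda>n. phi_scale m (exp w) * ((if n = 0 then phi_const m (exp w) else 0) +
     (\<Sum>k<M. phi_coeff m (2 * (M - Suc k)) (exp w) / fact (2 * k + 1) * ell_p_laurent (exp w) k n)) * exp t powi n)
     has_sum phi m w t) UNIV"
proof -
  have notin: "t \<notin> period_lattice w" by (rule right_strip_not_in_period_lattice[OF w t])
  have c: "((\<lambda>n. (if n = 0 then phi_const m (exp w) else 0) * exp t powi n) has_sum phi_const m (exp w)) UNIV"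
    by (rule has_sum_finite_neutralI[of "{0}"]) auto
  have "((\<lambda>n. phi_scale m (exp w) * ((if n = 0 then phi_const m (exp w) else 0) * exp t powi n +
     (\<Sum>k<M. phi_coeff m (2 * (M - Suc k)) (exp w) / fact (2 * k + 1) * (ell_p_laurent (exp w) k n * exp t powi n))))
     has_sum phi_scale m (exp w) * (phi_const m (exp w) +
     (\<Sum>k<M. phi_coeff m (2 * (M - Suc k)) (exp w) / fact (2 * k + 1) * ell_p w (2 * k) t))) UNIV"
    by (intro has_sum_cmult_right has_sum_add c has_sum_finite_sum ell_p_has_sum w t) auto
  also have "phi_scale m (exp w) * (phi_const m (exp w) +
     (\<Sum>k<M. phi_coeff m (2 * (M - Suc k)) (exp w) / fact (2 * k + 1) * ell_p w (2 * k) t)) = phi m w t"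
    unfolding M_def by (rule phi_partial_fractions[OF w m notin, symmetric])
  also have "(\<lambda>n. phi_scale m (exp w) * ((if n = 0 then phi_const m (exp w) else 0) * exp t powi n +
     (\<Sum>k<M. phi_coeff m (2 * (M - Suc k)) (exp w) / fact (2 * k + 1) * (ell_p_laurent (exp w) k n * exp t powi n)))) =
     (\<lambda>n. phi_scale m (exp w) * ((if n = 0 then phi_const m (exp w) else 0) +
     (\<Sum>k<M. phi_coeff m (2 * (M - Suc k)) (exp w) / fact (2 * k + 1) * ell_p_laurent (exp w) k n)) * exp t powi n)"
    by (simp only: distrib_right sum_distrib_right mult.assoc)
  finally show ?thesis .
qed

section \<open>The constant term as an eta quotient\<close>

lemma dedekind_eta_eq:
  assumes "Im \<tau> > 0"
  shows "dedekind_eta \<tau> = qpow \<tau> (1/24) * euler_prod (nome \<tau>)"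
proof -
  have "norm (qpow \<tau> 1) < 1" using assms by (simp add: qpow_def)
  thus ?thesis by (simp add: dedekind_eta_def prodinf_euler_prod qpow_def del: power_Suc)
qed

lemma qpow_power: "qpow \<tau> a ^ n = qpow \<tau> (of_nat n * a)"
  by (simp add: qpow_def exp_of_nat_mult[symmetric] mult_ac)

text \<open>The prefactors \<open>exp (m w / 8)\<close> and \<open>exp (w / 8) ^ m\<close> of the
  theta functions cancel, so only \<open>\<i> / \<i> ^ m\<close> remains.\<close>

lemma F_scaled_eq_phi:
  assumes \<tau>: "Im \<tau> > 0" and m: "m > 0"
  shows "F_scaled e m \<tau> z = e * (\<i> / \<i> ^ m) * dedekind_eta \<tau> ^ (m + 1) * phi m (two_pi_i * \<tau>) (two_pi_i * z)"
proof -
  define w t where "w = two_pi_i * \<tau>" and "t = two_pi_i * z"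
  have mw: "two_pi_i * (of_nat m * \<tau>) = of_nat m * w" "two_pi_i * (of_nat m * z) = of_nat m * t"
    by (simp_all add: w_def t_def)
  have "Im (of_nat m * \<tau>) > 0" using assms by simp
  note jv = jacobi_vartheta_eq_theta[OF this, of "of_nat m * z"] jacobi_vartheta_eq_theta[OF \<tau>, of z]
  have e: "exp (of_nat m * w / 8) = exp (w / 8) ^ m"
    by (simp add: exp_of_nat_mult[symmetric])
  show ?thesis
    unfolding F_scaled_def jv mw w_def[symmetric] t_def[symmetric] phi_def e power_mult_distrib
    by simp
qed

text \<open>The factor \<open>dedekind_eta \<tau> ^ (m + 1)\<close> cancels \<open>m + 1\<close> of
  the \<open>3 * m\<close> Euler products in the denominator of \<open>phi_scale\<close>, which
  leaves \<open>2 * m - 1\<close>. The powers of \<open>q\<close> fit by the same count: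
  \<open>3 * m - (2 * m - 1) = m + 1\<close>, in units of \<open>1/24\<close>.\<close>

theorem constant_term_F_scaled:
  assumes \<tau>: "Im \<tau> > 0" and m: "odd m"
  shows "constant_term \<tau> (F_scaled e m \<tau>) = e * (\<i> / \<i> ^ m) *
    (dedekind_eta (of_nat m * \<tau>) ^ 3 / dedekind_eta \<tau> ^ (2 * m - 1) * phi_const m (nome \<tau>))"
    and "dedekind_eta (of_nat m * \<tau>) ^ 3 / dedekind_eta \<tau> ^ (2 * m - 1) =
      qpow \<tau> ((real m + 1) / 24) * (euler_prod (nome \<tau> ^ m) ^ 3 / euler_prod (nome \<tau>) ^ (2 * m - 1))"
proof -
  define w where "w = two_pi_i * \<tau>"
  have m0: "m > 0" using m by (cases m) auto
  have w: "Re w < 0" using \<tau> by (simp add: w_def)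
  define M where "M = (m - 1) div 2"
  define C where "C = e * (\<i> / \<i> ^ m) * dedekind_eta \<tau> ^ (m + 1)"
  define a where "a = (\<lambda>n. C * (phi_scale m (exp w) * ((if n = 0 then phi_const m (exp w) else 0) +
     (\<Sum>k<M. phi_coeff m (2 * (M - Suc k)) (exp w) / fact (2 * k + 1) * ell_p_laurent (exp w) k n))))"
  have "laurent_expansion \<tau> (F_scaled e m \<tau>) a"
    unfolding laurent_expansion_def
  proof (intro allI impI)
    fix z assume z: "- Im \<tau> < Im z \<and> Im z < 0"
    have "Re (two_pi_i * z) > 0" "Re (two_pi_i * z) < - Re w"
      using z mult_strict_left_mono[of "- Im z" "Im \<tau>" "2 * pi"] by (simp_all add: w_def mult_less_0_iff)
    from has_sum_cmult_right[OF phi_has_sum[OF w m this], of C]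
    show "((\<lambda>n. a n * exp (two_pi_i * z) powi n) has_sum F_scaled e m \<tau> z) UNIV"
      unfolding F_scaled_eq_phi[OF \<tau> m0] a_def C_def w_def M_def by (simp only: mult.assoc)
  qed
  from constant_term_eqI[OF \<tau> this]
  have ct: "constant_term \<tau> (F_scaled e m \<tau>) = C * (phi_scale m (exp w) * phi_const m (exp w))"
    by (simp add: a_def ell_p_laurent_def)
  have eta: "dedekind_eta \<tau> = qpow \<tau> (1/24) * euler_prod (exp w)"
    unfolding w_def by (rule dedekind_eta_eq[OF \<tau>])
  have "Im (of_nat m * \<tau>) > 0" using \<tau> m0 by simp
  hence etam: "dedekind_eta (of_nat m * \<tau>) = qpow (of_nat m * \<tau>) (1/24) * euler_prod (exp w ^ m)"
    unfolding w_def exp_of_nat_mult[symmetric] by (subst dedekind_eta_eq) (simp_all add: mult_ac)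
  have e1: "qpow (of_nat m * \<tau>) (1/24) ^ 3 = qpow \<tau> (1/24) ^ (m + 1) * qpow \<tau> (1/24) ^ (2 * m - 1)"
  proof -
    have "(m + 1) + (2 * m - 1) = 3 * m" using m0 by simp
    thus ?thesis unfolding power_add[symmetric]
      by (simp add: qpow_def exp_of_nat_mult[symmetric] mult_ac)
  qed
  have nz: "qpow \<tau> (1/24) \<noteq> 0" by (simp add: qpow_def)
  show "constant_term \<tau> (F_scaled e m \<tau>) = e * (\<i> / \<i> ^ m) *
    (dedekind_eta (of_nat m * \<tau>) ^ 3 / dedekind_eta \<tau> ^ (2 * m - 1) * phi_const m (nome \<tau>))"
  proof -
    have "3 * m = (m + 1) + (2 * m - 1)" using m0 by simp
    hence "euler_prod (exp w) ^ (3 * m) = euler_prod (exp w) ^ (m + 1) * euler_prod (exp w) ^ (2 * m - 1)"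
      by (simp only: power_add)
    hence "dedekind_eta \<tau> ^ (m + 1) * phi_scale m (exp w) = dedekind_eta (of_nat m * \<tau>) ^ 3 / dedekind_eta \<tau> ^ (2 * m - 1)"
      unfolding phi_scale_def eta etam power_mult_distrib e1 using nz by (simp add: field_simps del: power_Suc)
    thus ?thesis unfolding ct C_def w_def[symmetric] by (simp add: mult.assoc[symmetric]) (simp add: mult_ac)
  qed
  have "qpow \<tau> (1/24) ^ (m + 1) = qpow \<tau> ((real m + 1) / 24)"
    unfolding qpow_power by (simp add: field_simps)
  thus "dedekind_eta (of_nat m * \<tau>) ^ 3 / dedekind_eta \<tau> ^ (2 * m - 1) =
      qpow \<tau> ((real m + 1) / 24) * (euler_prod (nome \<tau> ^ m) ^ 3 / euler_prod (nome \<tau>) ^ (2 * m - 1))"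
    unfolding w_def[symmetric] eta etam power_mult_distrib e1 using nz by (simp del: power_Suc)
qed


section \<open>Polynomials in Eisenstein series\<close>

definition eval_eis_monom :: "eis_monom \<Rightarrow> complex \<Rightarrow> complex" where
  "eval_eis_monom M \<tau> = (\<Prod>(i, d)\<in>Poly_Mapping.keys M.
     eisenstein_E (2 * i) (of_nat d * \<tau>) ^ Poly_Mapping.lookup M (i, d))"

definition eis_monom_weight :: "eis_monom \<Rightarrow> nat" where
  "eis_monom_weight M = (\<Sum>(i, d)\<in>Poly_Mapping.keys M. 2 * i * Poly_Mapping.lookup M (i, d))"

text \<open>Monomials with different supports have to be compared over a common finite index set;
  outside the support the factors are zeroth powers.\<close>

lemma eval_eis_monom_superset:
  assumes "finite S" "Poly_Mapping.keys M \<subseteq> S"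
  shows "eval_eis_monom M \<tau> = (\<Prod>(i, d)\<in>S. eisenstein_E (2 * i) (of_nat d * \<tau>) ^ Poly_Mapping.lookup M (i, d))"
  unfolding eval_eis_monom_def using assms
  by (intro prod.mono_neutral_left) (auto simp: in_keys_iff)

lemma eis_monom_weight_superset:
  assumes "finite S" "Poly_Mapping.keys M \<subseteq> S"
  shows "eis_monom_weight M = (\<Sum>(i, d)\<in>S. 2 * i * Poly_Mapping.lookup M (i, d))"
  unfolding eis_monom_weight_def using assms
  by (intro sum.mono_neutral_left) (auto simp: in_keys_iff)

lemma eval_eis_monom_add: "eval_eis_monom (M + N) \<tau> = eval_eis_monom M \<tau> * eval_eis_monom N \<tau>"
proof -
  let ?S = "Poly_Mapping.keys M \<union> Poly_Mapping.keys N"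
  have "eval_eis_monom (M + N) \<tau> =
      (\<Prod>(i, d)\<in>?S. eisenstein_E (2 * i) (of_nat d * \<tau>) ^ Poly_Mapping.lookup (M + N) (i, d))"
    by (rule eval_eis_monom_superset) (auto simp: keys_add)
  also have "\<dots> = (\<Prod>(i, d)\<in>?S. eisenstein_E (2 * i) (of_nat d * \<tau>) ^ Poly_Mapping.lookup M (i, d)) *
      (\<Prod>(i, d)\<in>?S. eisenstein_E (2 * i) (of_nat d * \<tau>) ^ Poly_Mapping.lookup N (i, d))"
    by (simp add: lookup_add power_add case_prod_beta prod.distrib)
  also have "\<dots> = eval_eis_monom M \<tau> * eval_eis_monom N \<tau>"
    by (simp add: eval_eis_monom_superset[of ?S])
  finally show ?thesis .
qed

lemma eis_monom_weight_add: "eis_monom_weight (M + N) = eis_monom_weight M + eis_monom_weight N"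
proof -
  let ?S = "Poly_Mapping.keys M \<union> Poly_Mapping.keys N"
  have "eis_monom_weight (M + N) = (\<Sum>(i, d)\<in>?S. 2 * i * Poly_Mapping.lookup (M + N) (i, d))"
    by (rule eis_monom_weight_superset) (auto simp: keys_add)
  also have "\<dots> = (\<Sum>(i, d)\<in>?S. 2 * i * Poly_Mapping.lookup M (i, d)) + (\<Sum>(i, d)\<in>?S. 2 * i * Poly_Mapping.lookup N (i, d))"
    by (simp add: lookup_add distrib_left case_prod_beta sum.distrib)
  also have "\<dots> = eis_monom_weight M + eis_monom_weight N"
    by (simp add: eis_monom_weight_superset[of ?S])
  finally show ?thesis .
qed

lemma eval_eis_poly_eq: "eval_eis_poly P \<tau> =
    (\<Sum>M\<in>Poly_Mapping.keys P. of_rat (Poly_Mapping.lookup P M) * eval_eis_monom M \<tau>)"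
  by (simp add: eval_eis_poly_def eval_eis_monom_def)

lemma eval_eis_poly_superset:
  assumes "finite S" "Poly_Mapping.keys P \<subseteq> S"
  shows "eval_eis_poly P \<tau> = (\<Sum>M\<in>S. of_rat (Poly_Mapping.lookup P M) * eval_eis_monom M \<tau>)"
  unfolding eval_eis_poly_eq using assms
  by (intro sum.mono_neutral_left) (auto simp: in_keys_iff)

lemma eval_eis_poly_add: "eval_eis_poly (P + Q) \<tau> = eval_eis_poly P \<tau> + eval_eis_poly Q \<tau>"
proof -
  let ?S = "Poly_Mapping.keys P \<union> Poly_Mapping.keys Q"
  have "eval_eis_poly (P + Q) \<tau> = (\<Sum>M\<in>?S. of_rat (Poly_Mapping.lookup (P + Q) M) * eval_eis_monom M \<tau>)"
    by (rule eval_eis_poly_superset) (auto simp: keys_add)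
  also have "\<dots> = (\<Sum>M\<in>?S. of_rat (Poly_Mapping.lookup P M) * eval_eis_monom M \<tau>) +
      (\<Sum>M\<in>?S. of_rat (Poly_Mapping.lookup Q M) * eval_eis_monom M \<tau>)"
    by (simp add: lookup_add of_rat_add distrib_right sum.distrib)
  also have "\<dots> = eval_eis_poly P \<tau> + eval_eis_poly Q \<tau>"
    by (simp add: eval_eis_poly_superset[of ?S])
  finally show ?thesis .
qed

section \<open>Functions given by homogeneous polynomials in Eisenstein series\<close>

text \<open>Closure of this class under sums, products and rational multiples replaces the explicit
  construction of the final polynomial, and the weight is carried along.\<close>

definition eis_form :: "nat \<Rightarrow> nat \<Rightarrow> (complex \<Rightarrow> complex) \<Rightarrow> bool" where
  "eis_form m k f \<longleftrightarrow> (\<exists>P. eis_poly_vars P \<subseteq> {1, 2, 3} \<times> {1, m} \<and> eis_weight_homogeneous k P \<and>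
     (\<forall>\<tau>\<in>upper_half_plane. f \<tau> = eval_eis_poly P \<tau>))"

lemma eis_weight_homogeneous_iff:
  "eis_weight_homogeneous k P \<longleftrightarrow> (\<forall>M\<in>Poly_Mapping.keys P. eis_monom_weight M = k)"
  by (simp add: eis_weight_homogeneous_def eis_monom_weight_def)

lemma eis_form_zero: "eis_form m k (\<lambda>_. 0)"
  unfolding eis_form_def
  by (rule exI[of _ 0]) (auto simp: eis_poly_vars_def eis_weight_homogeneous_def eval_eis_poly_def)

lemma eis_form_add:
  assumes "eis_form m k f" "eis_form m k g"
  shows "eis_form m k (\<lambda>\<tau>. f \<tau> + g \<tau>)"
proof -
  from assms(1) obtain P where P: "eis_poly_vars P \<subseteq> {1, 2, 3} \<times> {1, m}" "eis_weight_homogeneous k P"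
    "\<forall>\<tau>\<in>upper_half_plane. f \<tau> = eval_eis_poly P \<tau>" unfolding eis_form_def by blast
  from assms(2) obtain Q where Q: "eis_poly_vars Q \<subseteq> {1, 2, 3} \<times> {1, m}" "eis_weight_homogeneous k Q"
    "\<forall>\<tau>\<in>upper_half_plane. g \<tau> = eval_eis_poly Q \<tau>" unfolding eis_form_def by blast
  have keys: "Poly_Mapping.keys (P + Q) \<subseteq> Poly_Mapping.keys P \<union> Poly_Mapping.keys Q" by (rule keys_add)
  have "eis_poly_vars (P + Q) \<subseteq> eis_poly_vars P \<union> eis_poly_vars Q"
    using keys unfolding eis_poly_vars_def by blast
  hence "eis_poly_vars (P + Q) \<subseteq> {1, 2, 3} \<times> {1, m}" using P(1) Q(1) by blast
  moreover have "eis_weight_homogeneous k (P + Q)"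
    using keys P(2) Q(2) unfolding eis_weight_homogeneous_iff by blast
  ultimately show ?thesis unfolding eis_form_def using P(3) Q(3)
    by (intro exI[of _ "P + Q"]) (auto simp: eval_eis_poly_add)
qed

lemma eis_form_sum: "(\<And>i. i \<in> A \<Longrightarrow> eis_form m k (f i)) \<Longrightarrow> eis_form m k (\<lambda>\<tau>. \<Sum>i\<in>A. f i \<tau>)"
  by (induction A rule: infinite_finite_induct) (auto intro: eis_form_add eis_form_zero)

lemma eis_form_cong:
  assumes "eis_form m k f" "\<And>\<tau>. Im \<tau> > 0 \<Longrightarrow> f \<tau> = g \<tau>"
  shows "eis_form m k g"
  using assms unfolding eis_form_def by auto

lemma eis_form_monom:
  assumes "Poly_Mapping.keys M \<subseteq> {1, 2, 3} \<times> {1, m}" "eis_monom_weight M = k"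
  shows "eis_form m k (\<lambda>\<tau>. of_rat c * eval_eis_monom M \<tau>)"
  unfolding eis_form_def using assms
  by (intro exI[of _ "Poly_Mapping.single M c"])
     (auto simp: eis_poly_vars_def eis_weight_homogeneous_iff eval_eis_poly_eq split: if_splits)

lemma eis_form_const: "eis_form m 0 (\<lambda>_. of_rat c)"
  using eis_form_monom[of 0 m 0 c] by (simp add: eis_monom_weight_def eval_eis_monom_def)

lemma eis_form_gen:
  assumes "i \<in> {1, 2, 3}" "d \<in> {1, m}"
  shows "eis_form m (2 * i) (\<lambda>\<tau>. eisenstein_E (2 * i) (of_nat d * \<tau>))"
  using eis_form_monom[of "Poly_Mapping.single (i, d) 1" m "2 * i" 1] assms
  by (auto simp: eis_monom_weight_def eval_eis_monom_def)

text \<open>The product is expanded into a double sum of monomials, so multiplicativity of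
  \<open>eval_eis_monom\<close> and additivity of the weight suffice.\<close>

lemma eis_form_mult:
  assumes "eis_form m k f" "eis_form m l g"
  shows "eis_form m (k + l) (\<lambda>\<tau>. f \<tau> * g \<tau>)"
proof -
  from assms(1) obtain P where P: "eis_poly_vars P \<subseteq> {1, 2, 3} \<times> {1, m}" "eis_weight_homogeneous k P"
    "\<forall>\<tau>\<in>upper_half_plane. f \<tau> = eval_eis_poly P \<tau>" unfolding eis_form_def by blast
  from assms(2) obtain Q where Q: "eis_poly_vars Q \<subseteq> {1, 2, 3} \<times> {1, m}" "eis_weight_homogeneous l Q"
    "\<forall>\<tau>\<in>upper_half_plane. g \<tau> = eval_eis_poly Q \<tau>" unfolding eis_form_def by blast
  have "eis_form m (k + l) (\<lambda>\<tau>. \<Sum>M\<in>Poly_Mapping.keys P. \<Sum>N\<in>Poly_Mapping.keys Q.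
      of_rat (Poly_Mapping.lookup P M * Poly_Mapping.lookup Q N) * eval_eis_monom (M + N) \<tau>)"
  proof (intro eis_form_sum eis_form_monom)
    fix M N assume MN: "M \<in> Poly_Mapping.keys P" "N \<in> Poly_Mapping.keys Q"
    have "Poly_Mapping.keys M \<subseteq> {1, 2, 3} \<times> {1, m}" "Poly_Mapping.keys N \<subseteq> {1, 2, 3} \<times> {1, m}"
      using MN P(1) Q(1) unfolding eis_poly_vars_def by blast+
    thus "Poly_Mapping.keys (M + N) \<subseteq> {1, 2, 3} \<times> {1, m}" using keys_add[of M N] by blast
    show "eis_monom_weight (M + N) = k + l"
      using MN P(2) Q(2) by (simp add: eis_monom_weight_add eis_weight_homogeneous_iff)
  qed
  thus ?thesis
  proof (rule eis_form_cong)
    fix \<tau> :: complex assume "Im \<tau> > 0"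
    thus "(\<Sum>M\<in>Poly_Mapping.keys P. \<Sum>N\<in>Poly_Mapping.keys Q.
      of_rat (Poly_Mapping.lookup P M * Poly_Mapping.lookup Q N) * eval_eis_monom (M + N) \<tau>) = f \<tau> * g \<tau>"
      using P(3) Q(3)
      by (simp add: eval_eis_poly_eq sum_product of_rat_mult eval_eis_monom_add mult_ac)
  qed
qed

lemma eis_form_cmult:
  assumes "eis_form m k f" "c \<in> \<rat>"
  shows "eis_form m k (\<lambda>\<tau>. c * f \<tau>)"
proof -
  from assms(2) obtain r where "c = of_rat r" by (rule Rats_cases)
  thus ?thesis using eis_form_mult[OF eis_form_const[of m r] assms(1)] by simp
qed

lemma eisenstein_from_theta_ld_coeff:
  assumes "i \<in> {1, 2, 3}"
  shows "theta_ld_coeff (2 * i) (nome \<tau>) = of_real (bernoulli (2 * i) / fact (2 * i)) * eisenstein_E (2 * i) \<tau>"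
    and "bernoulli (2 * i) \<noteq> 0" and "complex_of_real (bernoulli (2 * i) / fact (2 * i)) \<in> \<rat>"
proof -
  have B: "bernoulli (2 * i) \<in> {1 / 6, - 1 / 30, 1 / 42}"
    using assms bernoulli_values by auto
  thus nz: "bernoulli (2 * i) \<noteq> 0" by auto
  show "theta_ld_coeff (2 * i) (nome \<tau>) = of_real (bernoulli (2 * i) / fact (2 * i)) * eisenstein_E (2 * i) \<tau>"
    using assms nz by (intro theta_ld_coeff_eq_eisenstein) auto
  have "(1 / 6 :: real) \<in> \<rat>" "(- 1 / 30 :: real) \<in> \<rat>" "(1 / 42 :: real) \<in> \<rat>" by simp_all
  hence "bernoulli (2 * i) \<in> \<rat>" using B by (metis empty_iff insert_iff)
  hence "complex_of_real (bernoulli (2 * i)) \<in> \<rat>" by (auto elim!: Rats_cases)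
  moreover have "(fact (2 * i) :: complex) \<in> \<rat>" by (metis of_nat_fact Rats_of_nat)
  ultimately show "complex_of_real (bernoulli (2 * i) / fact (2 * i)) \<in> \<rat>" by simp
qed

text \<open>The recurrence is solved for the coefficient of index \<open>n = k + 4\<close>. Its
  factor \<open>(k + 1) * (k + 2) - 12\<close> vanishes at \<open>k = 2\<close>, which is why
  \<open>n = 6\<close> has to be a generator besides \<open>n = 2\<close> and \<open>n = 4\<close>;
  for \<open>k \<ge> 4\<close> it is nonzero, and all coefficients on the right have smaller
  index.\<close>

lemma eis_form_theta_ld_coeff:
  assumes d: "d \<in> {1, m}" and m: "m > 0"
  shows "eis_form m n (\<lambda>\<tau>. theta_ld_coeff n (nome (of_nat d * \<tau>)))"
proof (induction n rule: less_induct)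
  case (less n)
  have d0: "d > 0" using d m by auto
  consider "n = 0" | "odd n" | i where "i \<in> {1, 2, 3}" "n = 2 * i" | k where "k \<ge> 4" "n = k + 4"
  proof -
    assume *: "n = 0 \<Longrightarrow> thesis" "odd n \<Longrightarrow> thesis" "\<And>i. i \<in> {1, 2, 3} \<Longrightarrow> n = 2 * i \<Longrightarrow> thesis"
      "\<And>k. k \<ge> 4 \<Longrightarrow> n = k + 4 \<Longrightarrow> thesis"
    show thesis
    proof (cases "n < 8")
      case True
      hence "n = 0 \<or> odd n \<or> n = 2 * 1 \<or> n = 2 * 2 \<or> n = 2 * 3" by presburger
      thus thesis using *(1,2) *(3)[of 1] *(3)[of 2] *(3)[of 3] by auto
    next
      case False
      thus thesis using *(4)[of "n - 4"] by simp
    qed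
  qed
  thus ?case
  proof cases
    case 1
    thus ?thesis using eis_form_const[of m 1] by (simp add: theta_ld_coeff_def)
  next
    case 2
    hence "theta_ld_coeff n q = 0" for q by (cases "n = 0") (auto simp: theta_ld_coeff_def)
    thus ?thesis by (simp add: eis_form_zero)
  next
    case (3 i)
    show ?thesis unfolding 3(2) eisenstein_from_theta_ld_coeff(1)[OF 3(1)]
      by (intro eis_form_cmult eis_form_gen d 3(1) eisenstein_from_theta_ld_coeff(3))
  next
    case (4 k)
    define r where "r = (- 6 / ((of_nat (k + 1) * of_nat (k + 2) - 12) * of_nat (k + 3)) :: complex)"
    have "eis_form m n (\<lambda>\<tau>. r * (\<Sum>i\<in>{0<..<k}. of_nat ((i + 1) * (k - i + 1)) *
       (theta_ld_coeff (i + 2) (nome (of_nat d * \<tau>)) * theta_ld_coeff (k - i + 2) (nome (of_nat d * \<tau>)))))"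
    proof (intro eis_form_cmult eis_form_sum Rats_of_nat)
      fix i assume i: "i \<in> {0<..<k}"
      have "eis_form m ((i + 2) + (k - i + 2)) (\<lambda>\<tau>. theta_ld_coeff (i + 2) (nome (of_nat d * \<tau>)) *
          theta_ld_coeff (k - i + 2) (nome (of_nat d * \<tau>)))"
        by (intro eis_form_mult less.IH) (use i 4 in auto)
      moreover have "(i + 2) + (k - i + 2) = n" using i 4 by auto
      ultimately show "eis_form m n (\<lambda>\<tau>. theta_ld_coeff (i + 2) (nome (of_nat d * \<tau>)) *
          theta_ld_coeff (k - i + 2) (nome (of_nat d * \<tau>)))" by simp
    next
      show "r \<in> \<rat>" unfolding r_def
        by (intro Rats_divide Rats_mult Rats_diff Rats_of_nat Rats_number_of Rats_minus_iff[THEN iffD2])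
    qed
    thus ?thesis
    proof (rule eis_form_cong)
      fix \<tau> :: complex assume "Im \<tau> > 0"
      hence w: "Re (two_pi_i * (of_nat d * \<tau>)) < 0" using d0 by (simp add: mult_less_0_iff)
      have nz: "(of_nat (k + 1) * of_nat (k + 2) - 12) * of_nat (k + 3) \<noteq> (0 :: complex)"
      proof -
        have "(k + 1) * (k + 2) \<ge> 5 * 6" using 4 by (intro mult_mono) auto
        hence "(k + 1) * (k + 2) \<noteq> 12" by linarith
        hence "of_nat ((k + 1) * (k + 2)) \<noteq> (of_nat 12 :: complex)" by (metis of_nat_eq_iff)
        thus ?thesis by (simp only: of_nat_mult of_nat_numeral mult_eq_0_iff right_minus_eq of_nat_eq_0_iff) simp
      qed
      show "r * (\<Sum>i\<in>{0<..<k}. of_nat ((i + 1) * (k - i + 1)) *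
       (theta_ld_coeff (i + 2) (nome (of_nat d * \<tau>)) * theta_ld_coeff (k - i + 2) (nome (of_nat d * \<tau>)))) =
       theta_ld_coeff n (nome (of_nat d * \<tau>))"
        using theta_ld_coeff_recurrence[OF w, of k] 4 nz
        unfolding r_def 4(2) by (simp only: mult.assoc[symmetric] times_divide_eq_left nonzero_divide_eq_eq[OF nz]) (simp add: mult_ac)
    qed
  qed
qed

lemma eis_form_phi_coeff:
  assumes m: "m > 0"
  shows "eis_form m n (\<lambda>\<tau>. phi_coeff m n (nome \<tau>))"
proof (induction n rule: less_induct)
  case (less n)
  show ?case
  proof (cases n)
    case 0
    thus ?thesis using eis_form_const[of m "of_nat m"] by simp
  next
    case (Suc k)
    have N1: "eis_form m i (\<lambda>\<tau>. theta_ld_coeff i (nome \<tau>))" for i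
      using eis_form_theta_ld_coeff[of 1 m i] m by simp
    have N2: "eis_form m i (\<lambda>\<tau>. theta_ld_coeff i (nome \<tau> ^ m))" for i
      using eis_form_theta_ld_coeff[of m m i] m by (simp add: exp_of_nat_mult[symmetric] mult_ac)
    have "eis_form m n (\<lambda>\<tau>. inverse (of_nat (Suc k)) * (\<Sum>i\<le>k. (of_nat m ^ Suc i * theta_ld_coeff (Suc i) (nome \<tau> ^ m) +
       - of_nat m * theta_ld_coeff (Suc i) (nome \<tau>)) * phi_coeff m (k - i) (nome \<tau>)))"
    proof (intro eis_form_cmult eis_form_sum)
      fix i assume "i \<in> {..k}"
      hence i: "n = Suc i + (k - i)" "k - i < n" using Suc by auto
      have "eis_form m (Suc i + (k - i)) (\<lambda>\<tau>. (of_nat m ^ Suc i * theta_ld_coeff (Suc i) (nome \<tau> ^ m) +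
         - of_nat m * theta_ld_coeff (Suc i) (nome \<tau>)) * phi_coeff m (k - i) (nome \<tau>))"
        by (intro eis_form_mult eis_form_add eis_form_cmult N1 N2 less.IH i(2)) auto
      thus "eis_form m n (\<lambda>\<tau>. (of_nat m ^ Suc i * theta_ld_coeff (Suc i) (nome \<tau> ^ m) +
         - of_nat m * theta_ld_coeff (Suc i) (nome \<tau>)) * phi_coeff m (k - i) (nome \<tau>))"
        by (simp only: i(1)[symmetric])
    qed (auto intro: Rats_inverse Rats_of_nat simp del: of_nat_Suc)
    thus ?thesis unfolding Suc phi_coeff.simps by (simp add: divide_inverse mult.commute del: of_nat_Suc)
  qed
qed

lemma eis_form_phi_const:
  assumes m: "odd m"
  shows "eis_form m (m - 1) (\<lambda>\<tau>. phi_const m (nome \<tau>))"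
proof -
  define M where "M = (m - 1) div 2"
  have m0: "m > 0" using m by (cases m) auto
  have mM: "m - 1 = 2 * M" using m by (auto simp: M_def elim!: oddE)
  have N1: "eis_form m i (\<lambda>\<tau>. theta_ld_coeff i (nome \<tau>))" for i
    using eis_form_theta_ld_coeff[of 1 m i] m0 by simp
  have "eis_form m (2 * M) (\<lambda>\<tau>. \<Sum>k\<le>M. phi_coeff m (2 * (M - k)) (nome \<tau>) * theta_ld_coeff (2 * k) (nome \<tau>))"
  proof (intro eis_form_sum)
    fix k assume "k \<in> {..M}"
    hence "2 * M = 2 * (M - k) + 2 * k" by auto
    moreover have "eis_form m (2 * (M - k) + 2 * k) (\<lambda>\<tau>. phi_coeff m (2 * (M - k)) (nome \<tau>) * theta_ld_coeff (2 * k) (nome \<tau>))"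
      by (intro eis_form_mult eis_form_phi_coeff N1 m0)
    ultimately show "eis_form m (2 * M) (\<lambda>\<tau>. phi_coeff m (2 * (M - k)) (nome \<tau>) * theta_ld_coeff (2 * k) (nome \<tau>))"
      by metis
  qed
  thus ?thesis unfolding phi_const_def M_def[symmetric] by (simp only: mM)
qed

section \<open>Quasi-modularity of polynomials in Eisenstein series\<close>

lemma quasimodular_eisenstein_E:
  assumes i: "i \<in> {1, 2, 3}" and d: "d \<in> {1, m}" and m: "m > 0"
  shows "quasimodular_form (Gamma0 m) (2 * i) (\<lambda>\<tau>. eisenstein_E (2 * i) (of_nat d * \<tau>))"
proof -
  let ?b = "complex_of_real (bernoulli (2 * i) / fact (2 * i))"
  have "?b \<noteq> 0" using eisenstein_from_theta_ld_coeff(2)[OF i] by simp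
  moreover have "quasimodular_form (Gamma0 m) (2 * i) (\<lambda>\<tau>. inverse ?b * theta_ld_coeff (2 * i) (nome (of_nat d * \<tau>)))"
    by (intro quasimodular_form_cmult quasimodular_theta_ld_coeff) (use i d m in auto)
  ultimately show ?thesis
    by (elim quasimodular_form_cong) (simp only: eisenstein_from_theta_ld_coeff(1)[OF i], simp)
qed

lemma quasimodular_form_of_eis_form:
  assumes m: "m > 0" and f: "eis_form m k f"
  shows "quasimodular_form (Gamma0 m) k f"
proof -
  from f obtain P where P: "eis_poly_vars P \<subseteq> {1, 2, 3} \<times> {1, m}" "eis_weight_homogeneous k P"
    "\<forall>\<tau>\<in>upper_half_plane. f \<tau> = eval_eis_poly P \<tau>" unfolding eis_form_def by blast
  have "quasimodular_form (Gamma0 m) k (\<lambda>\<tau>. eval_eis_poly P \<tau>)"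
    unfolding eval_eis_poly_eq
  proof (intro quasimodular_form_sum quasimodular_form_cmult)
    fix M assume M: "M \<in> Poly_Mapping.keys P"
    have "quasimodular_form (Gamma0 m) (\<Sum>p\<in>Poly_Mapping.keys M. 2 * fst p * Poly_Mapping.lookup M p)
       (\<lambda>\<tau>. \<Prod>p\<in>Poly_Mapping.keys M. eisenstein_E (2 * fst p) (of_nat (snd p) * \<tau>) ^ Poly_Mapping.lookup M p)"
    proof (intro quasimodular_form_prod quasimodular_form_power quasimodular_eisenstein_E m finite_keys)
      fix p assume "p \<in> Poly_Mapping.keys M"
      hence "p \<in> {1, 2, 3} \<times> {1, m}" using M P(1) unfolding eis_poly_vars_def by blast
      thus "fst p \<in> {1, 2, 3}" "snd p \<in> {1, m}" by (simp_all only: mem_Times_iff)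
    qed
    moreover have "(\<Sum>p\<in>Poly_Mapping.keys M. 2 * fst p * Poly_Mapping.lookup M p) = k"
      using P(2) M by (simp add: eis_weight_homogeneous_def case_prod_beta)
    ultimately show "quasimodular_form (Gamma0 m) k (eval_eis_monom M)"
      by (simp add: eval_eis_monom_def[abs_def] case_prod_beta)
  qed
  thus ?thesis by (rule quasimodular_form_cong) (use P(3) in auto)
qed


section \<open>The normalising constant\<close>

text \<open>The constant term is \<open>qpow \<tau> ((real m + 1) / 24)\<close> times
  \<open>e * (\<i> / \<i> ^ m) * h q\<close> with \<open>h\<close> holomorphic on the unit disc and
  \<open>h 0 = 1\<close>, by \<open>phi_const_0\<close>. The Taylor series of \<open>h\<close>
  proves existence, and the leading coefficient determines \<open>e\<close>.\<close>

lemma epsilon_const_eq: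
  assumes m: "odd m"
  shows "epsilon_const m = \<i> ^ m / \<i>"
proof -
  have m0: "m > 0" using m by (cases m) auto
  define h where "h = (\<lambda>q. euler_prod (q ^ m) ^ 3 / euler_prod q ^ (2 * m - 1) * phi_const m q)"
  have h_hol: "h holomorphic_on ball 0 1"
    unfolding h_def phi_const_def[abs_def]
    by (intro holomorphic_intros holomorphic_euler_prod holomorphic_phi_coeff holomorphic_theta_ld_coeff m0
          holomorphic_on_compose_gen[OF _ holomorphic_euler_prod, unfolded o_def])
       (use m0 in \<open>auto simp: norm_power power_less_one_iff\<close>)
  have h0: "h 0 = 1" using m0 by (simp add: h_def zero_power phi_const_0[OF m])
  have ct: "constant_term \<tau> (F_scaled e m \<tau>) = qpow \<tau> ((real m + 1) / 24) * (e * (\<i> / \<i> ^ m) * h (nome \<tau>))"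
    if "Im \<tau> > 0" for e \<tau>
    unfolding constant_term_F_scaled(1)[OF that m] constant_term_F_scaled(2)[OF that m] h_def
    by (simp only: mult_ac)
  have q1: "qpow \<tau> 1 = nome \<tau>" for \<tau> by (simp add: qpow_def)
  show ?thesis unfolding epsilon_const_def
  proof (rule the_equality, intro conjI)
    define c where "c = (\<lambda>n. (deriv ^^ n) h 0 / fact n)"
    have "c 0 = 1" by (simp add: c_def h0)
    moreover have "(\<lambda>n. c n * qpow \<tau> 1 ^ n) sums h (nome \<tau>)" if "Im \<tau> > 0" for \<tau>
      using holomorphic_power_series[OF h_hol, of "nome \<tau>"] that by (simp add: c_def q1)
    moreover have "constant_term \<tau> (F_scaled (\<i> ^ m / \<i>) m \<tau>) = qpow \<tau> ((real m + 1) / 24) * h (nome \<tau>)"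
      if "Im \<tau> > 0" for \<tau>
      unfolding ct[OF that] by simp
    ultimately show "\<exists>c :: nat \<Rightarrow> complex. c 0 = 1 \<and> (\<forall>\<tau>\<in>upper_half_plane. \<exists>s. (\<lambda>n. c n * qpow \<tau> 1 ^ n) sums s \<and>
        constant_term \<tau> (F_scaled (\<i> ^ m / \<i>) m \<tau>) = qpow \<tau> ((real m + 1) / 24) * s)"
      by (intro exI[of _ c]) auto
  next
    fix e
    assume "e \<noteq> 0 \<and> (\<exists>c :: nat \<Rightarrow> complex. c 0 = 1 \<and> (\<forall>\<tau>\<in>upper_half_plane. \<exists>s. (\<lambda>n. c n * qpow \<tau> 1 ^ n) sums s \<and>
        constant_term \<tau> (F_scaled e m \<tau>) = qpow \<tau> ((real m + 1) / 24) * s))"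
    then obtain c :: "nat \<Rightarrow> complex" where c0: "c 0 = 1"
      and c: "\<And>\<tau>. Im \<tau> > 0 \<Longrightarrow> \<exists>s. (\<lambda>n. c n * qpow \<tau> 1 ^ n) sums s \<and>
        constant_term \<tau> (F_scaled e m \<tau>) = qpow \<tau> ((real m + 1) / 24) * s" by auto
    \<comment> \<open>Every \<open>q\<close> in the punctured disc is the nome of some
      \<open>\<tau>\<close>, obtained from a logarithm; the conditions over all
      \<open>\<tau>\<close> thus become one power series in \<open>q\<close>.\<close>
    have sums: "(\<lambda>n. c n * q ^ n) sums (e * (\<i> / \<i> ^ m) * h q)" if q: "q \<noteq> 0" "norm q < 1" for q
    proof -
      define \<tau> where "\<tau> = Ln q / two_pi_i"
      have nq: "nome \<tau> = q" using q(1) by (simp add: \<tau>_def)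
      have "Re (two_pi_i * \<tau>) < 0" using q by (simp add: \<tau>_def Re_Ln)
      hence \<tau>: "Im \<tau> > 0" by (simp add: zero_less_mult_iff)
      from c[OF \<tau>] obtain s where s: "(\<lambda>n. c n * q ^ n) sums s"
        "qpow \<tau> ((real m + 1) / 24) * (e * (\<i> / \<i> ^ m) * h q) = qpow \<tau> ((real m + 1) / 24) * s"
        unfolding ct[OF \<tau>] q1 nq by blast
      have "qpow \<tau> ((real m + 1) / 24) \<noteq> 0" by (simp add: qpow_def)
      hence "s = e * (\<i> / \<i> ^ m) * h q" using s(2) by (metis mult_left_cancel)
      thus ?thesis using s(1) by simp
    qed
    \<comment> \<open>The identity is known only for \<open>q \<noteq> 0\<close>; the limit at
      \<open>0\<close> recovers the constant coefficient of the power series.\<close>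
    have "(\<lambda>q. e * (\<i> / \<i> ^ m) * h q) \<midarrow>0\<rightarrow> c 0"
      by (rule powser_limit_0_strong[of 1]) (use sums in auto)
    moreover have "(\<lambda>q. e * (\<i> / \<i> ^ m) * h q) \<midarrow>0\<rightarrow> e * (\<i> / \<i> ^ m) * h 0"
      using holomorphic_on_imp_continuous_on[OF h_hol]
      by (intro tendsto_intros) (simp add: continuous_on_eq_continuous_at isCont_def)
    ultimately have "e * (\<i> / \<i> ^ m) = 1" using LIM_unique c0 h0 by fastforce
    moreover have "e = (\<i> ^ m / \<i>) * (e * (\<i> / \<i> ^ m))" by (simp add: field_simps)
    ultimately show "e = \<i> ^ m / \<i>" by (simp only: mult_1_right)
  qed simp
qed

theorem theorem1p8:
  fixes m :: nat
    and scale :: "complex \<Rightarrow> 'v::ab_group_add \<Rightarrow> 'v"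
    and U :: "parity \<Rightarrow> nat \<Rightarrow> 'v set"
    and sch :: "complex \<Rightarrow> complex"
  assumes "m \<ge> 3" and "odd m"
    and "graded_superspace scale U"
    and sch_def: "sch = graded_superspace.supercharacter scale U (- (real m + 1))"
    and Adamovic_Milas: "\<And>\<tau>. \<tau> \<in> upper_half_plane \<Longrightarrow> sch \<tau> = constant_term \<tau> (F_fun m \<tau>)"
  shows "\<exists>FF :: complex \<Rightarrow> complex.
    (\<forall>\<tau>\<in>upper_half_plane.
       sch \<tau> = dedekind_eta (of_nat m * \<tau>) ^ 3 / dedekind_eta \<tau> ^ (2 * m - 1) * FF \<tau>) \<and>
    (\<exists>k. quasimodular_form (Gamma0 m) k FF \<and>
       (\<exists>P :: eis_poly. eis_poly_vars P \<subseteq> {1, 2, 3} \<times> {1, m} \<and>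
          eis_weight_homogeneous k P \<and>
          (\<forall>\<tau>\<in>upper_half_plane. FF \<tau> = eval_eis_poly P \<tau>)))"
proof -
  have m0: "m > 0" using assms(1) by simp
  let ?FF = "\<lambda>\<tau>. phi_const m (nome \<tau>)"
  have form: "eis_form m (m - 1) ?FF" by (rule eis_form_phi_const[OF assms(2)])
  have sch: "sch \<tau> = dedekind_eta (of_nat m * \<tau>) ^ 3 / dedekind_eta \<tau> ^ (2 * m - 1) * ?FF \<tau>"
    if "\<tau> \<in> upper_half_plane" for \<tau>
  proof -
    have "sch \<tau> = constant_term \<tau> (F_scaled (\<i> ^ m / \<i>) m \<tau>)"
      using Adamovic_Milas[OF that] by (simp add: F_fun_def epsilon_const_eq[OF assms(2)])
    also have "\<dots> = (\<i> ^ m / \<i>) * (\<i> / \<i> ^ m) *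
      (dedekind_eta (of_nat m * \<tau>) ^ 3 / dedekind_eta \<tau> ^ (2 * m - 1) * ?FF \<tau>)"
      using that by (intro constant_term_F_scaled(1) assms(2)) simp
    finally show ?thesis by simp
  qed
  show ?thesis
    using sch quasimodular_form_of_eis_form[OF m0 form] form unfolding eis_form_def
    by (intro exI[of _ ?FF] conjI exI[of _ "m - 1"]) auto
qed

end
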